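(* Let $E\to M$ be an exact Courant algebroid, $d=\dim M\ge2$, with (semi-Riemannian) generalised metric $\mathcal G$ and divergence operator $\mathrm{div}=\mathrm{div}^{\mathcal G}-\langle e,\cdot\rangle$, $e\in\Gamma(E)$, and let $D=D^{\mathcal G,\mathrm{div}}$ be the canonical generalised Levi-Civita connection. The trace of the full generalised Ricci tensor with respect to the scalar product $\langle\cdot,\cdot\rangle$ is given by $$\mathrm{tr}_E\,\overline{\mathcal{R}c}^D=2\,\mathrm{div}_g(e)-\left(|e_+|^2_{\mathcal G}-|e_-|^2_{\mathcal G}\right).$$
   Context: **Setting.** $(E,\pi,\langle\cdot,\cdot\rangle,[\cdot,\cdot])$ is an exact Courant algebroid over $M$: the bracket is the Dorfman bracket and $0\to T^*M\to E\xrightarrow{\pi}TM\to0$ is exact. A (semi-Riemannian) generalised metric is a nondegenerate symmetric bilinear form $\mathcal G$ on $E$ such that the endomorphism $\mathcal G^{\mathrm{End}}$ defined by $\langle\mathcal G^{\mathrm{End}}u,v\rangle=\mathcal G(u,v)$ is an involution and $\mathcal G|_{T^*M}$ is nondegenerate. $E_\pm$ are the $\pm1$-eigenbundles of $\mathcal G^{\mathrm{End}}$, so $E=E_+\oplus E_-$ orthogonally and $\mathcal G=\pm\langle\cdot,\cdot\rangle$ on $E_\pm$. The maps $\pi_\pm=\pi|_{E_\pm}:E_\pm\to TM$ are isomorphisms, and $g$ is the semi-Riemannian metric on $M$ with $(\pi_\pm)^*g=\mathcal G|_{E_\pm\times E_\pm}$. $\nabla$ is the Levi-Civita connection of $g$.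 The scalar product is normalised so that $E$ is identified with $TM\oplus T^*M$ with $\langle X+\xi,Y+\zeta\rangle=\frac12(\xi(Y)+\zeta(X))$ and the Dorfman bracket $[X+\xi,Y+\zeta]_H=\mathcal L_XY+\mathcal L_X\zeta-\iota_Yd\xi+H(X,Y,\cdot)$ twisted by a closed three-form $H$, via $\phi|_{E_\pm}=(1\pm g)\circ\pi_\pm$. **Generalised connections.** A generalised connection is an $\mathbb R$-bilinear map $D:\Gamma(E)\times\Gamma(E)\to\Gamma(E)$, $(u,v)\mapsto D_uv$, $C^\infty(M)$-linear in $u$, with $D_u(fv)=(\pi(u)f)v+fD_uv$ and $\pi(u)\langle v,w\rangle=\langle D_uv,w\rangle+\langle v,D_uw\rangle$. Its torsion is $T(u,v,w)=\langle D_uv-D_vu-[u,v],w\rangle+\langle D_wu,v\rangle$. It is metric if $D\mathcal G=0$ (equivalently $D$ preserves $E_\pm$); a generalised Levi-Civita connection is a torsion-free metric generalised connection. A divergence operator is an $\mathbb R$-linear map $\mathrm{div}:\Gamma(E)\to C^\infty(M)$ with $\mathrm{div}(fv)=\pi(v)f+f\,\mathrm{div}(v)$; $D$ has divergence $\mathrm{div}^D(v)=\mathrm{tr}(u\mapsto D_uv)$. The metric divergence is $\mathrm{div}^{\mathcal G}=\mathrm{div}^g\circ\pi$, with $\mathrm{div}^g=\mathrm{div}_g$ the divergence of $g$ on vector fields. **Canonical generalised Levi-Civita connection.** Let $\widetilde D$ be the generalised connection with $\widetilde D_u=\pi_\pm^{-1}\circ\nabla_{\pi(u)}\circ\pi_\pm$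 on $\Gamma(E_\pm)$ for $u\in\Gamma(E_\pm)$, and $\widetilde D_u=[u,\cdot]_\mp$ on $\Gamma(E_\mp)$ for $u\in\Gamma(E_\pm)$ (subscripts on brackets denote projection to $E_\mp$). Its torsion $\widetilde T$ is totally skew; $D^0$ is defined by $\langle D^0_uv,w\rangle=\langle\widetilde D_uv,w\rangle-\frac13\widetilde T(u,v,w)$; it is a generalised Levi-Civita connection with divergence $\mathrm{div}^{\mathcal G}$. Let $\mathfrak{so}(E)_{\mathcal G}^{\langle1\rangle}$ be the bundle of $S\in E^*\otimes\mathfrak{so}(E)$, $S_u$ preserving $E_\pm$, with $\sum_{\mathrm{cycl}}\langle S_uv,w\rangle=0$; put $\mathrm{tr}(S)(v)=\mathrm{tr}(u\mapsto S_uv)$. $D^{\mathcal G,\mathrm{div}}$ is the unique generalised Levi-Civita connection with divergence $\mathrm{div}$ such that $D^{\mathcal G,\mathrm{div}}-D^0$ is pointwise orthogonal, with respect to the scalar product induced by $\langle\cdot,\cdot\rangle$, to $\ker(\mathrm{tr}:\mathfrak{so}(E)_{\mathcal G}^{\langle1\rangle}\to E^* )$. (Explicitly, $D^{\mathcal G,\mathrm{div}}-D^0=\frac1{d-1}(\chi_+^{e_+}+\chi_-^{e_-})$ with $\chi_\pm^{e_\pm}(a,b)=\langle a,b\rangle e_\pm-\langle e_\pm,b\rangle a$ for $a,b\in E_\pm$, extended by zero.) **Curvature.** With $D^2_{v,w}=D_vD_w-D_{D_vw}$ the generalised Riemann tensor is the section of $\mathrm{Sym}^2\Lambda^2E^*$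 $$\mathcal{R}m^D(a,b,v,w)=\tfrac12\Big\{\langle(D^2_{v,w}-D^2_{w,v})b,a\rangle+\langle(D^2_{b,a}-D^2_{a,b})v,w\rangle-\mathrm{tr}_E(\langle Dv,w\rangle\langle Db,a\rangle)\Big\},$$ where $\mathrm{tr}_E$ is the trace with respect to $\langle\cdot,\cdot\rangle$ in the dotted slots: $\mathrm{tr}_E\,B=\sum_IB(e_I,e^I)$ for a local frame $(e_I)$ of $E$ and the frame $(e^I)$ with $\langle e^I,e_J\rangle=\delta^I_J$. The full generalised Ricci tensor is $\overline{\mathcal{R}c}^D(a,b)=\mathrm{tr}_E\,\mathcal{R}m^D(\cdot,a,\cdot,b)$ for $a,b\in\Gamma(E)$. **Notation.** $e_\pm$ are the projections of $e$ to $E_\pm$; $|e_\pm|^2_{\mathcal G}=\mathcal G(e_\pm,e_\pm)$; $\mathrm{div}_g(e)=\mathrm{div}_g(\pi e)$. *)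

theory Defs
  imports "HOL-Analysis.Analysis" "HOL-Library.Function_Algebras"
begin

section \<open>Smooth manifolds, functions and vector fields\<close>

text \<open>
  Only meant for open S. In finite dimensions a map is of class C^(k+1) on an open set iff it is
  differentiable and all its directional derivatives are of class C^k.
\<close>

fun Ck_on :: "nat \<Rightarrow> 'a::euclidean_space set \<Rightarrow> ('a \<Rightarrow> 'b::euclidean_space) \<Rightarrow> bool" where
  "Ck_on 0 S f \<longleftrightarrow> continuous_on S f"
| "Ck_on (Suc k) S f \<longleftrightarrow>
     (\<forall>x\<in>S. f differentiable (at x)) \<and> (\<forall>v. Ck_on k S (\<lambda>x. frechet_derivative f (at x) v))"

definition smooth_on :: "'a::euclidean_space set \<Rightarrow> ('a \<Rightarrow> 'b::euclidean_space) \<Rightarrow> bool" where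
  "smooth_on S f \<longleftrightarrow> (\<forall>k. Ck_on k S f)"

type_synonym ('m, 'n) atlas = "('m set \<times> ('m \<Rightarrow> 'n)) set"

text \<open>
  The manifold is the whole (Hausdorff, second countable) type 'm; its dimension is DIM('n). A chart
  is a pair of an open domain and a map, of which only the values on the domain matter. The atlas
  need not be maximal.
\<close>

definition smooth_manifold ::
    "('m::{t2_space, second_countable_topology}, 'n::euclidean_space) atlas \<Rightarrow> bool" where
  "smooth_manifold A \<longleftrightarrow>
     (\<Union>(U, \<phi>)\<in>A. U) = UNIV \<and>
     (\<forall>(U, \<phi>)\<in>A. open U \<and> open (\<phi> ` U) \<and> homeomorphism U (\<phi> ` U) \<phi> (inv_into U \<phi>)) \<and>
     (\<forall>(U, \<phi>)\<in>A. \<forall>(V, \<psi>)\<in>A. smooth_on (\<phi> ` (U \<inter> V)) (\<psi> \<circ> inv_into U \<phi>))"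

definition smooth_fun_on :: "('m::topological_space, 'n::euclidean_space) atlas \<Rightarrow> 'm set \<Rightarrow> ('m \<Rightarrow> real) \<Rightarrow> bool" where
  "smooth_fun_on A W f \<longleftrightarrow> (\<forall>(U, \<phi>)\<in>A. smooth_on (\<phi> ` (U \<inter> W)) (f \<circ> inv_into U \<phi>))"

abbreviation Cinf :: "('m::topological_space, 'n::euclidean_space) atlas \<Rightarrow> ('m \<Rightarrow> real) set" where
  "Cinf A \<equiv> {f. smooth_fun_on A UNIV f}"

text \<open>
  Tangent vectors at p are the derivations at p of the algebra of smooth functions. They are
  extended by 0 to non-smooth functions, so that equal derivations are equal as HOL functions.
\<close>

type_synonym 'm tvec = "('m \<Rightarrow> real) \<Rightarrow> real"

definition tangent_space :: "('m::topological_space, 'n::euclidean_space) atlas \<Rightarrow> 'm \<Rightarrow> 'm tvec set" where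
  "tangent_space A p = {x.
     (\<forall>f\<in>Cinf A. \<forall>h\<in>Cinf A. x (f + h) = x f + x h) \<and>
     (\<forall>c. \<forall>f\<in>Cinf A. x (\<lambda>q. c * f q) = c * x f) \<and>
     (\<forall>f\<in>Cinf A. \<forall>h\<in>Cinf A. x (f * h) = x f * h p + f p * x h) \<and>
     (\<forall>f. f \<notin> Cinf A \<longrightarrow> x f = 0)}"

definition cotangent_space ::
    "('m::topological_space, 'n::euclidean_space) atlas \<Rightarrow> 'm \<Rightarrow> ('m tvec \<Rightarrow> real) set" where
  "cotangent_space A p = {\<xi>.
     (\<forall>x\<in>tangent_space A p. \<forall>y\<in>tangent_space A p. \<xi> (x + y) = \<xi> x + \<xi> y) \<and>
     (\<forall>c. \<forall>x\<in>tangent_space A p. \<xi> (\<lambda>f. c * x f) = c * \<xi> x)}"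

type_synonym 'm vfield = "'m \<Rightarrow> 'm tvec"

definition app :: "'m vfield \<Rightarrow> ('m \<Rightarrow> real) \<Rightarrow> 'm \<Rightarrow> real" where
  "app X f = (\<lambda>p. X p f)"

definition vector_fields :: "('m::topological_space, 'n::euclidean_space) atlas \<Rightarrow> 'm vfield set" where
  "vector_fields A = {X. (\<forall>p. X p \<in> tangent_space A p) \<and> (\<forall>f\<in>Cinf A. app X f \<in> Cinf A)}"

definition fscale :: "('m \<Rightarrow> real) \<Rightarrow> 'm vfield \<Rightarrow> 'm vfield" where
  "fscale f X = (\<lambda>p h. f p * X p h)"

definition lie_bracket :: "'m vfield \<Rightarrow> 'm vfield \<Rightarrow> 'm vfield" where
  "lie_bracket X Y = (\<lambda>p f. X p (app Y f) - Y p (app X f))"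

text \<open>Here g is a (semi-Riemannian) metric, given as a form on each tangent space.\<close>

definition levi_civita ::
    "('m::topological_space, 'n::euclidean_space) atlas \<Rightarrow> ('m \<Rightarrow> 'm tvec \<Rightarrow> 'm tvec \<Rightarrow> real)
       \<Rightarrow> ('m vfield \<Rightarrow> 'm vfield \<Rightarrow> 'm vfield) \<Rightarrow> bool" where
  "levi_civita A g nabla \<longleftrightarrow>
     (\<forall>X\<in>vector_fields A. \<forall>Y\<in>vector_fields A. nabla X Y \<in> vector_fields A) \<and>
     (\<forall>X\<in>vector_fields A. \<forall>Y\<in>vector_fields A. \<forall>Z\<in>vector_fields A.
        nabla (X + Y) Z = nabla X Z + nabla Y Z \<and> nabla X (Y + Z) = nabla X Y + nabla X Z) \<and>
     (\<forall>X\<in>vector_fields A. \<forall>Y\<in>vector_fields A. \<forall>f\<in>Cinf A.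
        nabla (fscale f X) Y = fscale f (nabla X Y) \<and>
        nabla X (fscale f Y) = fscale (app X f) Y + fscale f (nabla X Y)) \<and>
     (\<forall>X\<in>vector_fields A. \<forall>Y\<in>vector_fields A. nabla X Y - nabla Y X = lie_bracket X Y) \<and>
     (\<forall>X\<in>vector_fields A. \<forall>Y\<in>vector_fields A. \<forall>Z\<in>vector_fields A.
        app X (\<lambda>p. g p (Y p) (Z p)) = (\<lambda>p. g p (nabla X Y p) (Z p) + g p (Y p) (nabla X Z p)))"

section \<open>Traces\<close>

text \<open>
  \<open>dual_frames \<Gamma> n \<beta> p e e'\<close>: for a vector bundle of rank n with space of sections \<Gamma> and fibre
  metric \<beta>, the values at p of the sections \<open>e 0, \<dots>, e (n - 1)\<close> form a basis of the fibre, and those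
  of \<open>e' 0, \<dots>, e' (n - 1)\<close> its dual basis with respect to \<beta>. Being a basis is automatic: the duality
  relations force the n vectors to be linearly independent.
\<close>

definition dual_frames ::
    "('m \<Rightarrow> 'w) set \<Rightarrow> nat \<Rightarrow> ('m \<Rightarrow> 'w \<Rightarrow> 'w \<Rightarrow> real) \<Rightarrow> 'm \<Rightarrow> (nat \<Rightarrow> 'm \<Rightarrow> 'w) \<Rightarrow> (nat \<Rightarrow> 'm \<Rightarrow> 'w) \<Rightarrow> bool" where
  "dual_frames \<Gamma> n \<beta> p e e' \<longleftrightarrow>
     (\<forall>i<n. e i \<in> \<Gamma> \<and> e' i \<in> \<Gamma>) \<and>
     (\<forall>i<n. \<forall>j<n. \<beta> p (e' i p) (e j p) = (if i = j then 1 else 0))"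

text \<open>
  The trace of B with respect to \<beta>. It is applied to B that are bilinear over the smooth functions,
  for which the value at p depends neither on the choice of the frames nor on their values away
  from p. The trace of an endomorphism L is the trace of \<open>\<lambda>a b. \<beta> (L a) b\<close>.
\<close>

definition metric_trace ::
    "('m \<Rightarrow> 'w) set \<Rightarrow> nat \<Rightarrow> ('m \<Rightarrow> 'w \<Rightarrow> 'w \<Rightarrow> real) \<Rightarrow> (('m \<Rightarrow> 'w) \<Rightarrow> ('m \<Rightarrow> 'w) \<Rightarrow> 'm \<Rightarrow> real) \<Rightarrow> 'm \<Rightarrow> real" where
  "metric_trace \<Gamma> n \<beta> B p =
     (case (SOME (e, e'). dual_frames \<Gamma> n \<beta> p e e') of (e, e') \<Rightarrow> \<Sum>i<n. B (e i) (e' i) p)"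

section \<open>Exact Courant algebroids\<close>

definition linear_on :: "'v::real_vector set \<Rightarrow> ('v \<Rightarrow> 'w::real_vector) \<Rightarrow> bool" where
  "linear_on V f \<longleftrightarrow> (\<forall>v\<in>V. \<forall>w\<in>V. f (v + w) = f v + f w) \<and> (\<forall>c. \<forall>v\<in>V. f (c *\<^sub>R v) = c *\<^sub>R f v)"

definition bilinear_on :: "'v::real_vector set \<Rightarrow> ('v \<Rightarrow> 'v \<Rightarrow> 'w::real_vector) \<Rightarrow> bool" where
  "bilinear_on V B \<longleftrightarrow> (\<forall>v\<in>V. linear_on V (B v)) \<and> (\<forall>w\<in>V. linear_on V (\<lambda>v. B v w))"

definition sym_on :: "'v set \<Rightarrow> ('v \<Rightarrow> 'v \<Rightarrow> real) \<Rightarrow> bool" where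
  "sym_on V B \<longleftrightarrow> (\<forall>v\<in>V. \<forall>w\<in>V. B v w = B w v)"

definition nondegenerate_on :: "'v::zero set \<Rightarrow> ('v \<Rightarrow> 'v \<Rightarrow> real) \<Rightarrow> bool" where
  "nondegenerate_on V B \<longleftrightarrow> (\<forall>v\<in>V. (\<forall>w\<in>V. B v w = 0) \<longrightarrow> v = 0)"

text \<open>
  A vector bundle is a family of linear subspaces \<open>fibre p\<close> of a real vector space 'v that merely
  serves as a container (every family of vector spaces of equal dimension embeds into one, with no
  topological compatibility), with a set of local trivialisations (U, s): a frame
  \<open>s 0 p, \<dots>, s (rk - 1) p\<close> of \<open>fibre p\<close> for p in U. The smooth structure of the bundle is the one
  for which these local frames are smooth; it is independent of 'v.
\<close>

record ('m, 'n, 'v) courant =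
  atlas :: "('m, 'n) atlas"
  fibre :: "'m \<Rightarrow> 'v set"
  rk :: nat
  frames :: "('m set \<times> (nat \<Rightarrow> 'm \<Rightarrow> 'v)) set"
  scal :: "'m \<Rightarrow> 'v \<Rightarrow> 'v \<Rightarrow> real"
  anchor :: "'m \<Rightarrow> 'v \<Rightarrow> 'm tvec"
  dorfman :: "('m \<Rightarrow> 'v) \<Rightarrow> ('m \<Rightarrow> 'v) \<Rightarrow> ('m \<Rightarrow> 'v)"

abbreviation fns :: "('m::topological_space, 'n::euclidean_space, 'v) courant \<Rightarrow> ('m \<Rightarrow> real) set" where
  "fns C \<equiv> Cinf (atlas C)"

definition vector_bundle ::
    "('m::topological_space, 'n::euclidean_space, 'v::real_vector) courant \<Rightarrow> bool" where
  "vector_bundle C \<longleftrightarrow>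
     (\<forall>p. subspace (fibre C p)) \<and>
     (\<Union>(U, s)\<in>frames C. U) = UNIV \<and>
     (\<forall>(U, s)\<in>frames C. open U \<and>
        (\<forall>p\<in>U. inj_on (\<lambda>i. s i p) {..<rk C} \<and> independent ((\<lambda>i. s i p) ` {..<rk C}) \<and>
          span ((\<lambda>i. s i p) ` {..<rk C}) = fibre C p)) \<and>
     (\<forall>(U, s)\<in>frames C. \<forall>(V, t)\<in>frames C. \<exists>a.
        (\<forall>i<rk C. \<forall>j<rk C. smooth_fun_on (atlas C) (U \<inter> V) (a i j)) \<and>
        (\<forall>p\<in>U \<inter> V. \<forall>j<rk C. t j p = (\<Sum>i<rk C. a i j p *\<^sub>R s i p)))"

definition sections ::
    "('m::topological_space, 'n::euclidean_space, 'v::real_vector) courant \<Rightarrow> ('m \<Rightarrow> 'v) set" where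
  "sections C = {u. (\<forall>p. u p \<in> fibre C p) \<and>
     (\<forall>(U, s)\<in>frames C. \<exists>c. (\<forall>i<rk C. smooth_fun_on (atlas C) U (c i)) \<and>
        (\<forall>p\<in>U. u p = (\<Sum>i<rk C. c i p *\<^sub>R s i p)))}"

definition smul :: "('m \<Rightarrow> real) \<Rightarrow> ('m \<Rightarrow> 'v::real_vector) \<Rightarrow> 'm \<Rightarrow> 'v" where
  "smul f u = (\<lambda>p. f p *\<^sub>R u p)"

definition sprod :: "('m, 'n, 'v) courant \<Rightarrow> ('m \<Rightarrow> 'v) \<Rightarrow> ('m \<Rightarrow> 'v) \<Rightarrow> 'm \<Rightarrow> real" where
  "sprod C u v = (\<lambda>p. scal C p (u p) (v p))"

definition anch :: "('m, 'n, 'v) courant \<Rightarrow> ('m \<Rightarrow> 'v) \<Rightarrow> 'm vfield" where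
  "anch C u = (\<lambda>p. anchor C p (u p))"

text \<open>A smooth fibrewise bilinear symmetric nondegenerate form.\<close>

definition fibre_metric ::
    "('m::topological_space, 'n::euclidean_space, 'v::real_vector) courant \<Rightarrow> ('m \<Rightarrow> 'v \<Rightarrow> 'v \<Rightarrow> real) \<Rightarrow> bool" where
  "fibre_metric C \<beta> \<longleftrightarrow>
     (\<forall>p. bilinear_on (fibre C p) (\<beta> p) \<and> sym_on (fibre C p) (\<beta> p) \<and> nondegenerate_on (fibre C p) (\<beta> p)) \<and>
     (\<forall>u\<in>sections C. \<forall>v\<in>sections C. (\<lambda>p. \<beta> p (u p) (v p)) \<in> fns C)"

definition courant_algebroid ::
    "('m::{t2_space, second_countable_topology}, 'n::euclidean_space, 'v::real_vector) courant \<Rightarrow> bool" where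
  "courant_algebroid C \<longleftrightarrow>
     smooth_manifold (atlas C) \<and> vector_bundle C \<and> fibre_metric C (scal C) \<and>
     (\<forall>p. \<forall>v\<in>fibre C p. anchor C p v \<in> tangent_space (atlas C) p) \<and>
     (\<forall>p f. linear_on (fibre C p) (\<lambda>v. anchor C p v f)) \<and>
     (\<forall>u\<in>sections C. anch C u \<in> vector_fields (atlas C)) \<and>
     (\<forall>u\<in>sections C. \<forall>v\<in>sections C. dorfman C u v \<in> sections C) \<and>
     (\<forall>u\<in>sections C. \<forall>v\<in>sections C. \<forall>w\<in>sections C.
        dorfman C (u + v) w = dorfman C u w + dorfman C v w \<and>
        dorfman C u (v + w) = dorfman C u v + dorfman C u w) \<and>
     (\<forall>c. \<forall>u\<in>sections C. \<forall>v\<in>sections C.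
        dorfman C (smul (\<lambda>_. c) u) v = smul (\<lambda>_. c) (dorfman C u v) \<and>
        dorfman C u (smul (\<lambda>_. c) v) = smul (\<lambda>_. c) (dorfman C u v)) \<and>
     (\<forall>u\<in>sections C. \<forall>v\<in>sections C. \<forall>w\<in>sections C.
        dorfman C u (dorfman C v w) = dorfman C (dorfman C u v) w + dorfman C v (dorfman C u w)) \<and>
     (\<forall>u\<in>sections C. \<forall>v\<in>sections C. anch C (dorfman C u v) = lie_bracket (anch C u) (anch C v)) \<and>
     (\<forall>u\<in>sections C. \<forall>v\<in>sections C. \<forall>f\<in>fns C.
        dorfman C u (smul f v) = smul (app (anch C u) f) v + smul f (dorfman C u v)) \<and>
     (\<forall>u\<in>sections C. \<forall>v\<in>sections C. \<forall>w\<in>sections C.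
        app (anch C u) (sprod C v w) = sprod C (dorfman C u v) w + sprod C v (dorfman C u w)) \<and>
     (\<forall>u\<in>sections C. \<forall>v\<in>sections C. \<forall>w\<in>sections C.
        sprod C (dorfman C u v + dorfman C v u) w = app (anch C w) (sprod C u v))"

text \<open>
  The image of the cotangent space at p in the fibre. A one-form \<xi> corresponds to the vector v with
  \<open>\<langle>v, w\<rangle> = \<xi> (\<pi> w) / 2\<close>; the factor is the one of the scalar product
  \<open>\<langle>X + \<xi>, Y + \<zeta>\<rangle> = (\<xi> Y + \<zeta> X) / 2\<close> on the sum of tangent and cotangent bundle.
\<close>

definition cotangent_part :: "('m::topological_space, 'n::euclidean_space, 'v) courant \<Rightarrow> 'm \<Rightarrow> 'v set" where
  "cotangent_part C p = {v \<in> fibre C p. \<exists>\<xi>\<in>cotangent_space (atlas C) p.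
     \<forall>w\<in>fibre C p. scal C p v w = \<xi> (anchor C p w) / 2}"

text \<open>Injectivity of the map from the cotangent bundle follows from surjectivity of the anchor.\<close>

definition exact_courant_algebroid ::
    "('m::{t2_space, second_countable_topology}, 'n::euclidean_space, 'v::real_vector) courant \<Rightarrow> bool" where
  "exact_courant_algebroid C \<longleftrightarrow> courant_algebroid C \<and>
     (\<forall>p. anchor C p ` fibre C p = tangent_space (atlas C) p) \<and>
     (\<forall>p. {v \<in> fibre C p. anchor C p v = 0} = cotangent_part C p)"

section \<open>Generalised metrics\<close>

type_synonym ('m, 'v) form = "'m \<Rightarrow> 'v \<Rightarrow> 'v \<Rightarrow> real"

definition Gend :: "('m, 'n, 'v) courant \<Rightarrow> ('m, 'v) form \<Rightarrow> 'm \<Rightarrow> 'v \<Rightarrow> 'v" where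
  "Gend C G p u = (THE w. w \<in> fibre C p \<and> (\<forall>v\<in>fibre C p. scal C p w v = G p u v))"

definition generalised_metric ::
    "('m::topological_space, 'n::euclidean_space, 'v::real_vector) courant \<Rightarrow> ('m, 'v) form \<Rightarrow> bool" where
  "generalised_metric C G \<longleftrightarrow> fibre_metric C G \<and>
     (\<forall>p. \<forall>v\<in>fibre C p. Gend C G p (Gend C G p v) = v) \<and>
     (\<forall>p. nondegenerate_on (cotangent_part C p) (G p))"

text \<open>
  In the following \<sigma> is 1 or -1 and selects between the two eigenbundles; since \<open>Gend\<close> is an
  involution, \<open>proj C G \<sigma>\<close> is the projection onto \<open>eigen C G \<sigma>\<close> along the other one.
\<close>

definition eigen :: "('m, 'n, 'v::real_vector) courant \<Rightarrow> ('m, 'v) form \<Rightarrow> real \<Rightarrow> 'm \<Rightarrow> 'v set" where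
  "eigen C G \<sigma> p = {v \<in> fibre C p. Gend C G p v = \<sigma> *\<^sub>R v}"

definition proj ::
    "('m, 'n, 'v::real_vector) courant \<Rightarrow> ('m, 'v) form \<Rightarrow> real \<Rightarrow> ('m \<Rightarrow> 'v) \<Rightarrow> 'm \<Rightarrow> 'v" where
  "proj C G \<sigma> u = (\<lambda>p. (1/2) *\<^sub>R (u p + \<sigma> *\<^sub>R Gend C G p (u p)))"

definition lift ::
    "('m, 'n, 'v::real_vector) courant \<Rightarrow> ('m, 'v) form \<Rightarrow> real \<Rightarrow> 'm vfield \<Rightarrow> 'm \<Rightarrow> 'v" where
  "lift C G \<sigma> X = (\<lambda>p. inv_into (eigen C G \<sigma> p) (anchor C p) (X p))"

text \<open>
  The metric on the base whose pullback to the eigenbundle of 1 is G. Its pullback to the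
  eigenbundle of -1 is then G as well.
\<close>

definition base_metric ::
    "('m, 'n, 'v::real_vector) courant \<Rightarrow> ('m, 'v) form \<Rightarrow> 'm \<Rightarrow> 'm tvec \<Rightarrow> 'm tvec \<Rightarrow> real" where
  "base_metric C G p x y =
     G p (inv_into (eigen C G 1 p) (anchor C p) x) (inv_into (eigen C G 1 p) (anchor C p) y)"

section \<open>Generalised connections and divergence operators\<close>

type_synonym ('m, 'v) gconn = "('m \<Rightarrow> 'v) \<Rightarrow> ('m \<Rightarrow> 'v) \<Rightarrow> 'm \<Rightarrow> 'v"

definition generalised_connection ::
    "('m::topological_space, 'n::euclidean_space, 'v::real_vector) courant \<Rightarrow> ('m, 'v) gconn \<Rightarrow> bool" where
  "generalised_connection C D \<longleftrightarrow>
     (\<forall>u\<in>sections C. \<forall>v\<in>sections C. D u v \<in> sections C) \<and>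
     (\<forall>u\<in>sections C. \<forall>v\<in>sections C. \<forall>w\<in>sections C.
        D (u + v) w = D u w + D v w \<and> D u (v + w) = D u v + D u w) \<and>
     (\<forall>u\<in>sections C. \<forall>v\<in>sections C. \<forall>f\<in>fns C.
        D (smul f u) v = smul f (D u v) \<and>
        D u (smul f v) = smul (app (anch C u) f) v + smul f (D u v)) \<and>
     (\<forall>u\<in>sections C. \<forall>v\<in>sections C. \<forall>w\<in>sections C.
        app (anch C u) (sprod C v w) = sprod C (D u v) w + sprod C v (D u w))"

definition torsion ::
    "('m, 'n, 'v::real_vector) courant \<Rightarrow> ('m, 'v) gconn \<Rightarrow> ('m \<Rightarrow> 'v) \<Rightarrow> ('m \<Rightarrow> 'v) \<Rightarrow> ('m \<Rightarrow> 'v) \<Rightarrow> 'm \<Rightarrow> real" where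
  "torsion C D u v w = sprod C (D u v - D v u - dorfman C u v) w + sprod C (D w u) v"

definition gen_levi_civita ::
    "('m::topological_space, 'n::euclidean_space, 'v::real_vector) courant \<Rightarrow> ('m, 'v) form
       \<Rightarrow> ('m, 'v) gconn \<Rightarrow> bool" where
  "gen_levi_civita C G D \<longleftrightarrow> generalised_connection C D \<and>
     (\<forall>u\<in>sections C. \<forall>v\<in>sections C. \<forall>w\<in>sections C.
        app (anch C u) (\<lambda>p. G p (v p) (w p)) = (\<lambda>p. G p (D u v p) (w p) + G p (v p) (D u w p))) \<and>
     (\<forall>u\<in>sections C. \<forall>v\<in>sections C. \<forall>w\<in>sections C. torsion C D u v w = 0)"

definition divergence_operator ::
    "('m::topological_space, 'n::euclidean_space, 'v::real_vector) courant
       \<Rightarrow> (('m \<Rightarrow> 'v) \<Rightarrow> 'm \<Rightarrow> real) \<Rightarrow> bool" where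
  "divergence_operator C dv \<longleftrightarrow>
     (\<forall>v\<in>sections C. dv v \<in> fns C) \<and>
     (\<forall>v\<in>sections C. \<forall>w\<in>sections C. dv (v + w) = dv v + dv w) \<and>
     (\<forall>c. \<forall>v\<in>sections C. dv (smul (\<lambda>_. c) v) = (\<lambda>p. c * dv v p)) \<and>
     (\<forall>f\<in>fns C. \<forall>v\<in>sections C. dv (smul f v) = app (anch C v) f + f * dv v)"

definition trE ::
    "('m::topological_space, 'n::euclidean_space, 'v::real_vector) courant
       \<Rightarrow> (('m \<Rightarrow> 'v) \<Rightarrow> ('m \<Rightarrow> 'v) \<Rightarrow> 'm \<Rightarrow> real) \<Rightarrow> 'm \<Rightarrow> real" where
  "trE C = metric_trace (sections C) (rk C) (scal C)"

definition div_of_conn ::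
    "('m::topological_space, 'n::euclidean_space, 'v::real_vector) courant \<Rightarrow> ('m, 'v) gconn
       \<Rightarrow> ('m \<Rightarrow> 'v) \<Rightarrow> 'm \<Rightarrow> real" where
  "div_of_conn C D v = trE C (\<lambda>a b. sprod C (D a v) b)"

text \<open>The trace of \<open>\<lambda>Y. nabla Y X\<close>, for the Levi-Civita connection nabla of g.\<close>

definition div_metric ::
    "('m::topological_space, 'n::euclidean_space) atlas \<Rightarrow> ('m \<Rightarrow> 'm tvec \<Rightarrow> 'm tvec \<Rightarrow> real)
       \<Rightarrow> ('m vfield \<Rightarrow> 'm vfield \<Rightarrow> 'm vfield) \<Rightarrow> 'm vfield \<Rightarrow> 'm \<Rightarrow> real" where
  "div_metric A g nabla X = metric_trace (vector_fields A) DIM('n) g (\<lambda>Y Z p. g p (nabla Y X p) (Z p))"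

text \<open>In the following nabla is the Levi-Civita connection of \<open>base_metric C G\<close>.\<close>

definition metric_div ::
    "('m::topological_space, 'n::euclidean_space, 'v::real_vector) courant \<Rightarrow> ('m, 'v) form
       \<Rightarrow> ('m vfield \<Rightarrow> 'm vfield \<Rightarrow> 'm vfield) \<Rightarrow> ('m \<Rightarrow> 'v) \<Rightarrow> 'm \<Rightarrow> real" where
  "metric_div C G nabla u = div_metric (atlas C) (base_metric C G) nabla (anch C u)"

definition Dtilde ::
    "('m, 'n, 'v::real_vector) courant \<Rightarrow> ('m, 'v) form
       \<Rightarrow> ('m vfield \<Rightarrow> 'm vfield \<Rightarrow> 'm vfield) \<Rightarrow> ('m, 'v) gconn" where
  "Dtilde C G nabla u v = (\<Sum>\<sigma>\<in>{1, -1}.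
     lift C G \<sigma> (nabla (anch C (proj C G \<sigma> u)) (anch C (proj C G \<sigma> v))) +
     proj C G (- \<sigma>) (dorfman C (proj C G \<sigma> u) (proj C G (- \<sigma>) v)))"

definition D0 ::
    "('m::topological_space, 'n::euclidean_space, 'v::real_vector) courant \<Rightarrow> ('m, 'v) form
       \<Rightarrow> ('m vfield \<Rightarrow> 'm vfield \<Rightarrow> 'm vfield) \<Rightarrow> ('m, 'v) gconn" where
  "D0 C G nabla u v p = (THE x. x \<in> fibre C p \<and> (\<forall>w\<in>sections C.
     scal C p x (w p) = sprod C (Dtilde C G nabla u v) w p - (1/3) * torsion C (Dtilde C G nabla) u v w p))"

text \<open>The fibre at p of the first prolongation of the bundle \<open>so(E)\<^sub>G\<close>.\<close>

definition so_prolongation ::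
    "('m, 'n, 'v::real_vector) courant \<Rightarrow> ('m, 'v) form \<Rightarrow> 'm \<Rightarrow> ('v \<Rightarrow> 'v \<Rightarrow> 'v) set" where
  "so_prolongation C G p = {S.
     bilinear_on (fibre C p) S \<and>
     (\<forall>u\<in>fibre C p. \<forall>v\<in>fibre C p. S u v \<in> fibre C p) \<and>
     (\<forall>u\<in>fibre C p. \<forall>v\<in>fibre C p. \<forall>w\<in>fibre C p. scal C p (S u v) w = - scal C p v (S u w)) \<and>
     (\<forall>\<sigma>\<in>{1, -1}. \<forall>u\<in>fibre C p. \<forall>v\<in>eigen C G \<sigma> p. S u v \<in> eigen C G \<sigma> p) \<and>
     (\<forall>u\<in>fibre C p. \<forall>v\<in>fibre C p. \<forall>w\<in>fibre C p.
        scal C p (S u v) w + scal C p (S v w) u + scal C p (S w u) v = 0)}"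

definition ker_tr ::
    "('m::topological_space, 'n::euclidean_space, 'v::real_vector) courant \<Rightarrow> ('m, 'v) form \<Rightarrow> 'm
       \<Rightarrow> ('v \<Rightarrow> 'v \<Rightarrow> 'v) set" where
  "ker_tr C G p = {S \<in> so_prolongation C G p.
     \<forall>v\<in>fibre C p. trE C (\<lambda>a b q. scal C q (S (a q) v) (b q)) p = 0}"

text \<open>
  The last conjunct says that the tensor \<open>D - D0\<close> is orthogonal to \<open>ker_tr C G p\<close>: the double trace
  is the scalar product induced on the fibre at p of the tensor product of two dual copies of E
  with E.
\<close>

definition canonical_glc ::
    "('m::topological_space, 'n::euclidean_space, 'v::real_vector) courant \<Rightarrow> ('m, 'v) form
       \<Rightarrow> ('m vfield \<Rightarrow> 'm vfield \<Rightarrow> 'm vfield) \<Rightarrow> (('m \<Rightarrow> 'v) \<Rightarrow> 'm \<Rightarrow> real) \<Rightarrow> ('m, 'v) gconn \<Rightarrow> bool" where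
  "canonical_glc C G nabla dv D \<longleftrightarrow> gen_levi_civita C G D \<and>
     (\<forall>v\<in>sections C. div_of_conn C D v = dv v) \<and>
     (\<forall>p. \<forall>S\<in>ker_tr C G p.
        trE C (\<lambda>a a'. trE C (\<lambda>b b' q.
          scal C q (D a b q - D0 C G nabla a b q) (S (a' q) (b' q)))) p = 0)"

section \<open>Curvature\<close>

definition second_deriv :: "('m, 'v::real_vector) gconn \<Rightarrow> ('m \<Rightarrow> 'v) \<Rightarrow> ('m \<Rightarrow> 'v) \<Rightarrow> ('m \<Rightarrow> 'v) \<Rightarrow> 'm \<Rightarrow> 'v" where
  "second_deriv D v w u = D v (D w u) - D (D v w) u"

definition gen_riemann ::
    "('m::topological_space, 'n::euclidean_space, 'v::real_vector) courant \<Rightarrow> ('m, 'v) gconn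
       \<Rightarrow> ('m \<Rightarrow> 'v) \<Rightarrow> ('m \<Rightarrow> 'v) \<Rightarrow> ('m \<Rightarrow> 'v) \<Rightarrow> ('m \<Rightarrow> 'v) \<Rightarrow> 'm \<Rightarrow> real" where
  "gen_riemann C D a b v w p = (1/2) *
     (sprod C (second_deriv D v w b - second_deriv D w v b) a p
      + sprod C (second_deriv D b a v - second_deriv D a b v) w p
      - trE C (\<lambda>x y. sprod C (D x v) w * sprod C (D y b) a) p)"

definition full_ricci ::
    "('m::topological_space, 'n::euclidean_space, 'v::real_vector) courant \<Rightarrow> ('m, 'v) gconn
       \<Rightarrow> ('m \<Rightarrow> 'v) \<Rightarrow> ('m \<Rightarrow> 'v) \<Rightarrow> 'm \<Rightarrow> real" where
  "full_ricci C D a b = trE C (\<lambda>u v. gen_riemann C D u a v b)"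

end

theory Submission
  imports Defs
begin

text \<open>
  For a torsion-free D the trace depends only on the divergence \<open>div = div\<^sup>0 - \<langle>e, \<cdot>\<rangle>\<close> of D, where
  \<open>div\<^sup>0\<close> factors through the anchor.
  Near a point choose a frame \<open>e\<^sub>i\<close> of E of constant isotropic type: half of it consists of gradients,
  which lie in the kernel of the anchor, the other half is isotropic and dual to the first.
  With \<open>e\<^sup>i\<close> the dual frame, writing out the curvature in the connection coefficients gives

    \<open>- 2 \<Sum> \<pi>(e\<^sup>i)(div e\<^sub>i) - \<Sum> div(e\<^sub>i) div(e\<^sup>i) + 1/6 \<Sum> c(e\<^sub>i, e\<^sub>j, e\<^sub>k) c(e\<^sup>i, e\<^sup>j, e\<^sup>k)\<close>

  for the trace, where \<open>c(u, v, w) = \<langle>[u, v], w\<rangle>\<close>. The last sum vanishes because c does so on any two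
  gradients, and so do the contributions of \<open>div\<^sup>0\<close> alone, because \<open>e\<^sub>i\<close> or \<open>e\<^sup>i\<close> is a gradient. The
  terms linear and quadratic in e add up to \<open>2 div\<^sup>0(e) - \<langle>e, e\<rangle>\<close>.
\<close>

section \<open>Smooth functions on Euclidean spaces\<close>


text \<open>For a trace at one point any dual bases would do. But the divergences of the frame
  vectors get differentiated, so the pairings of the frame must be constant on a neighbourhood. This
  makes the coefficients T a b c = \<langle>D (e a) (e b), e c\<rangle> skew in b and c, and then
  vanishing torsion says that the cyclic sum of T is c(e a, e b, e c). Contracting that cyclic sum
  with its dual gives three products of one kind and six of another, the origin of the factor 1/6.
  Connections act on global sections only, so local frames, dual sections and reciprocals are
  globalised with bump functions, and each traced quantity must be shown to depend on its arguments
  only through their values at the point. No differential from functions to sections is given.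
  Symmetrised brackets [u, v] + [v, u] play the part of the gradients of \<langle>u, v\<rangle>;
  since f \<langle>u, v\<rangle> = \<langle>f u, v\<rangle>, there are enough of them. That they
  fill exactly half of the rank comes from exactness, which makes the kernel of the anchor
  isotropic. Finally \<langle>e, e\<rangle> is the difference of the two squared norms, by
  polarisation of G along its involution.\<close>

lemma Ck_on_subset: "Ck_on k S f \<Longrightarrow> T \<subseteq> S \<Longrightarrow> Ck_on k T f"
  by (induction k arbitrary: f) (auto intro: continuous_on_subset)

lemma Ck_on_SucD: "Ck_on (Suc k) S f \<Longrightarrow> Ck_on k S f"
proof (induction k arbitrary: f)
  case 0
  then show ?case
    by (auto intro!: continuous_at_imp_continuous_on differentiable_imp_continuous_within)
next
  case (Suc k)
  have "Ck_on k S (\<lambda>x. frechet_derivative f (at x) v)" for v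
    using Suc.prems by (intro Suc.IH) simp
  with Suc.prems show ?case by simp
qed

lemma frechet_derivative_cong_open:
  assumes "open S" "x \<in> S" "\<And>y. y \<in> S \<Longrightarrow> f y = g y"
  shows "frechet_derivative f (at x) = frechet_derivative g (at x)"
proof -
  have "(f has_derivative D) (at x) \<longleftrightarrow> (g has_derivative D) (at x)" for D
    using assms has_derivative_transform_within_open[of f D x UNIV S g]
      has_derivative_transform_within_open[of g D x UNIV S f] by auto
  then show ?thesis by (simp add: frechet_derivative_def)
qed

lemma differentiable_cong_open:
  assumes "open S" "x \<in> S" "\<And>y. y \<in> S \<Longrightarrow> f y = g y" "f differentiable (at x)"
  shows "g differentiable (at x)"
  using assms has_derivative_transform_within_open[of f _ x UNIV S g] unfolding differentiable_def by blast

lemma Ck_on_cong: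
  assumes "open S" "\<And>y. y \<in> S \<Longrightarrow> f y = g y" "Ck_on k S f"
  shows "Ck_on k S g"
  using assms(2,3)
proof (induction k arbitrary: f g)
  case 0
  then show ?case by (auto cong: continuous_on_cong)
next
  case (Suc k)
  have "Ck_on k S (\<lambda>x. frechet_derivative g (at x) v)" for v
  proof (rule Suc.IH)
    show "frechet_derivative f (at y) v = frechet_derivative g (at y) v" if "y \<in> S" for y
      using frechet_derivative_cong_open[OF assms(1) that Suc.prems(1)] by simp
    show "Ck_on k S (\<lambda>x. frechet_derivative f (at x) v)"
      using Suc.prems(2) by simp
  qed
  moreover have "g differentiable (at y)" if "y \<in> S" for y
    using differentiable_cong_open[OF assms(1) that Suc.prems(1)] Suc.prems(2) that by simp
  ultimately show ?case by simp
qed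

lemma Ck_on_Un:
  assumes "open S" "open T" "Ck_on k S f" "Ck_on k T f"
  shows "Ck_on k (S \<union> T) f"
  using assms(3,4)
  by (induction k arbitrary: f) (auto intro!: continuous_on_open_Un assms)

lemma Ck_on_const: "Ck_on k S (\<lambda>x. c)"
  by (induction k arbitrary: c) auto

lemma Ck_on_bounded_linear:
  assumes "bounded_linear f" shows "Ck_on k S f"
proof (cases k)
  case 0
  then show ?thesis using assms by (simp add: linear_continuous_on)
next
  case (Suc l)
  have "frechet_derivative f (at x) = f" for x
    using bounded_linear_imp_has_derivative[OF assms] by (metis frechet_derivative_at)
  then show ?thesis using Suc Ck_on_const bounded_linear_imp_differentiable[OF assms] by auto
qed

text \<open>The form in which differentiability classes are verified below: the derivative may be
  any explicit formula instead of \<open>frechet_derivative\<close>, with which it agrees on the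
  open set by uniqueness.\<close>

lemma Ck_on_step:
  assumes "open S" "\<And>x. x \<in> S \<Longrightarrow> (f has_derivative f' x) (at x)"
    "\<And>v. Ck_on k S (\<lambda>x. f' x v)"
  shows "Ck_on (Suc k) S f"
proof -
  have eq: "f' x = frechet_derivative f (at x)" if "x \<in> S" for x
    using assms(2)[OF that] by (rule frechet_derivative_at)
  have "Ck_on k S (\<lambda>x. frechet_derivative f (at x) v)" for v
    by (rule Ck_on_cong[OF assms(1) _ assms(3)[of v]]) (simp add: eq)
  moreover have "f differentiable (at x)" if "x \<in> S" for x
    using assms(2)[OF that] by (rule differentiableI)
  ultimately show ?thesis by simp
qed

lemma Ck_on_Suc_derivative:
  assumes "Ck_on (Suc k) S f"
  shows "x \<in> S \<Longrightarrow> (f has_derivative frechet_derivative f (at x)) (at x)"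
    and "Ck_on k S (\<lambda>x. frechet_derivative f (at x) v)"
  using assms frechet_derivative_works[of f "at x"] by simp_all

lemma Ck_on_add:
  assumes "open S" "Ck_on k S f" "Ck_on k S g"
  shows "Ck_on k S (\<lambda>x. f x + g x)"
  using assms(2,3)
proof (induction k arbitrary: f g)
  case 0 then show ?case by (auto intro: continuous_intros)
next
  case (Suc k)
  define f' where "f' x = frechet_derivative f (at x)" for x
have f: "\<And>x. x \<in> S \<Longrightarrow> (f has_derivative f' x) (at x)" "\<And>v. Ck_on k S (\<lambda>x. f' x v)"
    using Ck_on_Suc_derivative[OF Suc.prems(1)] by (simp_all add: f'_def)
  define g' where "g' x = frechet_derivative g (at x)" for x
have g: "\<And>x. x \<in> S \<Longrightarrow> (g has_derivative g' x) (at x)" "\<And>v. Ck_on k S (\<lambda>x. g' x v)"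
    using Ck_on_Suc_derivative[OF Suc.prems(2)] by (simp_all add: g'_def)
  show ?case
    by (rule Ck_on_step[OF assms(1), where f'="\<lambda>x v. f' x v + g' x v"])
      (auto intro!: has_derivative_add f g Suc.IH)
qed

lemma Ck_on_sum:
  assumes "open S" "\<And>i. i \<in> I \<Longrightarrow> Ck_on k S (f i)"
  shows "Ck_on k S (\<lambda>x. \<Sum>i\<in>I. f i x)"
  using assms(2)
  by (induction I rule: infinite_finite_induct) (auto intro: Ck_on_const Ck_on_add[OF assms(1)])

lemma Ck_on_mult:
  fixes f g :: "'a::euclidean_space \<Rightarrow> real"
  assumes "open S" "Ck_on k S f" "Ck_on k S g"
  shows "Ck_on k S (\<lambda>x. f x * g x)"
  using assms(2,3)
proof (induction k arbitrary: f g)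
  case 0 then show ?case by (auto intro: continuous_intros)
next
  case (Suc k)
  define f' where "f' x = frechet_derivative f (at x)" for x
have f: "\<And>x. x \<in> S \<Longrightarrow> (f has_derivative f' x) (at x)" "\<And>v. Ck_on k S (\<lambda>x. f' x v)"
    using Ck_on_Suc_derivative[OF Suc.prems(1)] by (simp_all add: f'_def)
  define g' where "g' x = frechet_derivative g (at x)" for x
have g: "\<And>x. x \<in> S \<Longrightarrow> (g has_derivative g' x) (at x)" "\<And>v. Ck_on k S (\<lambda>x. g' x v)"
    using Ck_on_Suc_derivative[OF Suc.prems(2)] by (simp_all add: g'_def)
  note Ck_on_SucD[OF Suc.prems(1)] Ck_on_SucD[OF Suc.prems(2)]
  then show ?case
    by (intro Ck_on_step[OF assms(1), where f'="\<lambda>x v. f x * g' x v + f' x v * g x"])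
      (auto intro!: has_derivative_mult f g Suc.IH Ck_on_add[OF assms(1)])
qed

text \<open>Chain rule. Regularity of f' is known in fixed directions only, whereas the direction
  \<open>g' x v\<close> moves with x. It is therefore expanded in \<open>Basis\<close>: each summand
  is a component of g' times a partial derivative of f composed with g, and the induction hypothesis
  applies to the latter.\<close>

lemma Ck_on_compose:
  fixes f :: "'b::euclidean_space \<Rightarrow> real" and g :: "'a::euclidean_space \<Rightarrow> 'b"
  assumes "open S" "open T" "g ` S \<subseteq> T" "Ck_on k T f" "Ck_on k S g"
  shows "Ck_on k S (f \<circ> g)"
  using assms(4,5)
proof (induction k arbitrary: f)
  case 0
  then show ?case using assms(3)
    by (auto intro: continuous_on_compose continuous_on_subset simp del: comp_apply o_apply)
next
  case (Suc k)
  define f' where "f' x = frechet_derivative f (at x)" for x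
have f: "\<And>x. x \<in> T \<Longrightarrow> (f has_derivative f' x) (at x)" "\<And>v. Ck_on k T (\<lambda>x. f' x v)"
    using Ck_on_Suc_derivative[OF Suc.prems(1)] by (simp_all add: f'_def)
  define g' where "g' x = frechet_derivative g (at x)" for x
have g: "\<And>x. x \<in> S \<Longrightarrow> (g has_derivative g' x) (at x)" "\<And>v. Ck_on k S (\<lambda>x. g' x v)"
    using Ck_on_Suc_derivative[OF Suc.prems(2)] by (simp_all add: g'_def)
  have gk: "Ck_on k S g" by (rule Ck_on_SucD[OF Suc.prems(2)])
  have lin: "f' (g x) w = (\<Sum>b\<in>Basis. (w \<bullet> b) * f' (g x) b)" if "x \<in> S" for x w
  proof -
    have "linear (f' (g x))"
      using f(1)[of "g x"] that assms(3) by (auto dest: has_derivative_linear)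
    from linear_sum[OF this, of "\<lambda>b. (w \<bullet> b) *\<^sub>R b" Basis] show ?thesis
      by (simp add: euclidean_representation linear_scale[OF \<open>linear (f' (g x))\<close>])
  qed
  have "Ck_on k S (\<lambda>x. \<Sum>b\<in>Basis. (g' x v \<bullet> b) * f' (g x) b)" for v
  proof (intro Ck_on_sum Ck_on_mult assms(1))
    fix b :: 'b
    show "Ck_on k S (\<lambda>x. f' (g x) b)" using Suc.IH[OF f(2) gk, of b] by (simp add: o_def)
    \<comment> \<open>The inner product with a fixed vector is linear and commutes with
      differentiation, hence an inner induction over arbitrary families \<open>g'\<close>.\<close>
    show "Ck_on k S (\<lambda>x. g' x v \<bullet> b)" using g(2)[of v]
    proof (induction k arbitrary: g')
      case 0
      then show ?case by (auto intro: continuous_intros)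
    next
      case (Suc k)
      define h where "h x = frechet_derivative (\<lambda>x. g' x v) (at x)" for x
      have h: "\<And>x. x \<in> S \<Longrightarrow> ((\<lambda>x. g' x v) has_derivative h x) (at x)" "\<And>w. Ck_on k S (\<lambda>x. h x w)"
        using Ck_on_Suc_derivative[OF Suc.prems(1)] by (simp_all add: h_def)
      show ?case
        by (rule Ck_on_step[OF assms(1), where f'="\<lambda>x w. h x w \<bullet> b"])
          (auto intro!: has_derivative_inner_left h Suc.IH[of "\<lambda>x v. h x w" for w])
    qed
  qed
  then have C: "Ck_on k S (\<lambda>x. f' (g x) (g' x v))" for v
    by (rule Ck_on_cong[OF assms(1), rotated]) (rule lin[symmetric])
  show ?case
  proof (rule Ck_on_step[OF assms(1) _ C])
    fix x assume "x \<in> S"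
    then have "(f has_derivative f' (g x)) (at (g x))" using f(1) assms(3) by auto
    from diff_chain_at[OF g(1)[OF \<open>x \<in> S\<close>] this]
    show "(f \<circ> g has_derivative (\<lambda>v. f' (g x) (g' x v))) (at x)" by (simp add: o_def)
  qed
qed

section \<open>Reciprocals, flat functions and a cutoff on the real line\<close>

lemma Ck_on_inverse: "Ck_on k {0<..} (inverse :: real \<Rightarrow> real)"
proof (induction k)
  case 0
  then show ?case by (auto intro!: continuous_intros)
next
  case (Suc k)
  have "Ck_on k {0<..} (\<lambda>x. inverse x * inverse x * (- v))" for v :: real
    by (intro Ck_on_mult Ck_on_const Suc) simp_all
  moreover have "(inverse has_derivative (\<lambda>v. inverse x * inverse x * (- v))) (at x)"
    if "x \<in> {0<..}" for x :: real
    using has_derivative_inverse'[of x] that by (simp add: algebra_simps)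
  ultimately show ?case
    using Ck_on_step[of "{0<..}" inverse "\<lambda>x v. inverse x * inverse x * (- v)" k] open_greaterThan
    by blast
qed

text \<open>The family is closed under differentiation up to linear combinations, so that all members are
  smooth as soon as all of them are continuous.\<close>

definition flat :: "nat \<Rightarrow> real \<Rightarrow> real" where
  "flat n t = (if 0 < t then exp (- 1 / t) / t ^ n else 0)"

text \<open>From the right, the substitution of 1/t turns this into x^n / exp x \<rightarrow> 0 at
  infinity; from the left the function is identically 0.\<close>

lemma flat_tendsto_0: "(flat n \<longlongrightarrow> 0) (at 0)"
proof -
  have "((\<lambda>t. inverse t ^ n / exp (inverse t)) \<longlongrightarrow> 0) (at_right (0::real))"
    by (rule filterlim_compose[OF tendsto_power_div_exp_0 filterlim_inverse_at_top_right])
  moreover have "eventually (\<lambda>t. inverse t ^ n / exp (inverse t) = flat n t) (at_right 0)"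
    by (auto simp: flat_def eventually_at_filter exp_minus divide_simps power_inverse intro!: always_eventually)
  ultimately have "(flat n \<longlongrightarrow> 0) (at_right 0)" by (rule Lim_transform_eventually)
  moreover have "(flat n \<longlongrightarrow> 0) (at_left 0)"
    by (rule Lim_transform_eventually[OF tendsto_const])
      (auto simp: flat_def eventually_at_filter intro!: always_eventually)
  ultimately show ?thesis by (simp add: filterlim_at_split)
qed

lemma flat_has_derivative:
  "(flat n has_real_derivative flat (n + 2) t - real n * flat (n + 1) t) (at t)"
proof -
  consider "t > 0" | "t < 0" | "t = 0" by linarith
  then show ?thesis
  proof cases
    case 1
    have "((\<lambda>t. exp (- 1 / t) * inverse t ^ n) has_real_derivative flat (n + 2) t - real n * flat (n + 1) t) (at t)"
    \<comment> \<open>The power rule involves the exponent n - 1, which is truncated for n =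
      0.\<close>
    proof (cases n)
      case 0
      then show ?thesis
        using 1 by (auto intro!: derivative_eq_intros simp: flat_def field_simps power2_eq_square)
    next
      case (Suc m)
      then show ?thesis
        using 1 by (auto intro!: derivative_eq_intros simp: flat_def field_simps power2_eq_square
          simp del: power_Suc) (simp_all add: power_inverse field_simps)
    qed
    then show ?thesis
      by (rule has_field_derivative_transform_within_open[where S="{0<..}"])
        (use 1 in \<open>auto simp: flat_def divide_inverse power_inverse\<close>)
  next
    case 2
    have "((\<lambda>t. 0) has_real_derivative flat (n + 2) t - real n * flat (n + 1) t) (at t)"
      using 2 by (simp add: flat_def)
    then show ?thesis
      by (rule has_field_derivative_transform_within_open[where S="{..<0}"])
        (use 2 in \<open>auto simp: flat_def\<close>)
  next
    case 3
    \<comment> \<open>The difference quotient at 0 is itself a member of the family,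
      \<open>flat (Suc n)\<close>, so its limit is already known.\<close>
    have "((\<lambda>h. flat n h / h) \<longlongrightarrow> 0) (at 0)"
      by (rule Lim_transform_eventually[OF flat_tendsto_0[of "Suc n"]])
        (auto simp: flat_def eventually_at_filter intro!: always_eventually)
    then show ?thesis using 3 by (simp add: has_field_derivative_iff flat_def)
  qed
qed

lemma Ck_on_flat: "Ck_on k UNIV (flat n)"
proof (induction k arbitrary: n)
  case 0
  then show ?case
    using flat_has_derivative by (auto intro!: continuous_at_imp_continuous_on DERIV_isCont)
next
  case (Suc k)
  show ?case
  proof (rule Ck_on_step[where f'="\<lambda>t v. (flat (n + 2) t + (- real n) * flat (n + 1) t) * v"])
    show "(flat n has_derivative (\<lambda>v. (flat (n + 2) t + (- real n) * flat (n + 1) t) * v)) (at t)" for t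
      using flat_has_derivative[of n t] by (simp add: has_field_derivative_def)
    show "Ck_on k UNIV (\<lambda>t. (flat (n + 2) t + (- real n) * flat (n + 1) t) * v)" for v
      by (intro Ck_on_mult Ck_on_add Ck_on_const Suc) simp_all
  qed simp
qed

text \<open>The quotient of \<open>flat 0 (2 - t)\<close> by
  \<open>flat 0 (2 - t) + flat 0 (t - 1)\<close>. The denominator is positive because 2 - t and t -
  1 are never both nonpositive; the second summand vanishes for t \<le> 1, the numerator for t \<ge>
  2.\<close>

lemma smooth_cutoff_real:
  "\<exists>\<eta> :: real \<Rightarrow> real. smooth_on UNIV \<eta> \<and> (\<forall>t\<le>1. \<eta> t = 1) \<and> (\<forall>t\<ge>2. \<eta> t = 0) \<and>
     (\<forall>t. 0 \<le> \<eta> t \<and> \<eta> t \<le> 1)"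
proof (intro exI conjI allI impI)
  define den where "den t = flat 0 (2 - t) + flat 0 (t - 1)" for t
  have pos: "den t > 0" for t by (auto simp: den_def flat_def intro: add_pos_pos)
  have lin: "Ck_on k UNIV (\<lambda>t::real. a + b * t)" for k a b
    by (intro Ck_on_add Ck_on_mult Ck_on_const Ck_on_bounded_linear) (auto intro: bounded_linear_ident)
  have c: "Ck_on k UNIV (\<lambda>t. flat 0 (a + b * t))" for k a b
    using Ck_on_compose[OF _ _ _ Ck_on_flat lin] by (simp add: o_def)
  have n: "Ck_on k UNIV (\<lambda>t. flat 0 (2 - t))" "Ck_on k UNIV (\<lambda>t. flat 0 (t - 1))" for k
    using c[of k 2 "-1"] c[of k "-1" 1] by simp_all
  have inv: "Ck_on k UNIV (inverse \<circ> den)" for k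
  proof (rule Ck_on_compose[OF _ _ _ Ck_on_inverse])
    show "Ck_on k UNIV den" unfolding den_def[abs_def] by (intro Ck_on_add n) simp
  qed (use pos in auto)
  show "smooth_on UNIV (\<lambda>t. flat 0 (2 - t) * (inverse \<circ> den) t)"
    unfolding smooth_on_def by (intro allI Ck_on_mult n inv open_UNIV)
  show "flat 0 (2 - t) * (inverse \<circ> den) t = 1" if "t \<le> 1" for t
    using pos[of t] that by (auto simp: den_def flat_def)
  show "flat 0 (2 - t) * (inverse \<circ> den) t = 0" if "t \<ge> 2" for t
    using that by (auto simp: flat_def)
  show "0 \<le> flat 0 (2 - t) * (inverse \<circ> den) t" "flat 0 (2 - t) * (inverse \<circ> den) t \<le> 1" for t
    using pos[of t] by (auto simp: den_def flat_def field_simps)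
qed

section \<open>Smooth functions on manifolds\<close>


context
  fixes A :: "('m::{t2_space, second_countable_topology}, 'n::euclidean_space) atlas"
  assumes mfd: "smooth_manifold A"
begin

lemma chart_exists: "\<exists>U \<phi>. (U, \<phi>) \<in> A \<and> q \<in> U"
proof -
  have "q \<in> (\<Union>(U, \<phi>)\<in>A. U)" using mfd[unfolded smooth_manifold_def, THEN conjunct1] by simp
  then show ?thesis by auto
qed

lemma chartD:
  assumes "(U, \<phi>) \<in> A"
  shows chart_open: "open U"
    and chart_homeomorphism: "homeomorphism U (\<phi> ` U) \<phi> (inv_into U \<phi>)"
    and "open (\<phi> ` U)"
proof -
  have "\<forall>(U, \<phi>)\<in>A. open U \<and> open (\<phi> ` U) \<and> homeomorphism U (\<phi> ` U) \<phi> (inv_into U \<phi>)"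
    by (rule mfd[unfolded smooth_manifold_def, THEN conjunct2, THEN conjunct1])
  from bspec[OF this assms]
  show "open U" "homeomorphism U (\<phi> ` U) \<phi> (inv_into U \<phi>)" "open (\<phi> ` U)" by simp_all
qed

lemma chart_transition:
  assumes "(U, \<phi>) \<in> A" "(V, \<psi>) \<in> A"
  shows "smooth_on (\<phi> ` (U \<inter> V)) (\<psi> \<circ> inv_into U \<phi>)"
proof -
  have "\<forall>(U, \<phi>)\<in>A. \<forall>(V, \<psi>)\<in>A. smooth_on (\<phi> ` (U \<inter> V)) (\<psi> \<circ> inv_into U \<phi>)"
    by (rule mfd[unfolded smooth_manifold_def, THEN conjunct2, THEN conjunct2])
  from bspec[OF this assms(1)] have "\<forall>(V, \<psi>)\<in>A. smooth_on (\<phi> ` (U \<inter> V)) (\<psi> \<circ> inv_into U \<phi>)"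
    by simp
  from bspec[OF this assms(2)] show ?thesis by simp
qed

lemma chart_inv:
  assumes "(U, \<phi>) \<in> A" "q \<in> U"
  shows "inv_into U \<phi> (\<phi> q) = q"
  using chart_homeomorphism[OF assms(1)] assms(2) by (auto simp: homeomorphism_def)

lemma chart_continuous:
  assumes "(U, \<phi>) \<in> A"
  shows "continuous_on U \<phi>" and chart_inv_continuous: "continuous_on (\<phi> ` U) (inv_into U \<phi>)"
  using chart_homeomorphism[OF assms] by (simp_all add: homeomorphism_def)

lemma chart_open_image:
  assumes "(U, \<phi>) \<in> A" "open W"
  shows "open (\<phi> ` (U \<inter> W))"
proof -
  have "openin (top_of_set (\<phi> ` U)) (\<phi> ` (U \<inter> W))"
    using homeomorphism_imp_open_map[OF chart_homeomorphism[OF assms(1)]] assms(2)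
    by (simp add: openin_open_Int)
  then show ?thesis using chartD(3)[OF assms(1)] openin_open_eq by blast
qed

lemma smooth_fun_on_alt:
  "smooth_fun_on A W f \<longleftrightarrow> (\<forall>U \<phi> k. (U, \<phi>) \<in> A \<longrightarrow> Ck_on k (\<phi> ` (U \<inter> W)) (f \<circ> inv_into U \<phi>))"
  by (auto simp: smooth_fun_on_def smooth_on_def)

lemma smooth_fun_on_cong:
  assumes "open W" "\<And>q. q \<in> W \<Longrightarrow> f q = g q" "smooth_fun_on A W f"
  shows "smooth_fun_on A W g"
  unfolding smooth_fun_on_alt
proof (intro allI impI)
  fix U \<phi> k assume U: "(U, \<phi>) \<in> A"
  show "Ck_on k (\<phi> ` (U \<inter> W)) (g \<circ> inv_into U \<phi>)"
  proof (rule Ck_on_cong[OF chart_open_image[OF U assms(1)]])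
    show "Ck_on k (\<phi> ` (U \<inter> W)) (f \<circ> inv_into U \<phi>)"
      using U assms(3) by (auto simp: smooth_fun_on_alt)
  qed (use U assms(2) in \<open>auto simp: chart_inv\<close>)
qed

lemma smooth_fun_on_subset: "smooth_fun_on A W f \<Longrightarrow> V \<subseteq> W \<Longrightarrow> smooth_fun_on A V f"
  unfolding smooth_fun_on_alt by (blast intro: Ck_on_subset)

lemma smooth_fun_on_Un:
  assumes "open V" "open W" "smooth_fun_on A V f" "smooth_fun_on A W f"
  shows "smooth_fun_on A (V \<union> W) f"
  unfolding smooth_fun_on_alt
proof (intro allI impI)
  fix U \<phi> k assume U: "(U, \<phi>) \<in> A"
  have "Ck_on k (\<phi> ` (U \<inter> V) \<union> \<phi> ` (U \<inter> W)) (f \<circ> inv_into U \<phi>)"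
    using assms U by (intro Ck_on_Un chart_open_image) (auto simp: smooth_fun_on_alt)
  then show "Ck_on k (\<phi> ` (U \<inter> (V \<union> W))) (f \<circ> inv_into U \<phi>)"
    by (simp only: Int_Un_distrib image_Un)
qed

lemma smooth_fun_on_const: "smooth_fun_on A W (\<lambda>_. c)"
  by (simp add: smooth_fun_on_alt o_def Ck_on_const)

lemma smooth_fun_on_add:
  assumes "open W" "smooth_fun_on A W f" "smooth_fun_on A W g"
  shows "smooth_fun_on A W (\<lambda>q. f q + g q)"
  using assms unfolding smooth_fun_on_alt by (simp add: o_def Ck_on_add chart_open_image)

lemma smooth_fun_on_mult:
  assumes "open W" "smooth_fun_on A W f" "smooth_fun_on A W g"
  shows "smooth_fun_on A W (\<lambda>q. f q * g q)"
  using assms unfolding smooth_fun_on_alt by (simp add: o_def Ck_on_mult chart_open_image)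

lemma smooth_fun_on_compose:
  assumes "open W" "open T" "f ` W \<subseteq> T" "smooth_on T \<rho>" "smooth_fun_on A W f"
  shows "smooth_fun_on A W (\<lambda>q. \<rho> (f q))"
  unfolding smooth_fun_on_alt
proof (intro allI impI)
  fix U \<phi> k assume U: "(U, \<phi>) \<in> A"
  have "Ck_on k (\<phi> ` (U \<inter> W)) (\<rho> \<circ> (f \<circ> inv_into U \<phi>))"
  proof (rule Ck_on_compose[OF chart_open_image[OF U assms(1)] assms(2)])
    show "(f \<circ> inv_into U \<phi>) ` \<phi> ` (U \<inter> W) \<subseteq> T"
      using assms(3) chart_inv[OF U] by auto
  qed (use assms(4,5) U in \<open>auto simp: smooth_fun_on_alt smooth_on_def\<close>)
  then show "Ck_on k (\<phi> ` (U \<inter> W)) ((\<lambda>q. \<rho> (f q)) \<circ> inv_into U \<phi>)" by (simp add: o_def)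
qed

lemma smooth_fun_on_continuous:
  assumes "open W" "smooth_fun_on A W f"
  shows "continuous_on W f"
  unfolding continuous_on_eq_continuous_at[OF assms(1)]
proof
  fix q assume q: "q \<in> W"
  obtain U \<phi> where U: "(U, \<phi>) \<in> A" "q \<in> U" using chart_exists by blast
  have "Ck_on 0 (\<phi> ` (U \<inter> W)) (f \<circ> inv_into U \<phi>)"
    using U assms(2) unfolding smooth_fun_on_alt by blast
  then have "continuous_on (U \<inter> W) ((f \<circ> inv_into U \<phi>) \<circ> \<phi>)"
    using continuous_on_compose[OF continuous_on_subset[OF chart_continuous(1)[OF U(1)]], of "U \<inter> W"] by simp
  moreover have "((f \<circ> inv_into U \<phi>) \<circ> \<phi>) x = f x" if "x \<in> U \<inter> W" for x
    using that chart_inv[OF U(1)] by simp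
  ultimately have "continuous_on (U \<inter> W) f" by (rule continuous_on_eq)
  moreover have "open (U \<inter> W)" using chart_open[OF U(1)] assms(1) by (rule open_Int)
  ultimately show "isCont f q"
    using q U(2) continuous_on_eq_continuous_at by blast
qed

text \<open>The one-dimensional cutoff is applied to a multiple of the squared distance from the
  centre in a chart. The closed set K carrying the support serves to extend local data by zero, the
  plateau N to replace local data by global ones without changing germs at p.\<close>

lemma bump_function:
  assumes "open W" "p \<in> W"
  obtains \<theta> K N where "\<theta> \<in> Cinf A" "closed K" "K \<subseteq> W" "\<And>q. q \<notin> K \<Longrightarrow> \<theta> q = 0"
    "open N" "p \<in> N" "\<And>q. q \<in> N \<Longrightarrow> \<theta> q = 1"
proof -
  obtain U \<phi> where U: "(U, \<phi>) \<in> A" "p \<in> U" using chart_exists by blast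
  have "open (\<phi> ` (U \<inter> W))" by (rule chart_open_image[OF U(1) assms(1)])
  then obtain d where d: "d > 0" "cball (\<phi> p) d \<subseteq> \<phi> ` (U \<inter> W)"
    using assms(2) U(2) open_contains_cball by blast
  from smooth_cutoff_real obtain \<eta> :: "real \<Rightarrow> real" where "smooth_on UNIV \<eta> \<and> (\<forall>t\<le>1. \<eta> t = 1) \<and>
    (\<forall>t\<ge>2. \<eta> t = 0) \<and> (\<forall>t. 0 \<le> \<eta> t \<and> \<eta> t \<le> 1)" ..
  then have \<eta>: "smooth_on UNIV \<eta>" "\<And>t. t \<le> 1 \<Longrightarrow> \<eta> t = 1" "\<And>t. t \<ge> 2 \<Longrightarrow> \<eta> t = 0"
    "\<And>t. 0 \<le> \<eta> t \<and> \<eta> t \<le> 1" by simp_all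
  \<comment> \<open>Scaled so that b is 2 on the sphere of radius d, where the cutoff has reached 0,
    and below 1/2 on the ball of radius d/2, where it is 1.\<close>
  define b where "b x = 2 / d\<^sup>2 * ((x - \<phi> p) \<bullet> (x - \<phi> p))" for x
  have b: "Ck_on k UNIV b" for k
  proof -
    have "Ck_on k UNIV (\<lambda>x. x \<bullet> i + (- \<phi> p \<bullet> i))" for i
      by (intro Ck_on_add Ck_on_bounded_linear[OF bounded_linear_inner_left] Ck_on_const open_UNIV)
    then have "Ck_on k UNIV (\<lambda>x. 2 / d\<^sup>2 * (\<Sum>i\<in>Basis. (x \<bullet> i + (- \<phi> p \<bullet> i)) * (x \<bullet> i + (- \<phi> p \<bullet> i))))"
      by (intro Ck_on_mult Ck_on_const Ck_on_sum open_UNIV)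
    moreover have "b = (\<lambda>x. 2 / d\<^sup>2 * (\<Sum>i\<in>Basis. (x \<bullet> i + (- \<phi> p \<bullet> i)) * (x \<bullet> i + (- \<phi> p \<bullet> i))))"
      unfolding b_def by (subst euclidean_inner) (simp add: inner_diff_left)
    ultimately show ?thesis by simp
  qed
  have bn: "b x = 2 * (dist (\<phi> p) x / d)\<^sup>2" for x
    by (simp add: b_def dist_norm norm_minus_commute power_divide flip: power2_norm_eq_inner)
  define \<theta> where "\<theta> q = (if q \<in> U then \<eta> (b (\<phi> q)) else 0)" for q
  define K where "K = inv_into U \<phi> ` cball (\<phi> p) d"
  define N where "N = U \<inter> \<phi> -` ball (\<phi> p) (d / 2)"
  \<comment> \<open>A continuous image of a closed ball; it is closed in the manifold because the
    manifold is Hausdorff.\<close>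
  have "compact K" unfolding K_def
  proof (rule compact_continuous_image[OF _ compact_cball])
    show "continuous_on (cball (\<phi> p) d) (inv_into U \<phi>)"
      using continuous_on_subset[OF chart_inv_continuous[OF U(1)]] d(2) by blast
  qed
  then have K: "closed K" by (rule compact_imp_closed)
  have KW: "K \<subseteq> U \<inter> W"
  proof
    fix q assume "q \<in> K"
    then obtain x where "x \<in> cball (\<phi> p) d" "q = inv_into U \<phi> x" unfolding K_def by blast
    moreover then obtain y where "y \<in> U \<inter> W" "x = \<phi> y" using d(2) by blast
    ultimately show "q \<in> U \<inter> W" using chart_inv[OF U(1)] by simp
  qed
  have out: "\<theta> q = 0" if "q \<notin> K" for q
  proof (cases "q \<in> U")
    case True
    then have "\<phi> q \<notin> cball (\<phi> p) d"
      using that chart_inv[OF U(1) True] unfolding K_def by (metis imageI)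
    then have "1 \<le> (dist (\<phi> p) (\<phi> q) / d)\<^sup>2" using d(1) by (intro one_le_power) auto
    then have "2 \<le> b (\<phi> q)" by (simp add: bn)
    then show ?thesis using \<eta>(3) by (simp add: \<theta>_def)
  qed (simp add: \<theta>_def)
  have N: "open N" unfolding N_def
    by (rule continuous_open_preimage[OF chart_continuous(1)[OF U(1)] chart_open[OF U(1)] open_ball])
  have one: "\<theta> q = 1" if "q \<in> N" for q
  proof -
    have "dist (\<phi> p) (\<phi> q) / d \<le> 1 / 2" using that d(1) by (auto simp: N_def divide_simps)
    then have "(dist (\<phi> p) (\<phi> q) / d)\<^sup>2 \<le> (1 / 2)\<^sup>2" using d(1) by (intro power_mono) auto
    then have "2 * (dist (\<phi> p) (\<phi> q) / d)\<^sup>2 \<le> 2 * (1 / 2)\<^sup>2" by (rule mult_left_mono) simp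
    also have "2 * (1 / 2 :: real)\<^sup>2 \<le> 1" by (simp add: power2_eq_square)
    finally have "b (\<phi> q) \<le> 1" by (simp only: bn)
    then show ?thesis using \<eta>(2) that by (simp add: \<theta>_def N_def)
  qed
  have "smooth_fun_on A U \<theta>"
    unfolding smooth_fun_on_alt
  proof (intro allI impI)
    fix V \<psi> k assume V: "(V, \<psi>) \<in> A"
    let ?S = "\<psi> ` (V \<inter> U)"
    have "Ck_on k ?S ((\<eta> \<circ> b) \<circ> (\<phi> \<circ> inv_into V \<psi>))"
    proof (rule Ck_on_compose[OF chart_open_image[OF V chart_open[OF U(1)]] open_UNIV])
      show "Ck_on k ?S (\<phi> \<circ> inv_into V \<psi>)"
        using chart_transition[OF V U(1)] by (simp only: smooth_on_def)
      show "Ck_on k UNIV (\<eta> \<circ> b)"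
        by (rule Ck_on_compose[OF open_UNIV open_UNIV _ _ b]) (use \<eta>(1) in \<open>simp_all add: smooth_on_def\<close>)
    qed simp
    then show "Ck_on k ?S (\<theta> \<circ> inv_into V \<psi>)"
      by (rule Ck_on_cong[OF chart_open_image[OF V chart_open[OF U(1)]], rotated])
        (use chart_inv[OF V] in \<open>auto simp: \<theta>_def\<close>)
  qed
  moreover have "smooth_fun_on A (- K) \<theta>"
    by (rule smooth_fun_on_cong[of _ "\<lambda>_. 0"]) (use K out in \<open>auto simp: smooth_fun_on_const\<close>)
  \<comment> \<open>On U smoothness comes from the chart transitions, off K the function is 0, and
    these two open sets cover the manifold.\<close>
  ultimately have "smooth_fun_on A (U \<union> - K) \<theta>"
    using K chart_open[OF U(1)] by (intro smooth_fun_on_Un) auto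
  moreover have "U \<union> - K = UNIV" using KW by auto
  ultimately have "\<theta> \<in> Cinf A" by simp
  moreover have "p \<in> N" using U(2) d(1) by (simp add: N_def)
  moreover have "K \<subseteq> W" using KW by simp
  ultimately show thesis using K out N one by (intro that[of \<theta> K N])
qed

text \<open>Extension by zero: the product is smooth on the part of V inside U, vanishes on the part
  outside K, and these open pieces cover V since K lies in U. Nothing is asked of c outside
  U.\<close>

lemma smooth_fun_on_extend:
  assumes "open U" "open V" "closed K" "K \<subseteq> U" "\<And>q. q \<notin> K \<Longrightarrow> \<theta> q = 0" "\<theta> \<in> Cinf A"
    "smooth_fun_on A (U \<inter> V) c"
  shows "smooth_fun_on A V (\<lambda>q. \<theta> q * c q)"
proof -
  have "smooth_fun_on A (U \<inter> V) \<theta>" using assms(6) smooth_fun_on_subset by auto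
  then have "smooth_fun_on A (U \<inter> V) (\<lambda>q. \<theta> q * c q)"
    using assms by (intro smooth_fun_on_mult) auto
  moreover have "smooth_fun_on A (V \<inter> - K) (\<lambda>q. \<theta> q * c q)"
    by (rule smooth_fun_on_cong[of _ "\<lambda>_. 0"]) (use assms in \<open>auto simp: smooth_fun_on_const\<close>)
  ultimately have "smooth_fun_on A (U \<inter> V \<union> V \<inter> - K) (\<lambda>q. \<theta> q * c q)"
    using assms by (intro smooth_fun_on_Un) auto
  moreover have "U \<inter> V \<union> V \<inter> - K = V" using assms(4) by auto
  ultimately show ?thesis by simp
qed

lemma Cinf_const: "(\<lambda>_. c) \<in> Cinf A"
  by (simp add: smooth_fun_on_const)

lemma Cinf_add: "f \<in> Cinf A \<Longrightarrow> g \<in> Cinf A \<Longrightarrow> f + g \<in> Cinf A"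
  using smooth_fun_on_add[of UNIV f g] by (simp add: plus_fun_def)

lemma Cinf_mult: "f \<in> Cinf A \<Longrightarrow> g \<in> Cinf A \<Longrightarrow> f * g \<in> Cinf A"
  using smooth_fun_on_mult[of UNIV f g] by (simp add: times_fun_def)

text \<open>A function that is 1 at p may have zeros elsewhere. It is replaced by a positive smooth
  function m that agrees with it near p, and m is inverted globally.\<close>

lemma Cinf_local_reciprocal:
  assumes "h \<in> Cinf A" "h p = 1"
  obtains g where "g \<in> Cinf A" "eventually (\<lambda>q. g q * h q = 1) (nhds p)"
proof -
  from smooth_cutoff_real obtain \<eta> :: "real \<Rightarrow> real" where "smooth_on UNIV \<eta> \<and> (\<forall>t\<le>1. \<eta> t = 1) \<and>
    (\<forall>t\<ge>2. \<eta> t = 0) \<and> (\<forall>t. 0 \<le> \<eta> t \<and> \<eta> t \<le> 1)" ..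
  then have \<eta>: "smooth_on UNIV \<eta>" "\<And>t. t \<le> 1 \<Longrightarrow> \<eta> t = 1" "\<And>t. t \<ge> 2 \<Longrightarrow> \<eta> t = 0"
    "\<And>t. 0 \<le> \<eta> t \<and> \<eta> t \<le> 1" by simp_all
  \<comment> \<open>The constant 16 makes the cutoff equal to 1 for \<bar>h - 1\<bar> \<le> 1/4, so
    that m = h there, and equal to 0 once (h - 1)^2 \<ge> 1/8. Hence the perturbation of 1 always
    has absolute value below 1 and m stays positive.\<close>
  define m where "m q = 1 + (h q + (- 1)) * \<eta> (16 * ((h q + (- 1)) * (h q + (- 1))))" for q
  have pos: "m q > 0" for q
  proof (cases "16 * ((h q - 1) * (h q - 1)) \<ge> 2")
    case True
    then show ?thesis using \<eta>(3) by (simp add: m_def)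
  next
    case False
    have "\<bar>h q - 1\<bar> < 1"
    proof (rule ccontr)
      assume "\<not> \<bar>h q - 1\<bar> < 1"
      then have "1 * 1 \<le> \<bar>h q - 1\<bar> * \<bar>h q - 1\<bar>" by (intro mult_mono) auto
      then show False using False by simp
    qed
    moreover have "\<bar>(h q - 1) * \<eta> (16 * ((h q - 1) * (h q - 1)))\<bar> \<le> \<bar>h q - 1\<bar> * 1"
      unfolding abs_mult using \<eta>(4)[of "16 * ((h q - 1) * (h q - 1))"] by (intro mult_mono) auto
    ultimately show ?thesis by (simp add: m_def)
  qed
  have h: "smooth_fun_on A UNIV h" using assms by simp
  have h1: "smooth_fun_on A UNIV (\<lambda>q. h q + (- 1))"
    by (intro smooth_fun_on_add smooth_fun_on_const h open_UNIV)
  have "smooth_fun_on A UNIV (\<lambda>q. 16 * ((h q + (- 1)) * (h q + (- 1))))"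
    by (intro smooth_fun_on_mult smooth_fun_on_const h1 open_UNIV)
  from smooth_fun_on_compose[OF open_UNIV open_UNIV _ \<eta>(1) this]
  have "smooth_fun_on A UNIV m" unfolding m_def[abs_def]
    by (intro smooth_fun_on_add smooth_fun_on_const smooth_fun_on_mult h1 open_UNIV) simp
  then have "smooth_fun_on A UNIV (\<lambda>q. inverse (m q))"
    using pos Ck_on_inverse by (intro smooth_fun_on_compose[of UNIV "{0<..}" m inverse]) (auto simp: smooth_on_def)
  moreover have "eventually (\<lambda>q. inverse (m q) * h q = 1) (nhds p)"
  proof -
    have "continuous_on UNIV (\<lambda>q. 16 * ((h q + (- 1)) * (h q + (- 1))))"
      using smooth_fun_on_continuous[OF open_UNIV h] by (intro continuous_intros)
    then have "open ((\<lambda>q. 16 * ((h q + (- 1)) * (h q + (- 1)))) -` {..<1})"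
      by (rule open_vimage[rotated]) simp
    then have "eventually (\<lambda>q. 16 * ((h q + (- 1)) * (h q + (- 1))) < 1) (nhds p)"
      unfolding eventually_nhds using assms(2) by (intro exI conjI) (assumption, auto)
    then show ?thesis
    proof eventually_elim
      case (elim q)
      then have "m q = h q" using \<eta>(2) by (simp add: m_def)
      then show ?case using pos[of q] by simp
    qed
  qed
  ultimately show thesis using that[of "\<lambda>q. inverse (m q)"] by simp
qed

end

section \<open>Sections, tensoriality and traces\<close>


lemma sum_fun_apply: "(\<Sum>i\<in>I. f i) x = (\<Sum>i\<in>I. f i x)"
  by (induction I rule: infinite_finite_induct) auto

lemma in_span_image:
  fixes f :: "'i \<Rightarrow> 'v::real_vector"
  assumes "finite I" "inj_on f I" "x \<in> span (f ` I)"
  obtains a where "x = (\<Sum>i\<in>I. a i *\<^sub>R f i)"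
proof -
  obtain b where "x = (\<Sum>v\<in>f ` I. b v *\<^sub>R v)"
    using assms(1,3) by (auto simp: span_finite)
  then have "x = (\<Sum>i\<in>I. b (f i) *\<^sub>R f i)"
    using assms(2) by (simp add: sum.reindex)
  then show thesis by (rule that)
qed

lemma independent_image_coeff_zero:
  fixes f :: "'i \<Rightarrow> 'v::real_vector"
  assumes "finite I" "inj_on f I" "independent (f ` I)" "(\<Sum>i\<in>I. a i *\<^sub>R f i) = 0" "j \<in> I"
  shows "a j = 0"
proof -
  let ?b = "\<lambda>x. a (the_inv_into I f x)"
  have "(\<Sum>x\<in>f ` I. ?b x *\<^sub>R x) = (\<Sum>i\<in>I. a i *\<^sub>R f i)"
    using assms(2) by (subst sum.reindex) (auto simp: the_inv_into_f_f intro!: sum.cong)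
  then have "?b (f j) = 0"
    using independentD[OF assms(3) finite_imageI[OF assms(1)] subset_refl, of ?b "f j"] assms(4,5) by simp
  then show ?thesis using assms(2,5) by (simp add: the_inv_into_f_f)
qed

section \<open>The module of sections and local frames by global sections\<close>

locale courant_bundle =
  fixes C :: "('m::{t2_space, second_countable_topology}, 'n::euclidean_space, 'v::real_vector) courant"
  assumes courant: "courant_algebroid C"
begin

lemmas courant_axioms = courant[unfolded courant_algebroid_def]

lemma manifold: "smooth_manifold (atlas C)"
  by (rule courant_axioms[THEN conjunct1])

lemma bundle_axioms: "vector_bundle C"
  by (rule courant_axioms[THEN conjunct2, THEN conjunct1])

lemma scal_metric: "fibre_metric C (scal C)"
  by (rule courant_axioms[THEN conjunct2, THEN conjunct2, THEN conjunct1])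

lemma anchor_tangent: "v \<in> fibre C p \<Longrightarrow> anchor C p v \<in> tangent_space (atlas C) p"
  using courant_axioms[THEN conjunct2, THEN conjunct2, THEN conjunct2, THEN conjunct1] by blast

lemma anchor_linear: "linear_on (fibre C p) (\<lambda>v. anchor C p v f)"
  using courant_axioms[THEN conjunct2, THEN conjunct2, THEN conjunct2, THEN conjunct2, THEN conjunct1] by blast

lemma anch_vector_field: "u \<in> sections C \<Longrightarrow> anch C u \<in> vector_fields (atlas C)"
  using courant_axioms[THEN conjunct2, THEN conjunct2, THEN conjunct2, THEN conjunct2, THEN conjunct2, THEN conjunct1] by blast

lemma dorfman_section: "u \<in> sections C \<Longrightarrow> v \<in> sections C \<Longrightarrow> dorfman C u v \<in> sections C"
  using courant_axioms[THEN conjunct2, THEN conjunct2, THEN conjunct2, THEN conjunct2, THEN conjunct2, THEN conjunct2, THEN conjunct1] by blast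

lemma anch_dorfman: "u \<in> sections C \<Longrightarrow> v \<in> sections C \<Longrightarrow>
    anch C (dorfman C u v) = lie_bracket (anch C u) (anch C v)"
  using courant_axioms[THEN conjunct2, THEN conjunct2, THEN conjunct2, THEN conjunct2, THEN conjunct2, THEN conjunct2, THEN conjunct2, THEN conjunct2, THEN conjunct2, THEN conjunct2, THEN conjunct1] by blast

lemma app_sprod: "u \<in> sections C \<Longrightarrow> v \<in> sections C \<Longrightarrow> w \<in> sections C \<Longrightarrow>
    app (anch C u) (sprod C v w) = sprod C (dorfman C u v) w + sprod C v (dorfman C u w)"
  using courant_axioms[THEN conjunct2, THEN conjunct2, THEN conjunct2, THEN conjunct2, THEN conjunct2, THEN conjunct2, THEN conjunct2, THEN conjunct2, THEN conjunct2, THEN conjunct2, THEN conjunct2, THEN conjunct2, THEN conjunct1] by blast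

lemma sprod_symmetric_bracket: "u \<in> sections C \<Longrightarrow> v \<in> sections C \<Longrightarrow> w \<in> sections C \<Longrightarrow>
    sprod C (dorfman C u v + dorfman C v u) w = app (anch C w) (sprod C u v)"
  using courant_axioms[THEN conjunct2, THEN conjunct2, THEN conjunct2, THEN conjunct2, THEN conjunct2, THEN conjunct2, THEN conjunct2, THEN conjunct2, THEN conjunct2, THEN conjunct2, THEN conjunct2, THEN conjunct2, THEN conjunct2] by blast

lemma fibre_subspace: "subspace (fibre C p)"
  by (rule bundle_axioms[unfolded vector_bundle_def, THEN conjunct1, THEN spec])

lemma frame_at:
  obtains U s where "(U, s) \<in> frames C" "p \<in> U"
proof -
  have "p \<in> (\<Union>(U, s)\<in>frames C. U)"
    using bundle_axioms[unfolded vector_bundle_def, THEN conjunct2, THEN conjunct1] by simp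
  then show thesis using that by auto
qed

lemma frame_basis:
  assumes "(U, s) \<in> frames C"
  shows "open U"
    and "p \<in> U \<Longrightarrow> inj_on (\<lambda>i. s i p) {..<rk C}"
    and "p \<in> U \<Longrightarrow> independent ((\<lambda>i. s i p) ` {..<rk C})"
    and "p \<in> U \<Longrightarrow> span ((\<lambda>i. s i p) ` {..<rk C}) = fibre C p"
  using bspec[OF bundle_axioms[unfolded vector_bundle_def, THEN conjunct2, THEN conjunct2, THEN conjunct1] assms]
  by simp_all

lemma frame_transition:
  assumes "(U, s) \<in> frames C" "(V, t) \<in> frames C"
  obtains a where "\<And>i j. i < rk C \<Longrightarrow> j < rk C \<Longrightarrow> smooth_fun_on (atlas C) (U \<inter> V) (a i j)"
    and "\<And>p j. p \<in> U \<inter> V \<Longrightarrow> j < rk C \<Longrightarrow> t j p = (\<Sum>i<rk C. a i j p *\<^sub>R s i p)"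
proof -
  have "\<forall>(V, t)\<in>frames C. \<exists>a.
        (\<forall>i<rk C. \<forall>j<rk C. smooth_fun_on (atlas C) (U \<inter> V) (a i j)) \<and>
        (\<forall>p\<in>U \<inter> V. \<forall>j<rk C. t j p = (\<Sum>i<rk C. a i j p *\<^sub>R s i p))"
    using bspec[OF bundle_axioms[unfolded vector_bundle_def, THEN conjunct2, THEN conjunct2, THEN conjunct2] assms(1)]
    by simp
  from bspec[OF this assms(2)] obtain a where
    "\<forall>i<rk C. \<forall>j<rk C. smooth_fun_on (atlas C) (U \<inter> V) (a i j)"
    "\<forall>p\<in>U \<inter> V. \<forall>j<rk C. t j p = (\<Sum>i<rk C. a i j p *\<^sub>R s i p)"
    by auto
  then show thesis using that[of a] by simp
qed

lemma section_fibre: "u \<in> sections C \<Longrightarrow> u p \<in> fibre C p"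
  by (simp add: sections_def)

lemma section_coordinates:
  assumes "u \<in> sections C" "(U, s) \<in> frames C"
  obtains c where "\<And>i. i < rk C \<Longrightarrow> smooth_fun_on (atlas C) U (c i)"
    and "\<And>p. p \<in> U \<Longrightarrow> u p = (\<Sum>i<rk C. c i p *\<^sub>R s i p)"
proof -
  have "\<forall>(U, s)\<in>frames C. \<exists>c. (\<forall>i<rk C. smooth_fun_on (atlas C) U (c i)) \<and>
        (\<forall>p\<in>U. u p = (\<Sum>i<rk C. c i p *\<^sub>R s i p))"
    using assms(1) by (simp add: sections_def)
  from bspec[OF this assms(2)] obtain c where "\<forall>i<rk C. smooth_fun_on (atlas C) U (c i)"
    "\<forall>p\<in>U. u p = (\<Sum>i<rk C. c i p *\<^sub>R s i p)" by auto
  then show thesis using that[of c] by simp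
qed

lemma sectionI:
  assumes "\<And>p. u p \<in> fibre C p"
    and "\<And>U s. (U, s) \<in> frames C \<Longrightarrow> \<exists>c. (\<forall>i<rk C. smooth_fun_on (atlas C) U (c i)) \<and>
        (\<forall>p\<in>U. u p = (\<Sum>i<rk C. c i p *\<^sub>R s i p))"
  shows "u \<in> sections C"
  using assms by (auto simp: sections_def)

lemma section_add:
  assumes "u \<in> sections C" "v \<in> sections C"
  shows "u + v \<in> sections C"
proof (rule sectionI)
  fix U s assume U: "(U, s) \<in> frames C"
  obtain c where c: "\<And>i. i < rk C \<Longrightarrow> smooth_fun_on (atlas C) U (c i)"
    "\<And>p. p \<in> U \<Longrightarrow> u p = (\<Sum>i<rk C. c i p *\<^sub>R s i p)"
    using section_coordinates[OF assms(1) U] by metis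
  obtain d where d: "\<And>i. i < rk C \<Longrightarrow> smooth_fun_on (atlas C) U (d i)"
    "\<And>p. p \<in> U \<Longrightarrow> v p = (\<Sum>i<rk C. d i p *\<^sub>R s i p)"
    using section_coordinates[OF assms(2) U] by metis
  show "\<exists>c. (\<forall>i<rk C. smooth_fun_on (atlas C) U (c i)) \<and>
        (\<forall>p\<in>U. (u + v) p = (\<Sum>i<rk C. c i p *\<^sub>R s i p))"
    using c d frame_basis(1)[OF U]
    by (intro exI[of _ "\<lambda>i p. c i p + d i p"])
      (auto simp: scaleR_left_distrib sum.distrib smooth_fun_on_add[OF manifold])
qed (simp add: section_fibre assms subspace_add[OF fibre_subspace])

lemma section_smul:
  assumes "f \<in> fns C" "u \<in> sections C"
  shows "smul f u \<in> sections C"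
proof (rule sectionI)
  fix U s assume U: "(U, s) \<in> frames C"
  obtain c where c: "\<And>i. i < rk C \<Longrightarrow> smooth_fun_on (atlas C) U (c i)"
    "\<And>p. p \<in> U \<Longrightarrow> u p = (\<Sum>i<rk C. c i p *\<^sub>R s i p)"
    using section_coordinates[OF assms(2) U] by metis
  have "smooth_fun_on (atlas C) U f"
    using assms(1) smooth_fun_on_subset[OF manifold] by blast
  then show "\<exists>c. (\<forall>i<rk C. smooth_fun_on (atlas C) U (c i)) \<and>
        (\<forall>p\<in>U. smul f u p = (\<Sum>i<rk C. c i p *\<^sub>R s i p))"
    using c frame_basis(1)[OF U]
    by (intro exI[of _ "\<lambda>i p. f p * c i p"])
      (auto simp: smul_def scaleR_sum_right smooth_fun_on_mult[OF manifold])
qed (simp add: smul_def section_fibre assms subspace_scale[OF fibre_subspace])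

lemma fns_const: "(\<lambda>_. c) \<in> fns C"
  by (rule Cinf_const[OF manifold])

lemma fns_mult: "f \<in> fns C \<Longrightarrow> g \<in> fns C \<Longrightarrow> f * g \<in> fns C"
  by (rule Cinf_mult[OF manifold])

lemma section_zero: "0 \<in> sections C"
proof (rule sectionI)
  show "\<exists>c. (\<forall>i<rk C. smooth_fun_on (atlas C) U (c i)) \<and> (\<forall>p\<in>U. (0 :: 'm \<Rightarrow> 'v) p = (\<Sum>i<rk C. c i p *\<^sub>R s i p))" for U s
    by (intro exI[of _ "\<lambda>i p. 0"] conjI ballI allI impI smooth_fun_on_const[OF manifold]) simp
qed (simp add: subspace_0[OF fibre_subspace])

lemma section_diff:
  assumes "u \<in> sections C" "v \<in> sections C" shows "u - v \<in> sections C"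
proof -
  have "u - v = u + smul (\<lambda>_. - 1) v" by (auto simp: smul_def)
  then show ?thesis using assms by (simp only: section_add section_smul fns_const)
qed

lemma section_sum: "(\<And>i. i \<in> I \<Longrightarrow> u i \<in> sections C) \<Longrightarrow> (\<Sum>i\<in>I. u i) \<in> sections C"
  by (induction I rule: infinite_finite_induct) (auto intro: section_add section_zero)

text \<open>A local frame s is made global as E i = \<theta> s i with a bump function \<theta>. The
  coordinates c i of a section u also become global only after multiplication by \<theta>, so what
  has a global expansion is \<theta> \<theta> u = \<Sum> (\<theta> c i) (\<theta> s i); this is why
  \<open>smul \<theta>\<close> occurs twice. At p nothing is lost since \<theta> p = 1.\<close>

definition local_frame :: "'m \<Rightarrow> ('m \<Rightarrow> real) \<Rightarrow> (nat \<Rightarrow> 'm \<Rightarrow> 'v) \<Rightarrow> bool" where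
  "local_frame p \<theta> E \<longleftrightarrow> \<theta> \<in> fns C \<and> \<theta> p = 1 \<and> (\<forall>i<rk C. E i \<in> sections C) \<and>
     inj_on (\<lambda>i. E i p) {..<rk C} \<and> independent ((\<lambda>i. E i p) ` {..<rk C}) \<and>
     span ((\<lambda>i. E i p) ` {..<rk C}) = fibre C p \<and>
     (\<forall>u\<in>sections C. \<exists>c. (\<forall>i<rk C. c i \<in> fns C) \<and>
        smul \<theta> (smul \<theta> u) = (\<Sum>i<rk C. smul (c i) (E i)))"

lemma local_frameD:
  assumes "local_frame p \<theta> E"
  shows "\<theta> \<in> fns C" "\<theta> p = 1" "i < rk C \<Longrightarrow> E i \<in> sections C"
    "inj_on (\<lambda>i. E i p) {..<rk C}" "independent ((\<lambda>i. E i p) ` {..<rk C})"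
    "span ((\<lambda>i. E i p) ` {..<rk C}) = fibre C p"
  using assms by (simp_all add: local_frame_def)

lemma local_frame_coordinates:
  assumes "local_frame p \<theta> E" "u \<in> sections C"
  obtains c where "\<And>i. i < rk C \<Longrightarrow> c i \<in> fns C" "smul \<theta> (smul \<theta> u) = (\<Sum>i<rk C. smul (c i) (E i))"
  using assms unfolding local_frame_def by blast

lemma local_frame_exists: "\<exists>\<theta> E. local_frame p \<theta> E"
proof -
  obtain U s where U: "(U, s) \<in> frames C" "p \<in> U" by (rule frame_at)
  note oU = frame_basis(1)[OF U(1)]
  obtain \<theta> K N where \<theta>: "\<theta> \<in> fns C" "closed K" "K \<subseteq> U" "\<And>q. q \<notin> K \<Longrightarrow> \<theta> q = 0"
    "open N" "p \<in> N" "\<And>q. q \<in> N \<Longrightarrow> \<theta> q = 1"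
    using bump_function[OF manifold oU U(2)] by metis
  define E where "E i = smul \<theta> (s i)" for i
  have p: "\<theta> p = 1" using \<theta> by simp
  have Ep: "(\<lambda>i. E i p) = (\<lambda>i. s i p)" by (simp add: E_def smul_def p)
  have zero: "\<theta> q = 0" if "q \<notin> U" for q using \<theta>(3,4) that by blast
  have "E j \<in> sections C" if "j < rk C" for j
  proof (rule sectionI)
    fix q show "E j q \<in> fibre C q"
    proof (cases "q \<in> U")
      case True
      then have "s j q \<in> fibre C q"
        using frame_basis(4)[OF U(1) True] that span_base[of "s j q" "(\<lambda>i. s i q) ` {..<rk C}"] by auto
      then show ?thesis by (simp add: E_def smul_def subspace_scale[OF fibre_subspace])
    qed (simp add: E_def smul_def zero subspace_0[OF fibre_subspace])
  next
    fix V t assume V: "(V, t) \<in> frames C"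
    obtain a where a: "\<And>i j. i < rk C \<Longrightarrow> j < rk C \<Longrightarrow> smooth_fun_on (atlas C) (V \<inter> U) (a i j)"
      "\<And>p j. p \<in> V \<inter> U \<Longrightarrow> j < rk C \<Longrightarrow> s j p = (\<Sum>i<rk C. a i j p *\<^sub>R t i p)"
      using frame_transition[OF V U(1)] by metis
    have "smooth_fun_on (atlas C) V (\<lambda>q. \<theta> q * a i j q)" if "i < rk C" for i
      by (rule smooth_fun_on_extend[OF manifold oU frame_basis(1)[OF V] \<theta>(2,3,4,1)])
        (use a(1)[OF that \<open>j < rk C\<close>] in \<open>simp_all add: Int_commute\<close>)
    moreover have "E j q = (\<Sum>i<rk C. (\<theta> q * a i j q) *\<^sub>R t i q)" if "q \<in> V" for q
      using a(2)[of q j] that \<open>j < rk C\<close> zero[of q]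
      by (cases "q \<in> U") (auto simp: E_def smul_def scaleR_sum_right)
    ultimately show "\<exists>c. (\<forall>i<rk C. smooth_fun_on (atlas C) V (c i)) \<and>
        (\<forall>q\<in>V. E j q = (\<Sum>i<rk C. c i q *\<^sub>R t i q))"
      by (intro exI[of _ "\<lambda>i q. \<theta> q * a i j q"] conjI allI impI ballI)
  qed
  moreover have "\<exists>c. (\<forall>i<rk C. c i \<in> fns C) \<and> smul \<theta> (smul \<theta> u) = (\<Sum>i<rk C. smul (c i) (E i))"
    if u: "u \<in> sections C" for u
  proof -
    obtain c where c: "\<And>i. i < rk C \<Longrightarrow> smooth_fun_on (atlas C) U (c i)"
      "\<And>p. p \<in> U \<Longrightarrow> u p = (\<Sum>i<rk C. c i p *\<^sub>R s i p)"
      using section_coordinates[OF u U(1)] by metis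
    have "(\<lambda>q. \<theta> q * c i q) \<in> fns C" if "i < rk C" for i
      unfolding mem_Collect_eq by (rule smooth_fun_on_extend[OF manifold oU open_UNIV \<theta>(2,3,4,1)])
        (use c(1)[OF that] in simp_all)
    moreover have "smul \<theta> (smul \<theta> u) q = (\<Sum>i<rk C. smul (\<lambda>q. \<theta> q * c i q) (E i)) q" for q
      using c(2)[of q] zero[of q]
      by (cases "q \<in> U") (auto simp: E_def smul_def scaleR_sum_right sum_fun_apply mult_ac)
    ultimately show ?thesis by (intro exI[of _ "\<lambda>i q. \<theta> q * c i q"] conjI allI impI ext)
  qed
  ultimately show ?thesis
    unfolding local_frame_def
    by (intro exI[of _ \<theta>] exI[of _ E] conjI allI impI ballI \<theta>(1) p frame_basis(2-4)[OF U, folded Ep])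
qed

section \<open>Functionals on sections that depend only on the value at a point\<close>

definition tensorial :: "'m \<Rightarrow> (('m \<Rightarrow> 'v) \<Rightarrow> real) \<Rightarrow> bool" where
  "tensorial p L \<longleftrightarrow> (\<forall>u\<in>sections C. \<forall>v\<in>sections C. L (u + v) = L u + L v) \<and>
     (\<forall>f\<in>fns C. \<forall>u\<in>sections C. L (smul f u) = f p * L u)"

lemma tensorialD:
  assumes "tensorial p L"
  shows "u \<in> sections C \<Longrightarrow> v \<in> sections C \<Longrightarrow> L (u + v) = L u + L v"
    and "f \<in> fns C \<Longrightarrow> u \<in> sections C \<Longrightarrow> L (smul f u) = f p * L u"
  using assms unfolding tensorial_def by blast+

lemma tensorial_sum:
  assumes "tensorial p L" "\<And>i. i \<in> I \<Longrightarrow> f i \<in> fns C" "\<And>i. i \<in> I \<Longrightarrow> u i \<in> sections C"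
  shows "L (\<Sum>i\<in>I. smul (f i) (u i)) = (\<Sum>i\<in>I. f i p * L (u i))"
proof -
  have "smul (\<lambda>_. 0) 0 = (0 :: 'm \<Rightarrow> 'v)" by (auto simp: smul_def)
  then have 0: "L 0 = 0"
    using tensorialD(2)[OF assms(1) fns_const section_zero, of 0] by simp
  show ?thesis using assms(2,3)
    by (induction I rule: infinite_finite_induct)
      (simp_all add: 0 tensorialD[OF assms(1)] section_smul section_sum)
qed

text \<open>By additivity it suffices to treat a section w with w p = 0. The coordinates of \<theta>
  \<theta> w vanish at p by independence of the frame, so L annihilates \<theta> \<theta> w, and L
  takes the same value on w because \<theta> p = 1.\<close>

lemma tensorial_cong:
  assumes L: "tensorial p L" and "u \<in> sections C" "v \<in> sections C" "u p = v p"
  shows "L u = L v"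
proof -
  have zero: "L w = 0" if w: "w \<in> sections C" "w p = 0" for w
  proof -
    obtain \<theta> E where E: "local_frame p \<theta> E" using local_frame_exists by blast
    obtain c where c: "\<And>i. i < rk C \<Longrightarrow> c i \<in> fns C" "smul \<theta> (smul \<theta> w) = (\<Sum>i<rk C. smul (c i) (E i))"
      using local_frame_coordinates[OF E w(1)] by metis
    have "(\<Sum>i<rk C. c i p *\<^sub>R E i p) = smul \<theta> (smul \<theta> w) p"
      by (simp only: c(2) sum_fun_apply) (simp add: smul_def)
    also have "\<dots> = 0" using w(2) by (simp add: smul_def)
    finally have "c i p = 0" if "i < rk C" for i
      using that by (intro independent_image_coeff_zero[OF _ local_frameD(4,5)[OF E], of "\<lambda>i. c i p"]) simp_all
    then have "L (smul \<theta> (smul \<theta> w)) = 0"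
      unfolding c(2) by (subst tensorial_sum[OF L c(1) local_frameD(3)[OF E]]) simp_all
    then show "L w = 0"
      by (simp only: tensorialD(2)[OF L local_frameD(1)[OF E] section_smul[OF local_frameD(1)[OF E] w(1)]]
          tensorialD(2)[OF L local_frameD(1)[OF E] w(1)] local_frameD(2)[OF E] mult_1_left)
  qed
  have v: "smul (\<lambda>_. - 1) v \<in> sections C" by (intro section_smul fns_const assms)
  have "L (smul (\<lambda>_. - 1) v) = - 1 * L v" by (rule tensorialD(2)[OF L fns_const assms(3)])
  moreover have "L (u + smul (\<lambda>_. - 1) v) = 0"
    by (intro zero section_add assms(2) v) (simp add: smul_def assms(4))
  ultimately show ?thesis using tensorialD(1)[OF L assms(2) v] by simp
qed

lemma section_through:
  assumes "x \<in> fibre C p"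
  obtains u where "u \<in> sections C" "u p = x"
proof -
  obtain \<theta> E where E: "local_frame p \<theta> E" using local_frame_exists by blast
  obtain a where "x = (\<Sum>i<rk C. a i *\<^sub>R E i p)"
    using in_span_image[OF finite_lessThan local_frameD(4)[OF E]] assms local_frameD(6)[OF E] by blast
  then show thesis
    using local_frameD(3)[OF E] by (intro that[of "\<Sum>i<rk C. smul (\<lambda>_. a i) (E i)"])
      (auto simp: sum_fun_apply smul_def[of "\<lambda>_. _"] intro!: section_sum section_smul[unfolded smul_def] fns_const)
qed

section \<open>The scalar product on fibres and on sections\<close>

lemma scal_bilinear: "bilinear_on (fibre C p) (scal C p)"
  using scal_metric by (simp add: fibre_metric_def)

lemma
  assumes "x \<in> fibre C p" "z \<in> fibre C p"
  shows scal_add_left: "y \<in> fibre C p \<Longrightarrow> scal C p (x + y) z = scal C p x z + scal C p y z"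
    and scal_add_right: "y \<in> fibre C p \<Longrightarrow> scal C p z (x + y) = scal C p z x + scal C p z y"
    and scal_scale_left: "scal C p (c *\<^sub>R x) z = c * scal C p x z"
    and scal_scale_right: "scal C p z (c *\<^sub>R x) = c * scal C p z x"
  using scal_bilinear[of p] assms by (auto simp: bilinear_on_def linear_on_def)

lemma scal_commute: "x \<in> fibre C p \<Longrightarrow> y \<in> fibre C p \<Longrightarrow> scal C p x y = scal C p y x"
  using scal_metric by (simp add: fibre_metric_def sym_on_def)

lemma scal_nondegenerate:
  assumes "x \<in> fibre C p" "\<And>y. y \<in> fibre C p \<Longrightarrow> scal C p x y = 0" shows "x = 0"
proof -
  have "nondegenerate_on (fibre C p) (scal C p)" using scal_metric by (simp add: fibre_metric_def)
  then show ?thesis using assms by (simp add: nondegenerate_on_def)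
qed

lemma scal_sum_right:
  assumes "\<And>i. i \<in> I \<Longrightarrow> x i \<in> fibre C p" "z \<in> fibre C p"
  shows "scal C p z (\<Sum>i\<in>I. c i *\<^sub>R x i) = (\<Sum>i\<in>I. c i * scal C p z (x i))"
proof -
  have 0: "scal C p z 0 = 0"
    using scal_scale_right[OF subspace_0[OF fibre_subspace] assms(2), of 0] by simp
  show ?thesis using assms(1)
  proof (induction I rule: infinite_finite_induct)
    case (insert i I)
    have "(\<Sum>i\<in>I. c i *\<^sub>R x i) \<in> fibre C p" "c i *\<^sub>R x i \<in> fibre C p"
      using insert.prems by (auto intro!: subspace_sum[OF fibre_subspace] subspace_scale[OF fibre_subspace])
    then show ?case using insert by (simp add: scal_add_right[OF _ assms(2)] scal_scale_right[OF _ assms(2)])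
  qed (simp_all add: 0)
qed

lemma sprod_fns: "u \<in> sections C \<Longrightarrow> v \<in> sections C \<Longrightarrow> sprod C u v \<in> fns C"
  using scal_metric by (auto simp: fibre_metric_def sprod_def)

lemma
  assumes "u \<in> sections C" "v \<in> sections C"
  shows sprod_commute: "sprod C u v = sprod C v u"
    and sprod_smul_left: "sprod C (smul f u) v = f * sprod C u v"
    and sprod_smul_right: "sprod C u (smul f v) = f * sprod C u v"
    and sprod_add_left: "w \<in> sections C \<Longrightarrow> sprod C (u + v) w = sprod C u w + sprod C v w"
    and sprod_add_right: "w \<in> sections C \<Longrightarrow> sprod C w (u + v) = sprod C w u + sprod C w v"
    and sprod_diff_left: "w \<in> sections C \<Longrightarrow> sprod C (u - v) w = sprod C u w - sprod C v w"
proof -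
  show "sprod C u v = sprod C v u" unfolding sprod_def using assms by (intro ext scal_commute section_fibre)
  show "sprod C (smul f u) v = f * sprod C u v" "sprod C u (smul f v) = f * sprod C u v" for f
    using assms
    by (auto simp: sprod_def smul_def section_fibre fun_eq_iff intro!: scal_scale_left scal_scale_right)
  show add: "w \<in> sections C \<Longrightarrow> sprod C (u + v) w = sprod C u w + sprod C v w"
    "w \<in> sections C \<Longrightarrow> sprod C w (u + v) = sprod C w u + sprod C w v"
    using assms by (auto simp: sprod_def section_fibre scal_add_left scal_add_right)
  assume w: "w \<in> sections C"
  have v: "smul (\<lambda>_. - 1) v \<in> sections C" by (intro section_smul fns_const assms)
  have "u - v = u + smul (\<lambda>_. - 1) v" by (auto simp: smul_def)
  then have "sprod C (u - v) w = sprod C u w + sprod C (smul (\<lambda>_. - 1) v) w"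
    using v w assms(1) by (simp only:) (auto simp: sprod_def fun_eq_iff section_fibre scal_add_left)
  also have "sprod C (smul (\<lambda>_. - 1) v) w = - sprod C v w"
    using assms(2) w scal_scale_left[OF section_fibre section_fibre, of v w _ "- 1"]
    by (auto simp: sprod_def smul_def fun_eq_iff)
  finally show "sprod C (u - v) w = sprod C u w - sprod C v w"
    by (simp only: add_uminus_conv_diff)
qed

lemma tensorial_sprod:
  assumes "v \<in> sections C" shows "tensorial p (\<lambda>u. sprod C u v p)" "tensorial p (\<lambda>u. sprod C v u p)"
  using assms by (simp_all add: tensorial_def sprod_add_left sprod_add_right sprod_smul_left sprod_smul_right)

section \<open>Dual frames and traces\<close>

lemma dual_independent:
  assumes x: "\<And>i. i < n \<Longrightarrow> x i \<in> fibre C p" and y: "\<And>i. i < n \<Longrightarrow> y i \<in> fibre C p"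
    and d: "\<And>i j. i < n \<Longrightarrow> j < n \<Longrightarrow> scal C p (y i) (x j) = (if i = j then 1 else 0)"
  shows "inj_on x {..<n}" "independent (x ` {..<n})" "n \<le> rk C"
    "j < n \<Longrightarrow> scal C p (y j) (\<Sum>i<n. a i *\<^sub>R x i) = a j"
proof -
  show pair: "scal C p (y j) (\<Sum>i<n. a i *\<^sub>R x i) = a j" if "j < n" for j a
    using that by (subst scal_sum_right) (auto simp: x y d if_distrib[of "(*) _"] cong: if_cong)
  show inj: "inj_on x {..<n}"
  proof (rule inj_onI)
    fix i j assume "i \<in> {..<n}" "j \<in> {..<n}" "x i = x j"
    then show "i = j" using d[of i i] d[of i j] by (simp split: if_splits)
  qed
  show ind: "independent (x ` {..<n})"
  proof (rule independent_if_scalars_zero)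
    fix f z assume f: "(\<Sum>z\<in>x ` {..<n}. f z *\<^sub>R z) = 0" and "z \<in> x ` {..<n}"
    then obtain j where j: "j < n" "z = x j" by auto
    have "(\<Sum>i<n. f (x i) *\<^sub>R x i) = 0" using f inj by (simp add: sum.reindex)
    then have "f (x j) = scal C p (y j) 0"
      using pair[OF j(1), of "\<lambda>i. f (x i)"] by (simp only:)
    also have "\<dots> = 0" using pair[OF j(1), of "\<lambda>_. 0"] by (simp only: scaleR_zero_left sum.neutral_const)
    finally show "f z = 0" using j by simp
  qed simp
  obtain \<theta> E where E: "local_frame p \<theta> E" using local_frame_exists by blast
  have "x ` {..<n} \<subseteq> span ((\<lambda>i. E i p) ` {..<rk C})"
    using x local_frameD(6)[OF E] by auto
  then have "card (x ` {..<n}) \<le> card ((\<lambda>i. E i p) ` {..<rk C})"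
    using independent_span_bound[OF finite_imageI[OF finite_lessThan] ind] by blast
  then show "n \<le> rk C" using card_image[OF inj] card_image[OF local_frameD(4)[OF E]] by simp
qed

text \<open>Only the number of vectors is required to equal the rank: duality makes them a basis.\<close>

lemma dual_frames_expand:
  assumes "dual_frames (sections C) (rk C) (scal C) p e e'" "x \<in> fibre C p"
  shows "x = (\<Sum>i<rk C. scal C p (e' i p) x *\<^sub>R e i p)"
proof -
  have e: "e i p \<in> fibre C p" "e' i p \<in> fibre C p" if "i < rk C" for i
    using assms(1) that by (auto simp: dual_frames_def section_fibre)
  have d: "scal C p (e' i p) (e j p) = (if i = j then 1 else 0)" if "i < rk C" "j < rk C" for i j
    using assms(1) that by (auto simp: dual_frames_def)
  note dual = dual_independent[of "rk C" "\<lambda>i. e i p" p "\<lambda>i. e' i p", OF e d]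
  let ?S = "(\<lambda>i. e i p) ` {..<rk C}"
  have inj: "inj_on (\<lambda>i. e i p) {..<rk C}" and "independent ?S" by (rule dual; simp)+
  have pair: "scal C p (e' j p) (\<Sum>i<rk C. a i *\<^sub>R e i p) = a j" if "j < rk C" for j a
    by (rule dual) (use that in simp_all)
  obtain \<theta> E where E: "local_frame p \<theta> E" using local_frame_exists by blast
  let ?T = "(\<lambda>i. E i p) ` {..<rk C}"
  have "?S \<subseteq> span ?T" using e local_frameD(6)[OF E] by auto
  have "fibre C p \<subseteq> span ?S"
  proof (rule ccontr)
    assume "\<not> fibre C p \<subseteq> span ?S"
    then obtain y where y: "y \<in> fibre C p" "y \<notin> span ?S" by blast
    then have "independent (insert y ?S)" using \<open>independent ?S\<close> by (simp add: independent_insertI)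
    moreover have "insert y ?S \<subseteq> span ?T" using \<open>?S \<subseteq> span ?T\<close> y(1) local_frameD(6)[OF E] by simp
    ultimately have "card (insert y ?S) \<le> card ?T"
      using independent_span_bound[OF finite_imageI[OF finite_lessThan]] by blast
    moreover have "y \<notin> ?S" using y(2) span_base[of y ?S] by argo
    ultimately show False
      using card_image[OF inj] card_image[OF local_frameD(4)[OF E]]
        card_insert_disjoint[OF finite_imageI[OF finite_lessThan], of y "\<lambda>i. e i p"] by simp
  qed
  then have "x \<in> span ?S" using assms(2) by (rule subsetD)
  from in_span_image[OF finite_lessThan inj this] obtain a where a: "x = (\<Sum>i<rk C. a i *\<^sub>R e i p)" by metis
  have "scal C p (e' i p) x = a i" if "i < rk C" for i unfolding a by (rule pair[OF that])
  then have "(\<Sum>i<rk C. scal C p (e' i p) x *\<^sub>R e i p) = (\<Sum>i<rk C. a i *\<^sub>R e i p)" by simp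
  with a show ?thesis by (rule trans[OF _ sym])
qed

lemma dual_frames_swap:
  assumes "dual_frames (sections C) (rk C) (scal C) p e e'"
  shows "dual_frames (sections C) (rk C) (scal C) p e' e"
proof -
  have e: "e i \<in> sections C" "e' i \<in> sections C" if "i < rk C" for i
    using assms that by (simp_all add: dual_frames_def)
  then have "scal C p (e i p) (e' j p) = (if i = j then 1 else 0)" if "i < rk C" "j < rk C" for i j
    using assms that by (auto simp: scal_commute[OF section_fibre section_fibre] dual_frames_def)
  with e show ?thesis by (simp add: dual_frames_def)
qed

lemma tensorial_expand:
  assumes "dual_frames (sections C) (rk C) (scal C) p e e'" "tensorial p L" "u \<in> sections C"
  shows "L u = (\<Sum>i<rk C. sprod C (e' i) u p * L (e i))"
proof -
  have e: "e i \<in> sections C" if "i < rk C" for i using assms(1) that by (simp add: dual_frames_def)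
  have "L u = L (\<Sum>i<rk C. smul (\<lambda>_. sprod C (e' i) u p) (e i))"
  proof (rule tensorial_cong[OF assms(2,3)])
    show "(\<Sum>i<rk C. smul (\<lambda>_. sprod C (e' i) u p) (e i)) \<in> sections C"
      by (intro section_sum section_smul fns_const e) simp
    show "u p = (\<Sum>i<rk C. smul (\<lambda>_. sprod C (e' i) u p) (e i)) p"
      by (subst dual_frames_expand[OF assms(1) section_fibre[OF assms(3)]])
        (simp add: sum_fun_apply smul_def sprod_def)
  qed
  also have "\<dots> = (\<Sum>i<rk C. sprod C (e' i) u p * L (e i))"
    by (rule tensorial_sum[OF assms(2) fns_const]) (simp add: e)
  finally show ?thesis .
qed

text \<open>\<open>trE\<close> sums over dual frames f, f' picked by \<open>SOME\<close>; the given
  frames e, e' guarantee that the choice really is dual. Expanding f and f' in e and e' produces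
  coefficients whose sum over the chosen frame collapses to the pairing of e' with e, by the duality
  of f and f'.\<close>

lemma trE_dual_frames:
  assumes e: "dual_frames (sections C) (rk C) (scal C) p e e'"
    and B: "\<And>v. v \<in> sections C \<Longrightarrow> tensorial p (\<lambda>u. B u v p)" "\<And>u. u \<in> sections C \<Longrightarrow> tensorial p (\<lambda>v. B u v p)"
  shows "trE C B p = (\<Sum>i<rk C. B (e i) (e' i) p)"
proof -
  let ?n = "rk C"
  obtain f f' where some: "(SOME (e, e'). dual_frames (sections C) ?n (scal C) p e e') = (f, f')"
    by (metis surj_pair)
  have f: "dual_frames (sections C) ?n (scal C) p f f'"
    using someI[of "\<lambda>(e, e'). dual_frames (sections C) ?n (scal C) p e e'" "(e, e')"] e by (simp add: some)
  have sec: "e i \<in> sections C" "e' i \<in> sections C" "f i \<in> sections C" "f' i \<in> sections C" if "i < ?n" for i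
    using e f that by (auto simp: dual_frames_def)
  have "B (f i) (f' i) p = (\<Sum>j<?n. \<Sum>k<?n. sprod C (e' j) (f i) p * (sprod C (e k) (f' i) p * B (e j) (e' k) p))"
    if i: "i < ?n" for i
  proof -
    have "B (f i) (f' i) p = (\<Sum>j<?n. sprod C (e' j) (f i) p * B (e j) (f' i) p)"
      by (rule tensorial_expand[OF e B(1)[OF sec(4)[OF i]] sec(3)[OF i]])
    also have "\<dots> = (\<Sum>j<?n. \<Sum>k<?n. sprod C (e' j) (f i) p * (sprod C (e k) (f' i) p * B (e j) (e' k) p))"
      unfolding sum_distrib_left[symmetric]
    proof (intro sum.cong refl arg_cong2[of _ _ _ _ "(*)"])
      fix j assume "j \<in> {..<?n}"
      then show "B (e j) (f' i) p = (\<Sum>k<?n. sprod C (e k) (f' i) p * B (e j) (e' k) p)"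
        by (intro tensorial_expand[OF dual_frames_swap[OF e] B(2)[OF sec(1)] sec(4)[OF i]]) simp
    qed
    finally show ?thesis .
  qed
  then have "trE C B p = (\<Sum>i<?n. \<Sum>j<?n. \<Sum>k<?n. sprod C (e' j) (f i) p * (sprod C (e k) (f' i) p * B (e j) (e' k) p))"
    by (simp add: trE_def metric_trace_def some)
  also have "\<dots> = (\<Sum>j<?n. \<Sum>k<?n. (\<Sum>i<?n. sprod C (f' i) (e k) p * sprod C (e' j) (f i) p) * B (e j) (e' k) p)"
  proof -
    have "(\<Sum>i<?n. \<Sum>j<?n. \<Sum>k<?n. t i j k) = (\<Sum>j<?n. \<Sum>k<?n. \<Sum>i<?n. t i j k)"
      for t :: "nat \<Rightarrow> nat \<Rightarrow> nat \<Rightarrow> real"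
      by (rule trans[OF sum.swap]) (intro sum.cong refl sum.swap)
    also have "(\<Sum>i<?n. sprod C (e' j) (f i) p * (sprod C (e k) (f' i) p * B (e j) (e' k) p)) =
      (\<Sum>i<?n. sprod C (f' i) (e k) p * sprod C (e' j) (f i) p) * B (e j) (e' k) p" if "k < ?n" for j k
      unfolding sum_distrib_right
      using that by (intro sum.cong refl) (simp add: sprod_commute[OF sec(1)[OF that] sec(4)])
    then have "(\<Sum>j<?n. \<Sum>k<?n. \<Sum>i<?n. sprod C (e' j) (f i) p * (sprod C (e k) (f' i) p * B (e j) (e' k) p)) =
      (\<Sum>j<?n. \<Sum>k<?n. (\<Sum>i<?n. sprod C (f' i) (e k) p * sprod C (e' j) (f i) p) * B (e j) (e' k) p)"
      by (intro sum.cong refl) simp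
    finally show ?thesis .
  qed
  also have "\<dots> = (\<Sum>j<?n. \<Sum>k<?n. sprod C (e' j) (e k) p * B (e j) (e' k) p)"
  proof -
    have "sprod C (e' j) (e k) p = (\<Sum>i<?n. sprod C (f' i) (e k) p * sprod C (e' j) (f i) p)"
      if "j < ?n" "k < ?n" for j k
      by (rule tensorial_expand[OF f tensorial_sprod(2)[OF sec(2)[OF that(1)]] sec(1)[OF that(2)]])
    then show ?thesis by (intro sum.cong refl) simp
  qed
  also have "\<dots> = (\<Sum>j<?n. B (e j) (e' j) p)"
    using e by (intro sum.cong[OF refl]) (auto simp: dual_frames_def sprod_def if_distrib[of "\<lambda>x. x * _"] cong: if_cong)
  finally show ?thesis .
qed

end

section \<open>Local isotropic frames\<close>


context
  fixes A :: "('m::{t2_space, second_countable_topology}, 'n::euclidean_space) atlas"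
  assumes mfd: "smooth_manifold A"
begin

section \<open>Tangent vectors as local derivations\<close>

lemma tangentD:
  assumes "x \<in> tangent_space A p"
  shows tangent_add: "f \<in> Cinf A \<Longrightarrow> h \<in> Cinf A \<Longrightarrow> x (f + h) = x f + x h"
    and tangent_scale: "f \<in> Cinf A \<Longrightarrow> x (\<lambda>q. c * f q) = c * x f"
    and tangent_mult: "f \<in> Cinf A \<Longrightarrow> h \<in> Cinf A \<Longrightarrow> x (f * h) = x f * h p + f p * x h"
    and tangent_outside: "f \<notin> Cinf A \<Longrightarrow> x f = 0"
  using assms unfolding tangent_space_def by auto

lemma tangent_const:
  assumes "x \<in> tangent_space A p" shows "x (\<lambda>_. c) = 0"
proof -
  have "x ((\<lambda>_. 1) * (\<lambda>_. 1)) = x (\<lambda>_. 1) * 1 + 1 * x (\<lambda>_. 1)"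
    by (rule tangent_mult[OF assms Cinf_const[OF mfd] Cinf_const[OF mfd]])
  then have "x (\<lambda>_. 1) = 0" by (simp add: times_fun_def)
  then show ?thesis using tangent_scale[OF assms Cinf_const[OF mfd], of c 1] by simp
qed

text \<open>A bump function \<theta> supported where f and h agree gives \<theta> f = \<theta> h.
  The Leibniz rule at p, with f p = h p and \<theta> p = 1, then equates the two
  derivatives.\<close>

lemma tangent_local:
  assumes x: "x \<in> tangent_space A p" and f: "f \<in> Cinf A" and h: "h \<in> Cinf A"
    and eq: "eventually (\<lambda>q. f q = h q) (nhds p)"
  shows "x f = x h"
proof -
  obtain W where W: "open W" "p \<in> W" "\<forall>q\<in>W. f q = h q"
    using eq unfolding eventually_nhds by blast
  obtain \<theta> K N where \<theta>: "\<theta> \<in> Cinf A" "K \<subseteq> W" "\<And>q. q \<notin> K \<Longrightarrow> \<theta> q = 0"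
    "p \<in> N" "\<And>q. q \<in> N \<Longrightarrow> \<theta> q = 1"
    using bump_function[OF mfd W(1,2)] by metis
  have "\<theta> * f = \<theta> * h"
  proof
    fix q show "(\<theta> * f) q = (\<theta> * h) q"
      using W(3) \<theta>(2) \<theta>(3)[of q] by (cases "q \<in> K") auto
  qed
  then have "x \<theta> * f p + \<theta> p * x f = x \<theta> * h p + \<theta> p * x h"
    using tangent_mult[OF x \<theta>(1) f] tangent_mult[OF x \<theta>(1) h] by simp
  then show ?thesis using W(2,3) \<theta>(5)[OF \<theta>(4)] by simp
qed

end

context courant_bundle
begin

lemmas fibre_intros = subspace_add[OF fibre_subspace] subspace_diff[OF fibre_subspace]
  subspace_scale[OF fibre_subspace] subspace_sum[OF fibre_subspace] subspace_0[OF fibre_subspace]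

lemma scal_sum_left:
  assumes "\<And>i. i \<in> I \<Longrightarrow> x i \<in> fibre C p" "z \<in> fibre C p"
  shows "scal C p (\<Sum>i\<in>I. c i *\<^sub>R x i) z = (\<Sum>i\<in>I. c i * scal C p (x i) z)"
proof -
  have "(\<Sum>i\<in>I. c i *\<^sub>R x i) \<in> fibre C p"
    by (intro fibre_intros assms(1))
  then have "scal C p (\<Sum>i\<in>I. c i *\<^sub>R x i) z = scal C p z (\<Sum>i\<in>I. c i *\<^sub>R x i)"
    by (rule scal_commute) (rule assms(2))
  also have "\<dots> = (\<Sum>i\<in>I. c i * scal C p z (x i))" by (rule scal_sum_right[OF assms])
  also have "\<dots> = (\<Sum>i\<in>I. c i * scal C p (x i) z)"
    by (intro sum.cong refl arg_cong2[of _ _ _ _ "(*)"] scal_commute assms)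
  finally show ?thesis .
qed

lemma
  assumes "x \<in> fibre C p" "y \<in> fibre C p" "z \<in> fibre C p"
  shows scal_diff_left: "scal C p (x - y) z = scal C p x z - scal C p y z"
    and scal_diff_right: "scal C p z (x - y) = scal C p z x - scal C p z y"
proof -
  have y: "(- 1) *\<^sub>R y \<in> fibre C p" by (intro fibre_intros assms)
  show "scal C p (x - y) z = scal C p x z - scal C p y z"
    using scal_add_left[OF assms(1,3) y] scal_scale_left[OF assms(2,3), of "- 1"] by simp
  show "scal C p z (x - y) = scal C p z x - scal C p z y"
    using scal_add_right[OF assms(1,3) y] scal_scale_right[OF assms(2,3), of "- 1"] by simp
qed

section \<open>The anchor and gradients\<close>

lemma anch_eq: "anch C u p = anchor C p (u p)"
  by (simp add: anch_def)

lemma anch_tangent: "u \<in> sections C \<Longrightarrow> anch C u p \<in> tangent_space (atlas C) p"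
  by (simp add: anch_eq anchor_tangent section_fibre)

lemma app_fns: "u \<in> sections C \<Longrightarrow> f \<in> fns C \<Longrightarrow> app (anch C u) f \<in> fns C"
  using anch_vector_field unfolding vector_fields_def by blast

lemma
  assumes "x \<in> fibre C p"
  shows anchor_add: "y \<in> fibre C p \<Longrightarrow> anchor C p (x + y) f = anchor C p x f + anchor C p y f"
    and anchor_scale: "anchor C p (c *\<^sub>R x) f = c * anchor C p x f"
  using anchor_linear[of p f] assms by (auto simp: linear_on_def)

lemma anchor_zero: "anchor C p 0 = 0"
  using anchor_scale[OF fibre_intros(5), of p 0] by (auto simp: fun_eq_iff)

text \<open>By the last axiom of a Courant algebroid, [u, v] + [v, u] pairs with w to the derivative
  of \<langle>u, v\<rangle> along the anchor of w. Up to normalisation it is the differential of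
  \<langle>u, v\<rangle>, seen in E, and it is available as a section without a dualisation of the
  anchor.\<close>

definition gradients :: "('m \<Rightarrow> 'v) set" where
  "gradients = {dorfman C u v + dorfman C v u | u v. u \<in> sections C \<and> v \<in> sections C}"

lemma gradientE:
  assumes "k \<in> gradients"
  obtains u v where "u \<in> sections C" "v \<in> sections C" "k = dorfman C u v + dorfman C v u"
  using assms unfolding gradients_def by blast

lemma gradientI: "u \<in> sections C \<Longrightarrow> v \<in> sections C \<Longrightarrow> dorfman C u v + dorfman C v u \<in> gradients"
  unfolding gradients_def by blast

lemma gradient_section: "k \<in> gradients \<Longrightarrow> k \<in> sections C"
  by (elim gradientE) (simp add: section_add dorfman_section)

text \<open>The anchor turns the bracket into the Lie bracket of vector fields, which is
  skew.\<close>

lemma gradient_anch: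
  assumes "k \<in> gradients" shows "anch C k = 0"
proof (intro ext)
  fix p f
  obtain u v where k: "u \<in> sections C" "v \<in> sections C" "k = dorfman C u v + dorfman C v u"
    using assms by (rule gradientE)
  have "anch C k p f = anch C (dorfman C u v) p f + anch C (dorfman C v u) p f"
    using k by (simp add: anch_eq anchor_add section_fibre dorfman_section)
  also have "\<dots> = 0" using k by (simp add: anch_dorfman lie_bracket_def)
  finally show "anch C k p f = 0 p f" by simp
qed

lemma gradient_sprod:
  assumes "k \<in> gradients"
  obtains h where "h \<in> fns C" "\<And>w. w \<in> sections C \<Longrightarrow> sprod C k w = app (anch C w) h"
proof -
  obtain u v where k: "u \<in> sections C" "v \<in> sections C" "k = dorfman C u v + dorfman C v u"
    using assms by (rule gradientE)
  show thesis using k by (intro that[of "sprod C u v"]) (simp_all only: sprod_fns sprod_symmetric_bracket)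
qed

lemma gradient_orthogonal:
  assumes "k \<in> gradients" "w \<in> sections C" "anch C w = 0" shows "sprod C k w = 0"
proof -
  obtain h where "\<And>w. w \<in> sections C \<Longrightarrow> sprod C k w = app (anch C w) h"
    using gradient_sprod[OF assms(1)] by metis
  then show ?thesis using assms(2,3) by (simp add: app_def zero_fun_def)
qed

text \<open>Invariance of the scalar product gives \<langle>[k, k'], w\<rangle> =
  \<pi>(k)\<langle>k', w\<rangle> - \<langle>k', [k, w]\<rangle>. The first term vanishes since
  \<pi>(k) = 0; so does the second, because [k, w] has anchor [\<pi>(k), \<pi>(w)] = 0 and k' is
  orthogonal to the kernel of the anchor.\<close>

lemma dorfman_gradients:
  assumes "k \<in> gradients" "k' \<in> gradients" "w \<in> sections C"
  shows "sprod C (dorfman C k k') w = 0"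
proof -
  note s = gradient_section[OF assms(1)] gradient_section[OF assms(2)]
  have "anch C (dorfman C k w) = 0"
  proof (intro ext)
    fix p f
    have "anch C k q h = 0" for q h using gradient_anch[OF assms(1)] by simp
    moreover have "anch C w p (\<lambda>_. 0) = 0"
      by (rule tangent_const[OF manifold anch_tangent[OF assms(3)]])
    ultimately show "anch C (dorfman C k w) p f = 0 p f"
      using s assms(3) by (simp add: anch_dorfman lie_bracket_def app_def)
  qed
  then have "sprod C k' (dorfman C k w) = 0"
    by (intro gradient_orthogonal assms dorfman_section s)
  moreover have "app (anch C k) (sprod C k' w) = 0"
    using gradient_anch[OF assms(1)] by (auto simp: app_def)
  ultimately show ?thesis using app_sprod[OF s assms(3)] by simp
qed

text \<open>Independence of r gradients at p, recorded by vectors dual to them instead of by linear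
  independence: these vectors are the raw material for the other half of the frame.\<close>

definition dual_at :: "'m \<Rightarrow> nat \<Rightarrow> (nat \<Rightarrow> 'm \<Rightarrow> 'v) \<Rightarrow> (nat \<Rightarrow> 'v) \<Rightarrow> bool" where
  "dual_at p r k x \<longleftrightarrow> (\<forall>i<r. k i \<in> gradients \<and> x i \<in> fibre C p) \<and>
     (\<forall>i<r. \<forall>j<r. scal C p (k i p) (x j) = (if i = j then 1 else 0))"

lemma dual_at_bound: "dual_at p r k x \<Longrightarrow> r \<le> rk C"
  using dual_independent(3)[of r x p "\<lambda>i. k i p"]
  by (simp add: dual_at_def section_fibre gradient_section)

text \<open>The length of such a family is bounded by the rank, so extending it has to stop.\<close>

lemma maximal_dual_at: "\<exists>r k x. dual_at p r k x \<and> (\<forall>k x. \<not> dual_at p (Suc r) k x)"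
proof (rule ccontr)
  assume *: "\<not> ?thesis"
  have "\<exists>k x. dual_at p r k x" for r
  proof (induction r)
    case 0
    then show ?case by (simp add: dual_at_def)
  next
    case (Suc r)
    then show ?case using * by blast
  qed
  then obtain k x where "dual_at p (Suc (rk C)) k x" by blast
  then show False using dual_at_bound by fastforce
qed

text \<open>Suppose the remainder g p - s is nonzero. By nondegeneracy some w detects it, and w can
  be corrected to a vector z orthogonal to all k i with \<langle>g, z\<rangle> = 1. Then g and z
  prolong the family, against maximality.\<close>

lemma gradient_in_span:
  assumes k: "dual_at p r k x" and max: "\<forall>k x. \<not> dual_at p (Suc r) k x" and g: "g \<in> gradients"
  shows "g p = (\<Sum>i<r. scal C p (g p) (x i) *\<^sub>R k i p)"
proof (rule ccontr)
  let ?b = "scal C p" and ?V = "fibre C p"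
  assume "g p \<noteq> (\<Sum>i<r. ?b (g p) (x i) *\<^sub>R k i p)"
  have grad: "k i \<in> gradients" if "i < r" for i using k that by (simp add: dual_at_def)
  have x: "x i \<in> ?V" if "i < r" for i using k that by (simp add: dual_at_def)
  have d: "?b (k i p) (x j) = (if i = j then 1 else 0)" if "i < r" "j < r" for i j
    using k that by (simp add: dual_at_def)
  have kV: "k i p \<in> ?V" if "i < r" for i by (intro section_fibre gradient_section grad that)
  have gV: "g p \<in> ?V" by (intro section_fibre gradient_section g)
  define s where "s = (\<Sum>i<r. ?b (g p) (x i) *\<^sub>R k i p)"
  have sV: "s \<in> ?V" unfolding s_def by (intro fibre_intros kV) simp
  have s: "?b s y = (\<Sum>i<r. ?b (g p) (x i) * ?b (k i p) y)" if "y \<in> ?V" for y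
    unfolding s_def by (rule scal_sum_left) (simp_all add: kV that)
  have "g p - s \<noteq> 0" using \<open>g p \<noteq> _\<close> by (simp add: s_def)
  moreover have "g p - s \<in> ?V" by (intro fibre_intros gV sV)
  ultimately obtain w where w: "w \<in> ?V" "?b (g p - s) w \<noteq> 0"
    using scal_nondegenerate[of "g p - s" p] by blast
  \<comment> \<open>The combination of the x i with the same pairings with all k j as w, so that w -
    t is orthogonal to every k j.\<close>
  define t where "t = (\<Sum>i<r. ?b (k i p) w *\<^sub>R x i)"
  have tV: "t \<in> ?V" unfolding t_def by (intro fibre_intros x) simp
  have t: "?b y t = (\<Sum>i<r. ?b (k i p) w * ?b y (x i))" if "y \<in> ?V" for y
    unfolding t_def by (rule scal_sum_right) (simp_all add: x that)
  have kt: "?b (k j p) t = ?b (k j p) w" if "j < r" for j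
  proof -
    have "?b (k j p) t = (\<Sum>i<r. if j = i then ?b (k i p) w else 0)"
      unfolding t[OF kV[OF that]] using that d by (intro sum.cong refl) simp
    then show ?thesis using that by simp
  qed
  have sx: "?b s (x j) = ?b (g p) (x j)" if "j < r" for j
  proof -
    have "?b s (x j) = (\<Sum>i<r. if j = i then ?b (g p) (x i) else 0)"
      unfolding s[OF x[OF that]] using that d by (intro sum.cong refl) simp
    then show ?thesis using that by simp
  qed
  define z where "z = (1 / ?b (g p - s) w) *\<^sub>R (w - t)"
  have zV: "z \<in> ?V" unfolding z_def by (intro fibre_intros w tV)
  have wt: "w - t \<in> ?V" by (intro fibre_intros w tV)
  have kz: "?b (k j p) z = 0" if "j < r" for j
    unfolding z_def using that kV w(1) tV wt kt by (simp add: scal_scale_right scal_diff_right)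
  have "?b s t = ?b (g p) t"
    unfolding s[OF tV] t[OF gV] by (intro sum.cong refl) (simp add: kt)
  then have "?b (g p) (w - t) = ?b (g p - s) w + ?b s w - ?b s t"
    using gV sV w(1) tV by (simp add: scal_diff_left scal_diff_right)
  also have "?b s w = ?b s t"
    unfolding s[OF tV] s[OF w(1)] by (intro sum.cong refl) (simp add: kt)
  finally have gz: "?b (g p) z = 1"
    unfolding z_def using w(2) gV wt by (simp add: scal_scale_right)
  let ?k = "\<lambda>i. if i < r then k i else g"
  \<comment> \<open>A multiple of z is subtracted from the old dual vectors to make them orthogonal
    to g; their pairings with the k j do not change because z is orthogonal to those.\<close>
  let ?x = "\<lambda>i. if i < r then x i - ?b (g p) (x i) *\<^sub>R z else z"
  have "?b (k i p) (x j - ?b (g p) (x j) *\<^sub>R z) = (if i = j then 1 else 0)" if "i < r" "j < r" for i j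
    using that d kz kV x zV fibre_intros(3)[OF zV] by (simp add: scal_diff_right scal_scale_right)
  moreover have "?b (g p) (x j - ?b (g p) (x j) *\<^sub>R z) = 0" if "j < r" for j
    using that gz gV x zV fibre_intros(3)[OF zV] by (simp add: scal_diff_right scal_scale_right)
  ultimately have "dual_at p (Suc r) ?k ?x"
    unfolding dual_at_def using grad x zV g gz kz
    by (auto simp: less_Suc_eq intro!: fibre_intros)
  then show False using max by blast
qed

text \<open>Orthogonality to the gradients means that the anchor x of y annihilates all functions
  \<langle>w, v\<rangle>. For smooth f both \<langle>u, v\<rangle> and f \<langle>u, v\<rangle> =
  \<langle>f u, v\<rangle> are of this form, so the Leibniz rule leaves x(f) \<langle>u, v\<rangle>
  = 0 at p. Taking u through y and v through a vector that does not pair to 0 with y forces x(f) =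
  0.\<close>

lemma anchor_zero_if_orthogonal:
  assumes "y \<in> fibre C p" "\<And>g. g \<in> gradients \<Longrightarrow> scal C p (g p) y = 0"
  shows "anchor C p y = 0"
proof (cases "y = 0")
  case False
  have T: "anchor C p y \<in> tangent_space (atlas C) p" by (rule anchor_tangent[OF assms(1)])
  obtain z where z: "z \<in> fibre C p" "scal C p y z \<noteq> 0"
    using False scal_nondegenerate[OF assms(1)] by blast
  obtain u where u: "u \<in> sections C" "u p = y" using section_through[OF assms(1)] by metis
  obtain v where v: "v \<in> sections C" "v p = z" using section_through[OF z(1)] by metis
  have a: "anchor C p y (sprod C w v) = 0" if w: "w \<in> sections C" for w
  proof -
    have "scal C p ((dorfman C w v + dorfman C v w) p) y = app (anch C u) (sprod C w v) p"
      using fun_cong[OF sprod_symmetric_bracket[OF w v(1) u(1)], of p] u(2) by (simp add: sprod_def)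
    then show ?thesis
      using assms(2)[OF gradientI[OF w v(1)]] u(2) by (simp add: app_def anch_eq)
  qed
  show ?thesis
  proof (rule ext)
    fix f show "anchor C p y f = 0 f"
    proof (cases "f \<in> fns C")
      case True
      have "anchor C p y (f * sprod C u v) = anchor C p y f * sprod C u v p + f p * anchor C p y (sprod C u v)"
        by (rule tangent_mult[OF manifold T True sprod_fns[OF u(1) v(1)]])
      moreover have "f * sprod C u v = sprod C (smul f u) v"
        by (rule sprod_smul_left[symmetric, OF u(1) v(1)])
      ultimately have "anchor C p y f * sprod C u v p = 0"
        using a[OF u(1)] a[OF section_smul[OF True u(1)]] by simp
      then show ?thesis using z(2) u(2) v(2) by (simp add: sprod_def)
    next
      case False
      \<comment> \<open>Tangent vectors take the value 0 on non-smooth functions by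
        convention.\<close>
      then show ?thesis using tangent_outside[OF manifold T] by simp
    qed
  qed
qed (simp add: anchor_zero)

text \<open>Gaussian elimination on the matrix \<langle>k i, X j\<rangle>, one row at a time. It is
  the identity at p and is made the identity near p; every pivot is 1 at p, so only local
  reciprocals of such functions are needed.\<close>

lemma local_dual_sections:
  fixes r :: nat
  assumes k: "\<And>i. i < r \<Longrightarrow> k i \<in> sections C" and X: "\<And>i. i < r \<Longrightarrow> X i \<in> sections C"
    and d: "\<And>i j. i < r \<Longrightarrow> j < r \<Longrightarrow> sprod C (k i) (X j) p = (if i = j then 1 else 0)"
  shows "\<exists>Y. (\<forall>i<r. Y i \<in> sections C) \<and>
    eventually (\<lambda>q. \<forall>i<r. \<forall>j<r. sprod C (k i) (Y j) q = (if i = j then 1 else 0)) (nhds p)"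
proof -
  \<comment> \<open>The induction carries duality at p for all rows, which makes the next pivot
    equal to 1 there, next to duality near p for the rows already treated.\<close>
  have "\<exists>Y. (\<forall>j<r. Y j \<in> sections C) \<and> (\<forall>i<r. \<forall>j<r. sprod C (k i) (Y j) p = (if i = j then 1 else 0)) \<and>
     eventually (\<lambda>q. \<forall>i<s. \<forall>j<r. sprod C (k i) (Y j) q = (if i = j then 1 else 0)) (nhds p)"
    if "s \<le> r" for s
    using that
  proof (induction s)
    case 0
    then show ?case using X d by (intro exI[of _ X]) simp
  next
    case (Suc s)
    then have s: "s < r" by simp
    obtain Y where Y: "\<And>j. j < r \<Longrightarrow> Y j \<in> sections C"
      "\<And>i j. i < r \<Longrightarrow> j < r \<Longrightarrow> sprod C (k i) (Y j) p = (if i = j then 1 else 0)"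
      "eventually (\<lambda>q. \<forall>i<s. \<forall>j<r. sprod C (k i) (Y j) q = (if i = j then 1 else 0)) (nhds p)"
      using Suc.IH s by auto
    have "sprod C (k s) (Y s) \<in> fns C" by (intro sprod_fns k Y s)
    then obtain g where g: "g \<in> fns C" "eventually (\<lambda>q. g q * sprod C (k s) (Y s) q = 1) (nhds p)"
      using Cinf_local_reciprocal[OF manifold, of "sprod C (k s) (Y s)" p] Y(2)[OF s s] by auto
    \<comment> \<open>The normalised pivot column, which then clears row s in all other columns. The
      treated rows survive since \<open>Y s\<close> pairs to 0 with their \<open>k i\<close> near
      p.\<close>
    define Z0 where "Z0 = smul g (Y s)"
    define Z where "Z j = (if j = s then Z0 else Y j - smul (sprod C (k s) (Y j)) Z0)" for j
    have Z0: "Z0 \<in> sections C" unfolding Z0_def by (intro section_smul g Y s)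
    have Zs: "Z j \<in> sections C" if "j < r" for j
    proof (cases "j = s")
      case False
      have "Y j - smul (sprod C (k s) (Y j)) Z0 \<in> sections C"
        by (intro Z0 section_diff section_smul sprod_fns k s Y that)
      then show ?thesis using False by (simp only: Z_def if_False)
    qed (simp add: Z_def Z0)
    have kZ0: "sprod C (k i) Z0 q = g q * sprod C (k i) (Y s) q" if "i < r" for i q
      unfolding Z0_def by (simp add: sprod_smul_right k Y that s)
    have kZ: "sprod C (k i) (Z j) q = (if j = s then g q * sprod C (k i) (Y s) q
      else sprod C (k i) (Y j) q - sprod C (k s) (Y j) q * (g q * sprod C (k i) (Y s) q))"
      if "i < r" "j < r" for i j q
    proof (cases "j = s")
      case False
      have c: "smul (sprod C (k s) (Y j)) Z0 \<in> sections C"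
        by (intro section_smul sprod_fns k s Y that Z0)
      have "sprod C (k i) (Z j) q = sprod C (Y j - smul (sprod C (k s) (Y j)) Z0) (k i) q"
        using False Zs[OF that(2)] by (simp add: Z_def sprod_commute[OF k[OF that(1)]])
      also have "\<dots> = sprod C (Y j) (k i) q - sprod C (smul (sprod C (k s) (Y j)) Z0) (k i) q"
        by (simp add: sprod_diff_left Y c k that)
      also have "sprod C (smul (sprod C (k s) (Y j)) Z0) (k i) q = sprod C (k s) (Y j) q * sprod C (k i) Z0 q"
        using sprod_commute[OF k[OF that(1)] Z0] by (simp add: sprod_smul_left Z0 k that)
      finally show ?thesis
        using False kZ0[OF that(1)] sprod_commute[OF k[OF that(1)] Y(1)[OF that(2)]] by simp
    qed (simp add: Z_def kZ0 that)
    have gp: "g p = 1" using eventually_nhds_x_imp_x[OF g(2)] Y(2)[OF s s] by simp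
    have "eventually (\<lambda>q. \<forall>i<Suc s. \<forall>j<r. sprod C (k i) (Z j) q = (if i = j then 1 else 0)) (nhds p)"
      using Y(3) g(2)
    proof eventually_elim
      case (elim q)
      show ?case
      proof (intro allI impI)
        fix i j assume ij: "i < Suc s" "j < r"
        then have "i < r" using s by simp
        show "sprod C (k i) (Z j) q = (if i = j then 1 else 0)"
          unfolding kZ[OF \<open>i < r\<close> ij(2)] using elim ij s by (cases "i = s") auto
      qed
    qed
    moreover have "\<forall>i<r. \<forall>j<r. sprod C (k i) (Z j) p = (if i = j then 1 else 0)"
      using kZ Y(2) gp s by simp
    ultimately show ?case using Zs by (intro exI[of _ Z]) simp
  qed
  from this[OF order_refl] show ?thesis by (elim exE conjE, intro exI conjI)
qed

end

text \<open>The involution of the indices below 2 r that exchanges the halves; in an isotropic frame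
  it sends an index to that of the dual vector.\<close>

definition swap_half :: "nat \<Rightarrow> nat \<Rightarrow> nat" where
  "swap_half r i = (if i < r then i + r else i - r)"

lemma swap_half:
  assumes "i < 2 * r"
  shows "swap_half r i < 2 * r" "swap_half r (swap_half r i) = i" "swap_half r i < r \<longleftrightarrow> \<not> i < r"
  using assms by (auto simp: swap_half_def)

section \<open>Isotropic frames of an exact Courant algebroid\<close>

locale exact_courant_bundle = courant_bundle C
  for C :: "('m::{t2_space, second_countable_topology}, 'n::euclidean_space, 'v::real_vector) courant" +
  assumes exact: "exact_courant_algebroid C"
begin

text \<open>By exactness y comes from a one-form \<xi>, so its pairing with z is \<xi>(\<pi>(z)) / 2
  = \<xi>(0) / 2 = 0.\<close>

lemma ker_anchor_isotropic:
  assumes "y \<in> fibre C p" "z \<in> fibre C p" "anchor C p y = 0" "anchor C p z = 0"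
  shows "scal C p y z = 0"
proof -
  have "{v \<in> fibre C p. anchor C p v = 0} = cotangent_part C p"
    using exact unfolding exact_courant_algebroid_def by simp
  then have "y \<in> cotangent_part C p" using assms(1,3) by blast
  then obtain \<xi> where \<xi>: "\<xi> \<in> cotangent_space (atlas C) p" "\<forall>w\<in>fibre C p. scal C p y w = \<xi> (anchor C p w) / 2"
    unfolding cotangent_part_def by auto
  have 0: "0 \<in> tangent_space (atlas C) p"
    using anchor_tangent[OF assms(2)] assms(4) by simp
  have "\<forall>x\<in>tangent_space (atlas C) p. \<forall>y\<in>tangent_space (atlas C) p. \<xi> (x + y) = \<xi> x + \<xi> y"
    using \<xi>(1) unfolding cotangent_space_def by simp
  from bspec[OF bspec[OF this 0] 0] have "\<xi> 0 = 0" by simp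
  then show ?thesis using bspec[OF \<xi>(2) assms(2)] assms(4) by simp
qed

definition isotropic_frame :: "'m \<Rightarrow> nat \<Rightarrow> (nat \<Rightarrow> 'm \<Rightarrow> 'v) \<Rightarrow> bool" where
  "isotropic_frame p r e \<longleftrightarrow> rk C = 2 * r \<and> (\<forall>i<2 * r. e i \<in> sections C) \<and> (\<forall>i<r. e i \<in> gradients) \<and>
    eventually (\<lambda>q. \<forall>i<2 * r. \<forall>j<2 * r. sprod C (e i) (e j) q = (if j = swap_half r i then 1 else 0)) (nhds p)"

text \<open>A maximal family of gradients k is completed by local dual sections, corrected to be
  isotropic. To see that these 2 r sections span, subtract from v its projection P v: the remainder
  is orthogonal to the k i, by maximality to all gradients, and so lies in the kernel of the anchor.
  Two remainders are orthogonal by isotropy of that kernel, and a remainder is orthogonal to the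
  frame by construction; nondegeneracy makes it 0.\<close>

lemma isotropic_frame_exists: "\<exists>r e. isotropic_frame p r e"
proof -
  obtain r k x where kx: "dual_at p r k x" and max: "\<forall>k x. \<not> dual_at p (Suc r) k x"
    using maximal_dual_at by blast
  have grad: "k i \<in> gradients" if "i < r" for i using kx that by (simp add: dual_at_def)
  have ks: "k i \<in> sections C" if "i < r" for i by (intro gradient_section grad that)
  have "\<exists>u. u \<in> sections C \<and> u p = x i" if "i < r" for i
  proof -
    have "x i \<in> fibre C p" using kx that by (simp add: dual_at_def)
    from section_through[OF this] show ?thesis by metis
  qed
  then obtain X0 where X0: "\<And>i. i < r \<Longrightarrow> X0 i \<in> sections C" "\<And>i. i < r \<Longrightarrow> X0 i p = x i" by metis
  have d0: "sprod C (k i) (X0 j) p = (if i = j then 1 else 0)" if "i < r" "j < r" for i j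
    using kx that X0(2) by (simp add: dual_at_def sprod_def)
  obtain Y where Y: "\<And>i. i < r \<Longrightarrow> Y i \<in> sections C"
    and kY: "eventually (\<lambda>q. \<forall>i<r. \<forall>j<r. sprod C (k i) (Y j) q = (if i = j then 1 else 0)) (nhds p)"
  proof -
    have "\<exists>Y. (\<forall>i<r. Y i \<in> sections C) \<and>
      eventually (\<lambda>q. \<forall>i<r. \<forall>j<r. sprod C (k i) (Y j) q = (if i = j then 1 else 0)) (nhds p)"
      by (rule local_dual_sections[OF ks X0(1) d0])
    then show thesis using that by auto
  qed
  \<comment> \<open>The factor 1/2 makes each of the two cross terms in \<langle>Y i - S i, Y j - S
    j\<rangle> contribute half of \<langle>Y i, Y j\<rangle>, while \<langle>S i, S j\<rangle> = 0.
    Adding combinations of the k l does not disturb duality, as gradients are mutually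
    orthogonal.\<close>
  define S where "S i = (\<Sum>l<r. smul ((\<lambda>_. 1 / 2) * sprod C (Y i) (Y l)) (k l))" for i
  have Ss: "S i \<in> sections C" if "i < r" for i
    unfolding S_def by (intro section_sum section_smul fns_mult fns_const sprod_fns Y ks that) simp_all
  have S: "sprod C w (S i) q = (\<Sum>l<r. 1 / 2 * sprod C (Y i) (Y l) q * sprod C w (k l) q)"
    if "i < r" "w \<in> sections C" for i w q
  proof -
    have "sprod C w (S i) q = (\<Sum>l<r. ((\<lambda>_. 1 / 2) * sprod C (Y i) (Y l)) q * sprod C w (k l) q)"
      unfolding S_def
      by (rule tensorial_sum[OF tensorial_sprod(2)[OF that(2)]])
        (intro fns_mult fns_const sprod_fns Y ks that, simp, simp add: ks)
    then show ?thesis by simp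
  qed
  define e where "e i = (if i < r then k i else Y (i - r) - S (i - r))" for i
  have es: "e i \<in> sections C" if "i < 2 * r" for i
    unfolding e_def using that by (auto intro!: ks section_diff Y Ss)
  have eg: "e i \<in> gradients" if "i < r" for i using grad that by (simp add: e_def)
  have kk: "sprod C (k i) (k j) q = 0" if "i < r" "j < r" for i j q
    using gradient_orthogonal[OF grad ks gradient_anch[OF grad]] that by simp
  have "eventually (\<lambda>q. \<forall>i<2 * r. \<forall>j<2 * r. sprod C (e i) (e j) q = (if j = swap_half r i then 1 else 0)) (nhds p)"
    using kY
  proof eventually_elim
    case (elim q)
    have diff: "sprod C w (Y i - S i) q = sprod C w (Y i) q - sprod C w (S i) q" if "w \<in> sections C" "i < r" for w i
      using scal_diff_right[OF section_fibre section_fibre section_fibre, OF Y Ss, of i i w q] that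
      by (simp add: sprod_def)
    have kX: "sprod C (k i) (Y j - S j) q = (if i = j then 1 else 0)" if "i < r" "j < r" for i j
      using elim that by (simp add: diff ks S kk)
    have YS: "sprod C (Y j) (S i) q = 1 / 2 * sprod C (Y i) (Y j) q" if "i < r" "j < r" for i j
    proof -
      have "sprod C (Y j) (S i) q = (\<Sum>l<r. if l = j then 1 / 2 * sprod C (Y i) (Y l) q else 0)"
        unfolding S[OF that(1) Y[OF that(2)]]
        using elim that by (intro sum.cong refl) (simp add: sprod_commute[OF Y ks])
      then show ?thesis using that by simp
    qed
    have SS: "sprod C (S j) (S i) q = 0" if "i < r" "j < r" for i j
    proof -
      have "sprod C (S j) (k l) q = 0" if "l < r" for l
        using S[OF \<open>j < r\<close> ks[OF that], of q] kk that by (simp add: sprod_commute[OF ks Ss] \<open>j < r\<close>)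
      then show ?thesis unfolding S[OF that(1) Ss[OF that(2)]] by (intro sum.neutral) simp
    qed
    have XX: "sprod C (Y i - S i) (Y j - S j) q = 0" if "i < r" "j < r" for i j
    proof -
      have "sprod C (Y i - S i) (Y j - S j) q =
          sprod C (Y i - S i) (Y j) q - sprod C (Y i - S i) (S j) q"
        using that by (intro diff section_diff Y Ss)
      moreover have "sprod C (Y i - S i) w q = sprod C (Y i) w q - sprod C (S i) w q" if "w \<in> sections C" for w
        using sprod_diff_left[OF Y Ss that] \<open>i < r\<close> by simp
      ultimately show ?thesis
        using that YS SS by (simp add: Y Ss sprod_commute[OF Ss Y] sprod_commute[of "Y j" "Y i"])
    qed
    show ?case
    proof (intro allI impI)
      fix i j assume ij: "i < 2 * r" "j < 2 * r"
      consider "i < r" "j < r" | "i < r" "\<not> j < r" | "\<not> i < r" "j < r" | "\<not> i < r" "\<not> j < r" by blast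
      then show "sprod C (e i) (e j) q = (if j = swap_half r i then 1 else 0)"
      proof cases
        case 1
        then show ?thesis by (simp add: e_def kk swap_half_def)
      next
        case 2
        then show ?thesis using ij kX[of i "j - r"] by (auto simp: e_def swap_half_def)
      next
        case 3
        then have "sprod C (e i) (e j) = sprod C (e j) (e i)"
          using ij by (intro sprod_commute es)
        then show ?thesis using 3 ij kX[of j "i - r"] by (auto simp: e_def swap_half_def)
      next
        case 4
        then show ?thesis using ij XX[of "i - r" "j - r"] by (auto simp: e_def swap_half_def)
      qed
    qed
  qed
  note near = this
  let ?b = "scal C p" and ?V = "fibre C p"
  have b: "?b (e i p) (e j p) = (if j = swap_half r i then 1 else 0)" if "i < 2 * r" "j < 2 * r" for i j
    using eventually_nhds_x_imp_x[OF near] that by (simp add: sprod_def)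
  have eV: "e i p \<in> ?V" if "i < 2 * r" for i by (intro section_fibre es that)
  have b': "?b (e (swap_half r i) p) (e j p) = (if i = j then 1 else 0)" if "i < 2 * r" "j < 2 * r" for i j
    using b[OF swap_half(1)[OF that(1)] that(2)] swap_half(2)[OF that(1)] by auto
  note dual = dual_independent[of "2 * r" "\<lambda>i. e i p" p "\<lambda>i. e (swap_half r i) p", OF eV eV[OF swap_half(1)] b']
  \<comment> \<open>The orthogonal projection onto the span of the frame at p, where the coefficient
    of a vector is the pairing with its dual.\<close>
  define P where "P v = (\<Sum>i<2 * r. ?b (e (swap_half r i) p) v *\<^sub>R e i p)" for v
  have PV: "P v \<in> ?V" for v unfolding P_def by (intro fibre_intros eV) simp
  have Pd: "?b (e j p) (v - P v) = 0" if "v \<in> ?V" "j < 2 * r" for v j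
  proof -
    have "?b (e (swap_half r (swap_half r j)) p) (P v) = ?b (e (swap_half r (swap_half r j)) p) v"
      unfolding P_def by (rule dual(4)) (use that swap_half in simp_all)
    then show ?thesis using that swap_half(2)[OF that(2)] PV by (simp add: scal_diff_right eV)
  qed
  have P0: "anchor C p (v - P v) = 0" if v: "v \<in> ?V" for v
  proof (rule anchor_zero_if_orthogonal)
    show vP: "v - P v \<in> ?V" by (intro fibre_intros v PV)
    fix g assume g: "g \<in> gradients"
    have "?b (g p) (v - P v) = (\<Sum>i<r. ?b (g p) (x i) * ?b (k i p) (v - P v))"
      by (subst gradient_in_span[OF kx max g], rule scal_sum_left)
        (simp_all add: section_fibre ks vP)
    also have "\<dots> = 0"
    proof (intro sum.neutral ballI)
      fix i assume "i \<in> {..<r}"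
      then have "?b (k i p) (v - P v) = 0" using Pd[OF v, of i] by (simp add: e_def)
      then show "?b (g p) (x i) * ?b (k i p) (v - P v) = 0" by simp
    qed
    finally show "?b (g p) (v - P v) = 0" .
  qed
  have span: "v = P v" if v: "v \<in> ?V" for v
  proof -
    have vP: "v - P v \<in> ?V" by (intro fibre_intros v PV)
    have "?b (v - P v) w = 0" if w: "w \<in> ?V" for w
    proof -
      have wP: "w - P w \<in> ?V" by (intro fibre_intros w PV)
      have "?b (v - P v) (P w) = (\<Sum>i<2 * r. ?b (e (swap_half r i) p) w * ?b (v - P v) (e i p))"
        unfolding P_def[of w] by (rule scal_sum_right) (simp_all add: eV vP)
      also have "\<dots> = 0"
      proof (intro sum.neutral ballI)
        fix i assume "i \<in> {..<2 * r}"
        then have "?b (v - P v) (e i p) = 0"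
          using Pd[OF v, of i] scal_commute[OF vP eV, of i] by simp
        then show "?b (e (swap_half r i) p) w * ?b (v - P v) (e i p) = 0" by simp
      qed
      finally have "?b (v - P v) (P w) = 0" .
      moreover have "?b (v - P v) (w - P w) = 0"
        by (rule ker_anchor_isotropic[OF vP wP P0[OF v] P0[OF w]])
      ultimately show ?thesis using scal_diff_right[OF w PV vP, of w] by simp
    qed
    then have "v - P v = 0" by (rule scal_nondegenerate[OF vP])
    then show ?thesis by simp
  qed
  have "rk C \<le> 2 * r"
  proof -
    obtain \<theta> E where E: "local_frame p \<theta> E" using local_frame_exists by blast
    have "(\<lambda>i. E i p) ` {..<rk C} \<subseteq> span ((\<lambda>i. e i p) ` {..<2 * r})"
    proof
      fix v assume "v \<in> (\<lambda>i. E i p) ` {..<rk C}"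
      then have "v \<in> ?V" using local_frameD(3)[OF E] section_fibre by auto
      then have "v = P v" by (rule span)
      also have "P v \<in> span ((\<lambda>i. e i p) ` {..<2 * r})"
        unfolding P_def by (intro span_sum span_scale span_base) simp
      finally show "v \<in> span ((\<lambda>i. e i p) ` {..<2 * r})" .
    qed
    then have "card ((\<lambda>i. E i p) ` {..<rk C}) \<le> card ((\<lambda>i. e i p) ` {..<2 * r})"
      using independent_span_bound[OF finite_imageI[OF finite_lessThan] local_frameD(5)[OF E]] by blast
    also have "\<dots> \<le> 2 * r" using card_image_le[of "{..<2 * r}" "\<lambda>i. e i p"] by simp
    finally show ?thesis using card_image[OF local_frameD(4)[OF E]] by simp
  qed
  moreover have "2 * r \<le> rk C" by (rule dual(3))
  ultimately have "rk C = 2 * r" by simp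
  then show ?thesis
    unfolding isotropic_frame_def using es eg near by (intro exI[of _ r] exI[of _ e] conjI allI impI)
qed

lemma isotropic_frame_dual:
  assumes "isotropic_frame p r e"
  shows "eventually (\<lambda>q. dual_frames (sections C) (rk C) (scal C) q e (\<lambda>i. e (swap_half r i))) (nhds p)"
proof -
  have I: "rk C = 2 * r" "\<forall>i<2 * r. e i \<in> sections C"
    "eventually (\<lambda>q. \<forall>i<2 * r. \<forall>j<2 * r. sprod C (e i) (e j) q = (if j = swap_half r i then 1 else 0)) (nhds p)"
    using assms unfolding isotropic_frame_def by blast+
  show ?thesis using I(3)
  proof eventually_elim
    case (elim q)
    have "scal C q (e (swap_half r i) q) (e j q) = (if i = j then 1 else 0)" if "i < 2 * r" "j < 2 * r" for i j
      using elim swap_half[OF that(1)] that by (auto simp: sprod_def)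
    then show ?case using I(1,2) swap_half(1) by (simp add: dual_frames_def)
  qed
qed

end

section \<open>Generalised curvature\<close>


lemma sum_swap_half: "(\<Sum>i<2 * r. f (swap_half r i)) = (\<Sum>i<2 * r. f i)"
  by (rule sum.reindex_bij_witness[of _ "swap_half r" "swap_half r"]) (simp_all add: swap_half)

definition triple_sum :: "nat \<Rightarrow> (nat \<Rightarrow> nat \<Rightarrow> nat \<Rightarrow> real) \<Rightarrow> real" where
  "triple_sum n f = (\<Sum>a<n. \<Sum>b<n. \<Sum>c<n. f a b c)"

lemma triple_sum_rotate: "triple_sum n (\<lambda>a b c. f b c a) = triple_sum n f"
  unfolding triple_sum_def by (rule trans[OF sum.swap]) (intro sum.cong refl sum.swap)

lemma triple_sum_transpose: "triple_sum n (\<lambda>a b c. f b a c) = triple_sum n f"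
  unfolding triple_sum_def by (rule sum.swap)

lemma triple_sum_swap_half:
  "triple_sum (2 * r) (\<lambda>a b c. f (swap_half r a) b c) = triple_sum (2 * r) f"
  "triple_sum (2 * r) (\<lambda>a b c. f a (swap_half r b) c) = triple_sum (2 * r) f"
  "triple_sum (2 * r) (\<lambda>a b c. f a b (swap_half r c)) = triple_sum (2 * r) f"
  unfolding triple_sum_def
  by (rule sum_swap_half, intro sum.cong refl sum_swap_half, intro sum.cong refl sum_swap_half)

lemma triple_sum_cong:
  "(\<And>a b c. a < n \<Longrightarrow> b < n \<Longrightarrow> c < n \<Longrightarrow> f a b c = g a b c) \<Longrightarrow> triple_sum n f = triple_sum n g"
  unfolding triple_sum_def by (intro sum.cong refl) simp

lemma triple_sum_add: "triple_sum n (\<lambda>a b c. f a b c + g a b c) = triple_sum n f + triple_sum n g"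
  by (simp add: triple_sum_def sum.distrib)

lemma triple_sum_minus: "triple_sum n (\<lambda>a b c. - f a b c) = - triple_sum n f"
  by (simp add: triple_sum_def sum_negf)

text \<open>Here T a b c stands for \<langle>D (e a) (e b), e c\<rangle>. Relabelling and skewness
  reduce each contraction to P or N: the left side equals 2 P, the right side -N. The cyclic sum of
  T contracted with its dual is 3 N + 6 P, so its vanishing gives the claim. The hypothesis is a
  product because for each triple of indices at least one of the two cyclic sums is 0.\<close>

lemma connection_coefficient_contractions:
  fixes r :: nat and T :: "nat \<Rightarrow> nat \<Rightarrow> nat \<Rightarrow> real"
  defines "s \<equiv> swap_half r"
  assumes anti: "\<And>a b c. a < 2 * r \<Longrightarrow> b < 2 * r \<Longrightarrow> c < 2 * r \<Longrightarrow> T a b c = - T a c b"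
  assumes cyc: "\<And>a b c. a < 2 * r \<Longrightarrow> b < 2 * r \<Longrightarrow> c < 2 * r \<Longrightarrow>
    (T a b c + T b c a + T c a b) * (T (s a) (s b) (s c) + T (s b) (s c) (s a) + T (s c) (s a) (s b)) = 0"
  shows "2 * (- triple_sum (2 * r) (\<lambda>i j k. T (s i) (s j) k * T (s k) j i)
      + triple_sum (2 * r) (\<lambda>i j k. T (s i) j k * T (s j) i (s k))
      + triple_sum (2 * r) (\<lambda>i j k. T (s j) (s i) k * T (s k) j i))
    = triple_sum (2 * r) (\<lambda>i j k. T k (s i) (s j) * T (s k) j i)"
proof -
  let ?S = "triple_sum (2 * r)"
  have ss: "s a < 2 * r" "s (s a) = a" if "a < 2 * r" for a using that by (simp_all add: s_def swap_half)
  note re = triple_sum_swap_half[of r, folded s_def]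
  define P where "P = ?S (\<lambda>a b c. T a b c * T (s c) (s a) (s b))"
  define N where "N = ?S (\<lambda>a b c. T a b c * T (s a) (s b) (s c))"
  \<comment> \<open>Replacing all indices by their duals exchanges the two factors, so both
    nontrivial rotations give the same contraction.\<close>
  have P': "?S (\<lambda>a b c. T a b c * T (s b) (s c) (s a)) = P"
  proof -
    have "?S (\<lambda>a b c. T a b c * T (s b) (s c) (s a)) =
        ?S (\<lambda>a b c. T (s a) (s b) (s c) * T (s (s b)) (s (s c)) (s (s a)))"
      by (subst re(1)[of "\<lambda>a b c. T a (s b) (s c) * T (s (s b)) (s (s c)) (s a)"],
          subst re(2)[of "\<lambda>a b c. T a b (s c) * T (s b) (s (s c)) (s a)"],
          subst re(3)[of "\<lambda>a b c. T a b c * T (s b) (s c) (s a)"]) (rule refl)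
    also have "\<dots> = ?S (\<lambda>a b c. T b c a * T (s a) (s b) (s c))"
      by (rule triple_sum_cong) (simp add: ss)
    also have "\<dots> = P" unfolding P_def
      by (rule triple_sum_rotate[of _ "\<lambda>a b c. T a b c * T (s c) (s a) (s b)"])
    finally show ?thesis .
  qed
  have 1: "?S (\<lambda>i j k. T (s i) (s j) k * T (s k) j i) = - P"
  proof -
    have "?S (\<lambda>i j k. T (s i) (s j) k * T (s k) j i) =
        ?S (\<lambda>i j k. T (s (s i)) (s (s j)) k * T (s k) (s j) (s i))"
      by (subst re(1)[of "\<lambda>i j k. T (s i) (s (s j)) k * T (s k) (s j) i"],
          subst re(2)[of "\<lambda>i j k. T (s i) (s j) k * T (s k) j i"]) (rule refl)
    also have "\<dots> = ?S (\<lambda>a b c. - (T a b c * T (s c) (s a) (s b)))"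
    proof (rule triple_sum_cong)
      fix a b c assume "a < 2 * r" "b < 2 * r" "c < 2 * r"
      then show "T (s (s a)) (s (s b)) c * T (s c) (s b) (s a) = - (T a b c * T (s c) (s a) (s b))"
        using anti[of "s c" "s b" "s a"] by (simp add: ss)
    qed
    finally show ?thesis by (simp add: triple_sum_minus P_def)
  qed
  have 2: "?S (\<lambda>i j k. T (s i) j k * T (s j) i (s k)) = - P"
  proof -
    have "?S (\<lambda>i j k. T (s i) j k * T (s j) i (s k)) = ?S (\<lambda>i j k. T (s (s i)) j k * T (s j) (s i) (s k))"
      by (rule re(1)[symmetric])
    also have "\<dots> = ?S (\<lambda>a b c. - (T a b c * T (s b) (s c) (s a)))"
    proof (rule triple_sum_cong)
      fix a b c assume "a < 2 * r" "b < 2 * r" "c < 2 * r"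
      then show "T (s (s a)) b c * T (s b) (s a) (s c) = - (T a b c * T (s b) (s c) (s a))"
        using anti[of "s b" "s a" "s c"] by (simp add: ss)
    qed
    finally show ?thesis by (simp add: triple_sum_minus P')
  qed
  have 3: "?S (\<lambda>i j k. T (s j) (s i) k * T (s k) j i) = P"
  proof -
    have "?S (\<lambda>i j k. T (s j) (s i) k * T (s k) j i) =
        ?S (\<lambda>i j k. T (s (s j)) (s (s i)) k * T (s k) (s j) (s i))"
      by (subst re(1)[of "\<lambda>i j k. T (s (s j)) (s i) k * T (s k) (s j) i"],
          subst re(2)[of "\<lambda>i j k. T (s j) (s i) k * T (s k) j i"]) (rule refl)
    also have "\<dots> = ?S (\<lambda>i j k. T j i k * T (s k) (s j) (s i))"
      by (rule triple_sum_cong) (simp add: ss)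
    also have "\<dots> = P" unfolding P_def
      by (rule triple_sum_transpose[of _ "\<lambda>a b c. T a b c * T (s c) (s a) (s b)"])
    finally show ?thesis .
  qed
  have 4: "?S (\<lambda>i j k. T k (s i) (s j) * T (s k) j i) = - N"
  proof -
    have "?S (\<lambda>j i k. T k (s i) (s j) * T (s k) j i) =
        ?S (\<lambda>j i k. T k (s (s i)) (s (s j)) * T (s k) (s j) (s i))"
      by (subst re(1)[of "\<lambda>j i k. T k (s (s i)) (s j) * T (s k) j (s i)"],
          subst re(2)[of "\<lambda>j i k. T k (s i) (s j) * T (s k) j i"]) (rule refl)
    also have "\<dots> = ?S (\<lambda>j i k. - (T k i j * T (s k) (s i) (s j)))"
    proof (rule triple_sum_cong)
      fix j i k assume "j < 2 * r" "i < 2 * r" "k < 2 * r"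
      then show "T k (s (s i)) (s (s j)) * T (s k) (s j) (s i) = - (T k i j * T (s k) (s i) (s j))"
        using anti[of "s k" "s j" "s i"] by (simp add: ss)
    qed
    also have "\<dots> = - ?S (\<lambda>j i k. T k i j * T (s k) (s i) (s j))" by (rule triple_sum_minus)
    also have "?S (\<lambda>j i k. T k i j * T (s k) (s i) (s j)) = ?S (\<lambda>i j k. T k i j * T (s k) (s i) (s j))"
      by (rule triple_sum_transpose[of _ "\<lambda>i j k. T k i j * T (s k) (s i) (s j)"])
    also have "\<dots> = N" unfolding N_def
      by (rule triple_sum_rotate[of _ "\<lambda>i j k. T k i j * T (s k) (s i) (s j)", symmetric])
    finally show ?thesis
      using triple_sum_transpose[of "2 * r" "\<lambda>i j k. T k (s i) (s j) * T (s k) j i"] by simp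
  qed
  have rot: "?S (\<lambda>a b c. f b c a) = ?S f" "?S (\<lambda>a b c. f c a b) = ?S f" for f
    using triple_sum_rotate[of "2 * r" f] triple_sum_rotate[of "2 * r" "\<lambda>a b c. f c a b"] by simp_all
  have "0 = ?S (\<lambda>a b c. (T a b c + T b c a + T c a b) *
      (T (s a) (s b) (s c) + T (s b) (s c) (s a) + T (s c) (s a) (s b)))"
  proof -
    have "?S (\<lambda>a b c. (T a b c + T b c a + T c a b) *
      (T (s a) (s b) (s c) + T (s b) (s c) (s a) + T (s c) (s a) (s b))) = ?S (\<lambda>a b c. 0)"
      by (rule triple_sum_cong) (rule cyc)
    then show ?thesis by (simp add: triple_sum_def)
  qed
  \<comment> \<open>The nine products are grouped by the relative rotation of their factors: none
    gives N three times, the two others give P three times each.\<close>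
  also have "\<dots> = ?S (\<lambda>a b c. T a b c * T (s a) (s b) (s c) + T b c a * T (s b) (s c) (s a) + T c a b * T (s c) (s a) (s b)
      + (T a b c * T (s c) (s a) (s b) + T b c a * T (s a) (s b) (s c) + T c a b * T (s b) (s c) (s a))
      + (T a b c * T (s b) (s c) (s a) + T b c a * T (s c) (s a) (s b) + T c a b * T (s a) (s b) (s c)))"
    by (rule triple_sum_cong) (simp add: algebra_simps)
  also have "\<dots> = 3 * N + 6 * P"
    using rot[of "\<lambda>a b c. T a b c * T (s a) (s b) (s c)"] rot[of "\<lambda>a b c. T a b c * T (s c) (s a) (s b)"]
      rot[of "\<lambda>a b c. T a b c * T (s b) (s c) (s a)"]
    by (simp add: triple_sum_add P' flip: N_def P_def)
  finally show ?thesis unfolding 1 2 3 4 by simp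
qed

section \<open>Torsion-free generalised connections and their curvature operator\<close>

lemma smul_diff_right: "smul f (u - v) = smul f u - smul f v"
  by (auto simp: smul_def scaleR_diff_right)

locale torsion_free_connection = exact_courant_bundle C
  for C :: "('m::{t2_space, second_countable_topology}, 'n::euclidean_space, 'v::real_vector) courant" +
  fixes D :: "('m, 'v) gconn"
  assumes connection: "generalised_connection C D"
    and torsion_free: "\<And>u v w. u \<in> sections C \<Longrightarrow> v \<in> sections C \<Longrightarrow> w \<in> sections C \<Longrightarrow> torsion C D u v w = 0"
begin

lemma D_section: "u \<in> sections C \<Longrightarrow> v \<in> sections C \<Longrightarrow> D u v \<in> sections C"
  using connection[unfolded generalised_connection_def, THEN conjunct1] by blast

lemma
  assumes "u \<in> sections C" "v \<in> sections C" "w \<in> sections C"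
  shows D_add_left: "D (u + v) w = D u w + D v w"
    and D_add_right: "D u (v + w) = D u v + D u w"
  using bspec[OF bspec[OF bspec[OF connection[unfolded generalised_connection_def, THEN conjunct2, THEN conjunct1]
      assms(1)] assms(2)] assms(3)] by simp_all

lemma
  assumes "u \<in> sections C" "v \<in> sections C" "f \<in> fns C"
  shows D_smul_left: "D (smul f u) v = smul f (D u v)"
    and D_smul_right: "D u (smul f v) = smul (app (anch C u) f) v + smul f (D u v)"
  using bspec[OF bspec[OF bspec[OF connection[unfolded generalised_connection_def, THEN conjunct2,
      THEN conjunct2, THEN conjunct1] assms(1)] assms(2)] assms(3)] by simp_all

lemma D_metric:
  assumes "u \<in> sections C" "v \<in> sections C" "w \<in> sections C"
  shows "app (anch C u) (sprod C v w) = sprod C (D u v) w + sprod C v (D u w)"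
  using bspec[OF bspec[OF bspec[OF connection[unfolded generalised_connection_def, THEN conjunct2,
      THEN conjunct2, THEN conjunct2] assms(1)] assms(2)] assms(3)] .

lemma tensorial_compose:
  assumes "tensorial p L" "\<And>u. u \<in> sections C \<Longrightarrow> F u \<in> sections C"
    "\<And>u v. u \<in> sections C \<Longrightarrow> v \<in> sections C \<Longrightarrow> F (u + v) = F u + F v"
    "\<And>f u. f \<in> fns C \<Longrightarrow> u \<in> sections C \<Longrightarrow> F (smul f u) = smul f (F u)"
  shows "tensorial p (\<lambda>u. L (F u))"
  unfolding tensorial_def using assms(2-4) tensorialD[OF assms(1)] by simp

lemma tensorial_D:
  assumes "tensorial p L" "v \<in> sections C"
  shows "tensorial p (\<lambda>u. L (D u v))"
  by (rule tensorial_compose[OF assms(1)]) (simp_all add: D_section D_add_left D_smul_left assms(2) del: mem_Collect_eq)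

lemma tensorial_anch:
  "tensorial p (\<lambda>u. app (anch C u) f p)"
  by (simp add: tensorial_def app_def anch_eq smul_def anchor_add anchor_scale section_fibre)

lemma tensorial_scale: "tensorial p L \<Longrightarrow> tensorial p (\<lambda>u. c * L u)"
  by (simp add: tensorial_def algebra_simps)

lemma tensorial_scale': "tensorial p L \<Longrightarrow> tensorial p (\<lambda>u. L u * c)"
  by (simp add: tensorial_def algebra_simps)

lemma tensorial_add: "tensorial p L \<Longrightarrow> tensorial p M \<Longrightarrow> tensorial p (\<lambda>u. L u + M u)"
  by (simp add: tensorial_def algebra_simps)

lemma tensorial_diff: "tensorial p L \<Longrightarrow> tensorial p M \<Longrightarrow> tensorial p (\<lambda>u. L u - M u)"
  by (simp add: tensorial_def algebra_simps)

lemma tensorial_setsum: "(\<And>i. i \<in> I \<Longrightarrow> tensorial p (L i)) \<Longrightarrow> tensorial p (\<lambda>u. \<Sum>i\<in>I. L i u)"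
  by (induction I rule: infinite_finite_induct) (simp_all add: tensorial_add, simp_all add: tensorial_def)

definition curv :: "('m \<Rightarrow> 'v) \<Rightarrow> ('m \<Rightarrow> 'v) \<Rightarrow> ('m \<Rightarrow> 'v) \<Rightarrow> 'm \<Rightarrow> 'v" where
  "curv v w u = second_deriv D v w u - second_deriv D w v u"

lemmas connection_closed = section_add section_diff section_smul D_section

lemma second_deriv_section:
  "v \<in> sections C \<Longrightarrow> w \<in> sections C \<Longrightarrow> u \<in> sections C \<Longrightarrow> second_deriv D v w u \<in> sections C"
  unfolding second_deriv_def by (intro connection_closed)

lemma curv_section:
  "v \<in> sections C \<Longrightarrow> w \<in> sections C \<Longrightarrow> u \<in> sections C \<Longrightarrow> curv v w u \<in> sections C"
  unfolding curv_def by (intro connection_closed second_deriv_section)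

context
  fixes u v w assumes u: "u \<in> sections C" and v: "v \<in> sections C" and w: "w \<in> sections C"
begin

lemma second_deriv_add:
  assumes x: "x \<in> sections C"
  shows "second_deriv D (v + x) w u = second_deriv D v w u + second_deriv D x w u"
    and "second_deriv D w (v + x) u = second_deriv D w v u + second_deriv D w x u"
    and "second_deriv D v w (u + x) = second_deriv D v w u + second_deriv D v w x"
  unfolding second_deriv_def using u v w x
  by (simp_all add: D_add_left D_add_right D_section)

lemma second_deriv_smul:
  assumes f: "f \<in> fns C"
  shows "second_deriv D (smul f v) w u = smul f (second_deriv D v w u)"
    and "second_deriv D v (smul f w) u = smul f (second_deriv D v w u)"
    and "second_deriv D v w (smul f u) = smul (app (anch C v) (app (anch C w) f)) u + smul (app (anch C w) f) (D v u)
      + (smul (app (anch C v) f) (D w u) + smul f (D v (D w u)))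
      - (smul (app (anch C (D v w)) f) u + smul f (D (D v w) u))"
proof -
  show "second_deriv D (smul f v) w u = smul f (second_deriv D v w u)"
    unfolding second_deriv_def D_smul_left[OF v D_section[OF w u] f] D_smul_left[OF v w f]
      D_smul_left[OF D_section[OF v w] u f] smul_diff_right ..
  show "second_deriv D v (smul f w) u = smul f (second_deriv D v w u)"
    unfolding second_deriv_def D_smul_left[OF w u f] D_smul_right[OF v D_section[OF w u] f] D_smul_right[OF v w f]
      D_add_left[OF section_smul[OF app_fns[OF v f] w] section_smul[OF f D_section[OF v w]] u]
      D_smul_left[OF w u app_fns[OF v f]] D_smul_left[OF D_section[OF v w] u f] smul_diff_right by simp
  show "second_deriv D v w (smul f u) = smul (app (anch C v) (app (anch C w) f)) u + smul (app (anch C w) f) (D v u)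
      + (smul (app (anch C v) f) (D w u) + smul f (D v (D w u)))
      - (smul (app (anch C (D v w)) f) u + smul f (D (D v w) u))"
    unfolding second_deriv_def D_smul_right[OF w u f]
      D_add_right[OF v section_smul[OF app_fns[OF w f] u] section_smul[OF f D_section[OF w u]]]
      D_smul_right[OF v u app_fns[OF w f]] D_smul_right[OF v D_section[OF w u] f]
      D_smul_right[OF D_section[OF v w] u f] ..
qed

end

text \<open>Each second derivative is already tensorial in both directions of differentiation: the
  term with the derivative of f from \<open>D v (D (smul f w) u)\<close> is cancelled by the one
  from \<open>D (D v (smul f w)) u\<close>.\<close>

lemma tensorial_curv:
  assumes L: "tensorial p L" and u: "u \<in> sections C" and v: "v \<in> sections C"
  shows "tensorial p (\<lambda>w. L (curv w v u))" "tensorial p (\<lambda>w. L (curv v w u))"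
proof -
  show "tensorial p (\<lambda>w. L (curv w v u))"
  proof (rule tensorial_compose[OF L])
    fix f w assume f: "f \<in> fns C" and w: "w \<in> sections C"
    show "curv (smul f w) v u = smul f (curv w v u)"
      unfolding curv_def second_deriv_smul(1)[OF u w v f] second_deriv_smul(2)[OF u v w f] smul_diff_right ..
  next
    fix w x assume w: "w \<in> sections C" and x: "x \<in> sections C"
    show "curv (w + x) v u = curv w v u + curv x v u"
      unfolding curv_def second_deriv_add(1)[OF u w v x] second_deriv_add(2)[OF u w v x] by simp
  qed (simp add: curv_section u v)
  show "tensorial p (\<lambda>w. L (curv v w u))"
  proof (rule tensorial_compose[OF L])
    fix f w assume f: "f \<in> fns C" and w: "w \<in> sections C"
    show "curv v (smul f w) u = smul f (curv v w u)"
      unfolding curv_def second_deriv_smul(1)[OF u w v f] second_deriv_smul(2)[OF u v w f] smul_diff_right ..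
  next
    fix w x assume w: "w \<in> sections C" and x: "x \<in> sections C"
    show "curv v (w + x) u = curv v w u + curv v x u"
      unfolding curv_def second_deriv_add(1)[OF u w v x] second_deriv_add(2)[OF u w v x] by simp
  qed (simp add: curv_section u v)
qed

lemma tensorial_diffD:
  assumes L: "tensorial p L" and "u \<in> sections C" "v \<in> sections C"
  shows "L (u - v) = L u - L v"
  using tensorialD(1)[OF L section_diff[OF assms(2,3)] assms(3)] by simp

text \<open>Lets formulas that hold on sections only, such as expansions in a frame, be used to
  verify tensoriality.\<close>

lemma tensorial_transfer:
  assumes "tensorial p M" "\<And>u. u \<in> sections C \<Longrightarrow> L u = M u"
  shows "tensorial p L"
  unfolding tensorial_def
proof (intro conjI ballI)
  fix u v assume uv: "u \<in> sections C" "v \<in> sections C"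
  show "L (u + v) = L u + L v"
    using tensorialD(1)[OF assms(1) uv] assms(2)[OF section_add[OF uv]] assms(2)[OF uv(1)] assms(2)[OF uv(2)] by simp
next
  fix f u assume fu: "f \<in> fns C" "u \<in> sections C"
  show "L (smul f u) = f p * L u"
    using tensorialD(2)[OF assms(1) fu] assms(2)[OF section_smul[OF fu]] assms(2)[OF fu(2)] by simp
qed

text \<open>The curvature operator fails to be tensorial by the anchor of the naive torsion
  \<open>D v w - D w v - [v, w]\<close>, which the vanishing of the torsion expresses through \<open>D\<close>.\<close>

lemma curv_smul_third:
  assumes F: "dual_frames (sections C) (rk C) (scal C) p e e'" and u: "u \<in> sections C" and v: "v \<in> sections C"
    and w: "w \<in> sections C" and a: "a \<in> sections C" and f: "f \<in> fns C"
  shows "sprod C (curv v w (smul f u)) a p = f p * sprod C (curv v w u) a p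
    + (\<Sum>i<rk C. sprod C (D (e i) v) w p * app (anch C (e' i)) f p) * sprod C u a p"
proof -
  define L where "L x = sprod C x a p" for x
  have L: "tensorial p L" unfolding L_def using tensorial_sprod(1)[OF a] .
  have sd: "L (second_deriv D v w (smul f u)) = app (anch C v) (app (anch C w) f) p * L u + app (anch C w) f p * L (D v u)
      + (app (anch C v) f p * L (D w u) + f p * L (D v (D w u)))
      - (app (anch C (D v w)) f p * L u + f p * L (D (D v w) u))"
    if v: "v \<in> sections C" and w: "w \<in> sections C" for v w
  proof -
    note s = section_smul[OF app_fns[OF v app_fns[OF w f]] u] section_smul[OF app_fns[OF w f] D_section[OF v u]]
      section_smul[OF app_fns[OF v f] D_section[OF w u]] section_smul[OF f D_section[OF v D_section[OF w u]]]
      section_smul[OF app_fns[OF D_section[OF v w] f] u] section_smul[OF f D_section[OF D_section[OF v w] u]]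
    show ?thesis
      unfolding second_deriv_smul(3)[OF u v w f]
        tensorial_diffD[OF L section_add[OF section_add[OF s(1,2)] section_add[OF s(3,4)]] section_add[OF s(5,6)]]
        tensorialD(1)[OF L section_add[OF s(1,2)] section_add[OF s(3,4)]]
        tensorialD(1)[OF L s(1,2)] tensorialD(1)[OF L s(3,4)] tensorialD(1)[OF L s(5,6)]
        tensorialD(2)[OF L app_fns[OF v app_fns[OF w f]] u] tensorialD(2)[OF L app_fns[OF w f] D_section[OF v u]]
        tensorialD(2)[OF L app_fns[OF v f] D_section[OF w u]] tensorialD(2)[OF L f D_section[OF v D_section[OF w u]]]
        tensorialD(2)[OF L app_fns[OF D_section[OF v w] f] u] tensorialD(2)[OF L f D_section[OF D_section[OF v w] u]] ..
  qed
  have sd0: "L (second_deriv D v w u) = L (D v (D w u)) - L (D (D v w) u)"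
    if v: "v \<in> sections C" and w: "w \<in> sections C" for v w
    unfolding second_deriv_def by (intro tensorial_diffD[OF L] D_section u v w)
  define t where "t = D v w - D w v - dorfman C v w"
  note s = D_section[OF v w] D_section[OF w v] dorfman_section[OF v w]
  have t: "t \<in> sections C" unfolding t_def by (intro section_diff s)
  define M where "M x = app (anch C x) f p" for x
  have M: "tensorial p M" unfolding M_def by (rule tensorial_anch)
  have Mt: "M t = M (D v w) - M (D w v) - M (dorfman C v w)"
    unfolding t_def tensorial_diffD[OF M section_diff[OF s(1,2)] s(3)] tensorial_diffD[OF M s(1,2)] ..
  have Mb: "M (dorfman C v w) = app (anch C v) (app (anch C w) f) p - app (anch C w) (app (anch C v) f) p"
    unfolding M_def by (simp add: anch_dorfman[OF v w] app_def lie_bracket_def)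
  \<comment> \<open>The anchor of t is expanded in the frame because vanishing torsion determines t
    through its pairings: \<langle>t, e i\<rangle> = - \<langle>D (e i) v, w\<rangle>.\<close>
  have "M t = (\<Sum>i<rk C. sprod C (e i) t p * M (e' i))"
    by (rule tensorial_expand[OF dual_frames_swap[OF F] M t])
  also have "\<dots> = (\<Sum>i<rk C. - (sprod C (D (e i) v) w p * M (e' i)))"
  proof (intro sum.cong refl)
    fix i assume "i \<in> {..<rk C}"
    then have ei: "e i \<in> sections C" using F by (simp add: dual_frames_def)
    have "sprod C t (e i) p + sprod C (D (e i) v) w p = 0"
      using fun_cong[OF torsion_free[OF v w ei], of p] unfolding torsion_def t_def by simp
    then show "sprod C (e i) t p * M (e' i) = - (sprod C (D (e i) v) w p * M (e' i))"
      by (simp add: sprod_commute[OF ei t] eq_neg_iff_add_eq_0 flip: distrib_right)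
  qed
  finally have K: "M t = - (\<Sum>i<rk C. sprod C (D (e i) v) w p * M (e' i))" by (simp add: sum_negf)
  have "L (curv v w (smul f u)) = f p * L (curv v w u) - M t * L u"
    unfolding curv_def
      tensorial_diffD[OF L second_deriv_section[OF v w section_smul[OF f u]] second_deriv_section[OF w v section_smul[OF f u]]]
      tensorial_diffD[OF L second_deriv_section[OF v w u] second_deriv_section[OF w v u]]
      sd[OF v w] sd[OF w v] sd0[OF v w] sd0[OF w v] Mt Mb
    unfolding M_def by (simp add: algebra_simps)
  then show ?thesis unfolding K by (simp add: L_def M_def)
qed

section \<open>Tensoriality of the generalised Riemann tensor\<close>

lemma gen_riemann_eq:
  assumes F: "dual_frames (sections C) (rk C) (scal C) p e e'" and a: "a \<in> sections C" and b: "b \<in> sections C"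
    and v: "v \<in> sections C" and w: "w \<in> sections C"
  shows "gen_riemann C D a b v w p = 1 / 2 * (sprod C (curv v w b) a p + sprod C (curv b a v) w p
    - (\<Sum>i<rk C. sprod C (D (e i) v) w p * sprod C (D (e' i) b) a p))"
proof -
  have "trE C (\<lambda>x y. sprod C (D x v) w * sprod C (D y b) a) p
      = (\<Sum>i<rk C. (sprod C (D (e i) v) w * sprod C (D (e' i) b) a) p)"
  proof (rule trE_dual_frames[OF F])
    show "tensorial p (\<lambda>u. (sprod C (D u v) w * sprod C (D y b) a) p)" for y
      unfolding times_fun_apply by (intro tensorial_scale' tensorial_D[OF tensorial_sprod(1)] v w)
    show "tensorial p (\<lambda>u. (sprod C (D x v) w * sprod C (D u b) a) p)" for x
      unfolding times_fun_apply by (intro tensorial_scale tensorial_D[OF tensorial_sprod(1)] a b)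
  qed
  then show ?thesis by (simp add: gen_riemann_def curv_def)
qed

text \<open>The two curvature terms change places, and the trace term is unchanged when the frame is
  exchanged with its dual. Tensoriality in the last two arguments thus follows from that in the
  first two.\<close>

lemma gen_riemann_pair_symmetric:
  assumes F: "dual_frames (sections C) (rk C) (scal C) p e e'" and a: "a \<in> sections C" and b: "b \<in> sections C"
    and v: "v \<in> sections C" and w: "w \<in> sections C"
  shows "gen_riemann C D a b v w p = gen_riemann C D w v b a p"
  unfolding gen_riemann_eq[OF F a b v w] gen_riemann_eq[OF dual_frames_swap[OF F] w v b a]
  by (simp add: mult.commute add.commute)

lemma tensorial_gen_riemann_1:
  assumes F: "dual_frames (sections C) (rk C) (scal C) p e e'" and b: "b \<in> sections C"
    and v: "v \<in> sections C" and w: "w \<in> sections C"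
  shows "tensorial p (\<lambda>a. gen_riemann C D a b v w p)"
proof (rule tensorial_transfer[OF _ gen_riemann_eq[OF F _ b v w]])
  have e: "e' i \<in> sections C" if "i < rk C" for i using F that by (simp add: dual_frames_def)
  show "tensorial p (\<lambda>a. 1 / 2 * (sprod C (curv v w b) a p + sprod C (curv b a v) w p
    - (\<Sum>i<rk C. sprod C (D (e i) v) w p * sprod C (D (e' i) b) a p)))"
    by (intro tensorial_scale tensorial_diff tensorial_add tensorial_setsum tensorial_sprod(2)
        tensorial_curv(2)[OF tensorial_sprod(1)] curv_section D_section b v w e) simp
qed

text \<open>The purpose of the trace term in the definition: the defect \<Sum> \<langle>D (e i) v,
  w\<rangle> \<pi>(e' i)(f) \<langle>b, a\<rangle> of the curvature operator equals the term with
  the derivative of f in \<Sum> \<langle>D (e i) v, w\<rangle> \<langle>D (e' i) (f b), a\<rangle>,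
  which enters with the opposite sign.\<close>

lemma tensorial_gen_riemann_2:
  assumes F: "dual_frames (sections C) (rk C) (scal C) p e e'" and a: "a \<in> sections C"
    and v: "v \<in> sections C" and w: "w \<in> sections C"
  shows "tensorial p (\<lambda>b. gen_riemann C D a b v w p)"
proof (rule tensorial_transfer[OF _ gen_riemann_eq[OF F a _ v w]])
  have e: "e' i \<in> sections C" if "i < rk C" for i using F that by (simp add: dual_frames_def)
  define L where "L b = sprod C (curv v w b) a p - (\<Sum>i<rk C. sprod C (D (e i) v) w p * sprod C (D (e' i) b) a p)" for b
  have "tensorial p L"
    unfolding tensorial_def
  proof (intro conjI ballI)
    fix b x assume b: "b \<in> sections C" and x: "x \<in> sections C"
    have "curv v w (b + x) = curv v w b + curv v w x"
      unfolding curv_def second_deriv_add(3)[OF b v w x] second_deriv_add(3)[OF b w v x] by simp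
    moreover have "sprod C (D (e' i) (b + x)) a p = sprod C (D (e' i) b) a p + sprod C (D (e' i) x) a p" if "i < rk C" for i
      unfolding D_add_right[OF e[OF that] b x] using a b x e[OF that] by (simp add: sprod_add_left D_section)
    ultimately show "L (b + x) = L b + L x"
      unfolding L_def using a b x v w by (simp add: sprod_add_left curv_section distrib_left sum.distrib)
  next
    fix f b assume f: "f \<in> fns C" and b: "b \<in> sections C"
    have "sprod C (D (e' i) (smul f b)) a p = app (anch C (e' i)) f p * sprod C b a p + f p * sprod C (D (e' i) b) a p"
      if i: "i < rk C" for i
      unfolding D_smul_right[OF e[OF i] b f]
        sprod_add_left[OF section_smul[OF app_fns[OF e[OF i] f] b] section_smul[OF f D_section[OF e[OF i] b]] a]
        sprod_smul_left[OF b a] sprod_smul_left[OF D_section[OF e[OF i] b] a] by simp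
    then have "(\<Sum>i<rk C. sprod C (D (e i) v) w p * sprod C (D (e' i) (smul f b)) a p) =
        (\<Sum>i<rk C. sprod C (D (e i) v) w p * app (anch C (e' i)) f p) * sprod C b a p
        + f p * (\<Sum>i<rk C. sprod C (D (e i) v) w p * sprod C (D (e' i) b) a p)"
      by (simp add: sum_distrib_left sum_distrib_right distrib_left sum.distrib mult_ac)
    then show "L (smul f b) = f p * L b"
      unfolding L_def curv_smul_third[OF F b v w a f] by (simp add: algebra_simps)
  qed
  moreover have "tensorial p (\<lambda>b. sprod C (curv b a v) w p)"
    by (rule tensorial_curv(1)[OF tensorial_sprod(1)[OF w] v a])
  ultimately have "tensorial p (\<lambda>b. 1 / 2 * (L b + sprod C (curv b a v) w p))"
    by (intro tensorial_scale tensorial_add)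
  then show "tensorial p (\<lambda>b. 1 / 2 * (sprod C (curv v w b) a p + sprod C (curv b a v) w p
    - (\<Sum>i<rk C. sprod C (D (e i) v) w p * sprod C (D (e' i) b) a p)))"
    unfolding L_def by (simp add: algebra_simps)
qed

lemma trE_full_ricci_frame:
  assumes F: "dual_frames (sections C) (rk C) (scal C) p e e'"
  shows "trE C (full_ricci C D) p = (\<Sum>j<rk C. \<Sum>i<rk C. gen_riemann C D (e i) (e j) (e' i) (e' j) p)"
proof -
  have e: "e i \<in> sections C" "e' i \<in> sections C" if "i < rk C" for i using F that by (simp_all add: dual_frames_def)
  have t34: "tensorial p (\<lambda>v. gen_riemann C D a b v w p)" if "a \<in> sections C" "b \<in> sections C" "w \<in> sections C" for a b w
    by (rule tensorial_transfer[OF tensorial_gen_riemann_2[OF F that(3,2,1)]])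
      (rule gen_riemann_pair_symmetric[OF F that(1,2) _ that(3)])
  have t4: "tensorial p (\<lambda>w. gen_riemann C D a b v w p)" if "a \<in> sections C" "b \<in> sections C" "v \<in> sections C" for a b v
    by (rule tensorial_transfer[OF tensorial_gen_riemann_1[OF F that(3,2,1)]])
      (rule gen_riemann_pair_symmetric[OF F that])
  have ric: "full_ricci C D a b p = (\<Sum>i<rk C. gen_riemann C D (e i) a (e' i) b p)"
    if "a \<in> sections C" "b \<in> sections C" for a b
    unfolding full_ricci_def
    by (rule trE_dual_frames[OF F]) (intro tensorial_gen_riemann_1[OF F] t34 that, assumption)+
  have "trE C (full_ricci C D) p = (\<Sum>j<rk C. full_ricci C D (e j) (e' j) p)"
  proof (rule trE_dual_frames[OF F])
    show "tensorial p (\<lambda>a. full_ricci C D a b p)" if b: "b \<in> sections C" for b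
    proof (rule tensorial_transfer[OF _ ric[OF _ b]])
      show "tensorial p (\<lambda>a. \<Sum>i<rk C. gen_riemann C D (e i) a (e' i) b p)"
        by (intro tensorial_setsum tensorial_gen_riemann_2[OF F] e b) simp_all
    qed
    show "tensorial p (\<lambda>b. full_ricci C D a b p)" if a: "a \<in> sections C" for a
    proof (rule tensorial_transfer[OF _ ric[OF a]])
      show "tensorial p (\<lambda>b. \<Sum>i<rk C. gen_riemann C D (e i) a (e' i) b p)"
        by (intro tensorial_setsum t4 e a) simp_all
    qed
  qed
  also have "\<dots> = (\<Sum>j<rk C. \<Sum>i<rk C. gen_riemann C D (e i) (e j) (e' i) (e' j) p)"
    by (intro sum.cong refl ric e) simp_all
  finally show ?thesis .
qed

lemma div_of_conn_frame:
  assumes F: "dual_frames (sections C) (rk C) (scal C) p e e'" and v: "v \<in> sections C"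
  shows "div_of_conn C D v p = (\<Sum>i<rk C. sprod C (D (e i) v) (e' i) p)"
  unfolding div_of_conn_def
  by (rule trE_dual_frames[OF F])
    (intro tensorial_D[OF tensorial_sprod(1)] v tensorial_sprod(2) D_section, assumption)+

end

section \<open>The trace of the full generalised Ricci tensor\<close>


lemma Cinf_sum:
  assumes "smooth_manifold A" "\<And>i. i \<in> I \<Longrightarrow> f i \<in> Cinf A"
  shows "(\<Sum>i\<in>I. f i) \<in> Cinf A"
  using assms(2)
proof (induction I rule: infinite_finite_induct)
  case (insert i I)
  have "(\<Sum>i\<in>I. f i) \<in> Cinf A" by (rule insert.IH) (rule insert.prems, simp)
  then show ?case
    unfolding sum.insert[OF insert.hyps] by (intro Cinf_add[OF assms(1)] insert.prems) simp_all
qed (use Cinf_const[OF assms(1), of 0] in \<open>simp_all add: zero_fun_def\<close>)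

lemma tangent_sum:
  assumes "smooth_manifold A" "x \<in> tangent_space A p" "\<And>i. i \<in> I \<Longrightarrow> f i \<in> Cinf A"
  shows "x (\<Sum>i\<in>I. f i) = (\<Sum>i\<in>I. x (f i))"
  using assms(3)
proof (induction I rule: infinite_finite_induct)
  case (insert i I)
  have "x (f i + (\<Sum>i\<in>I. f i)) = x (f i) + x (\<Sum>i\<in>I. f i)"
    by (rule tangent_add[OF assms(1,2)]) (intro Cinf_sum[OF assms(1)] insert.prems, simp)+
  moreover have "x (\<Sum>i\<in>I. f i) = (\<Sum>i\<in>I. x (f i))" by (rule insert.IH) (rule insert.prems, simp)
  ultimately show ?case unfolding sum.insert[OF insert.hyps] by (simp only:)
qed (use tangent_const[OF assms(1,2), of 0] in \<open>simp_all add: zero_fun_def\<close>)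

context torsion_free_connection
begin

section \<open>Curvature and divergence in an isotropic frame\<close>

lemma sprod_dual_expand:
  assumes F: "dual_frames (sections C) (rk C) (scal C) p e e'" and "x \<in> sections C" "y \<in> sections C"
  shows "sprod C x y p = (\<Sum>i<rk C. sprod C x (e i) p * sprod C y (e' i) p)"
proof -
  have e: "e i \<in> sections C" "e' i \<in> sections C" if "i < rk C" for i using F that by (simp_all add: dual_frames_def)
  have "sprod C x y p = (\<Sum>i<rk C. sprod C (e i) x p * sprod C (e' i) y p)"
    by (rule tensorial_expand[OF dual_frames_swap[OF F] tensorial_sprod(1)]) (rule assms)+
  also have "\<dots> = (\<Sum>i<rk C. sprod C x (e i) p * sprod C y (e' i) p)"
    by (intro sum.cong refl) (simp add: sprod_commute[OF e(1) assms(2)] sprod_commute[OF e(2) assms(3)])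
  finally show ?thesis .
qed

text \<open>Metricity gives \<langle>D a (D b c), d\<rangle> = \<pi>(a)\<langle>D b c, d\<rangle> -
  \<langle>D b c, D a d\<rangle>. Expanding the last product and the direction D a b in the frame
  leaves first derivatives of connection coefficients and quadratic terms in them.\<close>

lemma sprod_curv_frame:
  assumes F: "dual_frames (sections C) (rk C) (scal C) p e e'" and a: "a \<in> sections C" and b: "b \<in> sections C"
    and c: "c \<in> sections C" and d: "d \<in> sections C"
  shows "sprod C (curv a b c) d p =
      app (anch C a) (sprod C (D b c) d) p - (\<Sum>k<rk C. sprod C (D b c) (e k) p * sprod C (D a d) (e' k) p)
    - (\<Sum>k<rk C. sprod C (D a b) (e k) p * sprod C (D (e' k) c) d p)
    - (app (anch C b) (sprod C (D a c) d) p - (\<Sum>k<rk C. sprod C (D a c) (e k) p * sprod C (D b d) (e' k) p)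
    - (\<Sum>k<rk C. sprod C (D b a) (e k) p * sprod C (D (e' k) c) d p))"
proof -
  have e: "e i \<in> sections C" "e' i \<in> sections C" if "i < rk C" for i using F that by (simp_all add: dual_frames_def)
  have sd: "sprod C (second_deriv D a b c) d p = app (anch C a) (sprod C (D b c) d) p
    - (\<Sum>k<rk C. sprod C (D b c) (e k) p * sprod C (D a d) (e' k) p)
    - (\<Sum>k<rk C. sprod C (D a b) (e k) p * sprod C (D (e' k) c) d p)"
    if a: "a \<in> sections C" and b: "b \<in> sections C" for a b
  proof -
    note s = D_section[OF a b] D_section[OF b c] D_section[OF a d]
    have "app (anch C a) (sprod C (D b c) d) p = sprod C (D a (D b c)) d p + sprod C (D b c) (D a d) p"
      using fun_cong[OF D_metric[OF a s(2) d], of p] by simp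
    moreover have "sprod C (D b c) (D a d) p = (\<Sum>k<rk C. sprod C (D b c) (e k) p * sprod C (D a d) (e' k) p)"
      by (rule sprod_dual_expand[OF F s(2,3)])
    moreover have "sprod C (D (D a b) c) d p = (\<Sum>k<rk C. sprod C (e k) (D a b) p * sprod C (D (e' k) c) d p)"
      by (rule tensorial_expand[OF dual_frames_swap[OF F] tensorial_D[OF tensorial_sprod(1)[OF d] c] s(1)])
    moreover have "\<dots> = (\<Sum>k<rk C. sprod C (D a b) (e k) p * sprod C (D (e' k) c) d p)"
      by (intro sum.cong refl) (simp add: sprod_commute[OF e(1) s(1)])
    moreover have "sprod C (second_deriv D a b c) d p = sprod C (D a (D b c)) d p - sprod C (D (D a b) c) d p"
      unfolding second_deriv_def sprod_diff_left[OF D_section[OF a s(2)] D_section[OF s(1) c] d] by simp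
    ultimately show ?thesis by simp
  qed
  have "sprod C (curv a b c) d p = sprod C (second_deriv D a b c) d p - sprod C (second_deriv D b a c) d p"
    unfolding curv_def sprod_diff_left[OF second_deriv_section[OF a b c] second_deriv_section[OF b a c] d] by simp
  then show ?thesis unfolding sd[OF a b] sd[OF b a] .
qed

text \<open>The pairings of the frame are locally constant, so metricity has left-hand side 0.
  Skewness is stated near p and not just at p because it is differentiated later.\<close>

lemma isotropic_frame_coefficients:
  assumes I: "isotropic_frame p r e"
  shows "eventually (\<lambda>q. \<forall>a<2 * r. \<forall>b<2 * r. \<forall>c<2 * r.
    sprod C (D (e a) (e b)) (e c) q = - sprod C (D (e a) (e c)) (e b) q) (nhds p)"
proof -
  have es: "e i \<in> sections C" if "i < 2 * r" for i using I that by (simp add: isotropic_frame_def)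
  let ?P = "\<lambda>q. \<forall>i<2 * r. \<forall>j<2 * r. sprod C (e i) (e j) q = (if j = swap_half r i then 1 else 0)"
  have "eventually ?P (nhds p)" using I by (simp only: isotropic_frame_def)
  \<comment> \<open>At a nearby point q, too, the pairings must be constant on a neighbourhood for
    their derivatives to vanish.\<close>
  then have "eventually (\<lambda>q. eventually ?P (nhds q)) (nhds p)" by (simp only: eventually_eventually)
  then show ?thesis
  proof eventually_elim
    case (elim q)
    show ?case
    proof (intro allI impI)
      fix a b c assume abc: "a < 2 * r" "b < 2 * r" "c < 2 * r"
      note s = es[OF abc(1)] es[OF abc(2)] es[OF abc(3)]
      have "eventually (\<lambda>x. sprod C (e b) (e c) x = (if c = swap_half r b then 1 else 0)) (nhds q)"
        using elim by eventually_elim (use abc in blast)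
      then have "anch C (e a) q (sprod C (e b) (e c)) = anch C (e a) q (\<lambda>_. if c = swap_half r b then 1 else 0)"
        by (rule tangent_local[OF manifold anch_tangent[OF s(1)] sprod_fns[OF s(2,3)] fns_const])
      also have "\<dots> = 0" by (rule tangent_const[OF manifold anch_tangent[OF s(1)]])
      finally have "app (anch C (e a)) (sprod C (e b) (e c)) q = 0" by (simp add: app_def)
      then have "sprod C (D (e a) (e b)) (e c) q + sprod C (e b) (D (e a) (e c)) q = 0"
        using fun_cong[OF D_metric[OF s], of q] by simp
      then show "sprod C (D (e a) (e b)) (e c) q = - sprod C (D (e a) (e c)) (e b) q"
        using sprod_commute[OF s(2) D_section[OF s(1,3)]] by simp
    qed
  qed
qed

text \<open>With skew coefficients, vanishing torsion identifies the cyclic sum with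
  \<langle>[e a, e b], e c\<rangle>, and this is 0 for two gradients.\<close>

lemma isotropic_frame_torsion:
  assumes I: "isotropic_frame p r e" and abc: "a < 2 * r" "b < 2 * r" "c < 2 * r" and two: "a < r \<and> b < r"
  shows "sprod C (D (e a) (e b)) (e c) p + sprod C (D (e b) (e c)) (e a) p + sprod C (D (e c) (e a)) (e b) p = 0"
proof -
  have es: "e i \<in> sections C" if "i < 2 * r" for i using I that by (simp add: isotropic_frame_def)
  have eg: "e i \<in> gradients" if "i < r" for i using I that by (simp add: isotropic_frame_def)
  note s = es[OF abc(1)] es[OF abc(2)] es[OF abc(3)]
  have "sprod C (D (e a) (e b) - D (e b) (e a) - dorfman C (e a) (e b)) (e c) p + sprod C (D (e c) (e a)) (e b) p = 0"
    using fun_cong[OF torsion_free[OF s], of p] by (simp add: torsion_def)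
  moreover have "sprod C (D (e a) (e b) - D (e b) (e a) - dorfman C (e a) (e b)) (e c) p =
      sprod C (D (e a) (e b)) (e c) p - sprod C (D (e b) (e a)) (e c) p - sprod C (dorfman C (e a) (e b)) (e c) p"
    unfolding sprod_diff_left[OF section_diff[OF D_section[OF s(1,2)] D_section[OF s(2,1)]] dorfman_section[OF s(1,2)] s(3)]
      sprod_diff_left[OF D_section[OF s(1,2)] D_section[OF s(2,1)] s(3)] by simp
  moreover have "sprod C (dorfman C (e a) (e b)) (e c) p = 0"
    using dorfman_gradients[OF eg eg s(3)] two by simp
  moreover have "sprod C (D (e b) (e a)) (e c) p = - sprod C (D (e b) (e c)) (e a) p"
    using eventually_nhds_x_imp_x[OF isotropic_frame_coefficients[OF I]] abc by blast
  ultimately show ?thesis by simp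
qed

text \<open>With S i j = \<langle>R(e' i, e' j) (e j), e i\<rangle>, where R is \<open>curv\<close>
  and e' the dual frame, both curvature terms of the Riemann tensor have the same double sum.
  Contracted coefficients give divergences and their derivatives; the remaining cubic contractions
  cancel by \<open>connection_coefficient_contractions\<close>.\<close>

lemma trE_full_ricci_isotropic_frame:
  assumes I: "isotropic_frame p r e"
    and df: "\<And>v. v \<in> sections C \<Longrightarrow> div_of_conn C D v \<in> fns C"
  shows "trE C (full_ricci C D) p =
    - 2 * (\<Sum>i<2 * r. app (anch C (e (swap_half r i))) (div_of_conn C D (e i)) p)
    - (\<Sum>i<2 * r. div_of_conn C D (e i) p * div_of_conn C D (e (swap_half r i)) p)"
proof -
  let ?n = "2 * r"
  define s where "s = swap_half r"
  define T where "T a b c = sprod C (D (e a) (e b)) (e c) p" for a b c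
  define d where "d i = div_of_conn C D (e i) p" for i
  define l where "l i = app (anch C (e (s i))) (div_of_conn C D (e i)) p" for i
  have rk: "rk C = ?n" using I by (simp add: isotropic_frame_def)
  have es: "e i \<in> sections C" if "i < ?n" for i using I that by (simp add: isotropic_frame_def)
  have ss: "s a < ?n" "s (s a) = a" "s a < r \<longleftrightarrow> \<not> a < r" if "a < ?n" for a
    using that by (simp_all add: s_def swap_half)
  have ev: "eventually (\<lambda>q. dual_frames (sections C) (rk C) (scal C) q e (\<lambda>i. e (s i))) (nhds p)"
    unfolding s_def by (rule isotropic_frame_dual[OF I])
  note F = eventually_nhds_x_imp_x[OF ev]
  have sums: "(\<Sum>i<?n. f (s i)) = (\<Sum>i<?n. f i)" for f :: "nat \<Rightarrow> real"
    unfolding s_def by (rule sum_swap_half)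
  have anti: "T a b c = - T a c b" if "a < ?n" "b < ?n" "c < ?n" for a b c
    using eventually_nhds_x_imp_x[OF isotropic_frame_coefficients[OF I]] that unfolding T_def by blast
  have tor: "T a b c + T b c a + T c a b = 0"
    if "a < ?n" "b < ?n" "c < ?n" "a < r \<and> b < r \<or> b < r \<and> c < r \<or> c < r \<and> a < r" for a b c
    using isotropic_frame_torsion[OF I that(1,2,3)] isotropic_frame_torsion[OF I that(2,3,1)]
      isotropic_frame_torsion[OF I that(3,1,2)] that(4) unfolding T_def by (elim disjE) simp_all
  \<comment> \<open>Of three indices, at least two lie in the gradient half or at least two of their
    duals do, so one of the factors vanishes.\<close>
  have cyc: "(T a b c + T b c a + T c a b) * (T (s a) (s b) (s c) + T (s b) (s c) (s a) + T (s c) (s a) (s b)) = 0"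
    if "a < ?n" "b < ?n" "c < ?n" for a b c
  proof (cases "a < r \<and> b < r \<or> b < r \<and> c < r \<or> c < r \<and> a < r")
    case True
    then show ?thesis using tor[OF that] by simp
  next
    case False
    then have "s a < r \<and> s b < r \<or> s b < r \<and> s c < r \<or> s c < r \<and> s a < r" using that by (simp add: ss) blast
    then show ?thesis using tor[OF ss(1)[OF that(1)] ss(1)[OF that(2)] ss(1)[OF that(3)]] by simp
  qed
  have div: "(\<Sum>j<?n. T j i (s j)) = d i" if "i < ?n" for i
    unfolding T_def d_def using div_of_conn_frame[OF F es[OF that]] by (simp add: rk)
  have div': "(\<Sum>j<?n. T (s j) j i) = - d i" if i: "i < ?n" for i
  proof -
    have "(\<Sum>j<?n. T (s j) j i) = (\<Sum>j<?n. - T (s j) i (s (s j)))"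
    proof (intro sum.cong refl)
      fix j assume "j \<in> {..<?n}"
      then have j: "j < ?n" by simp
      show "T (s j) j i = - T (s j) i (s (s j))"
        using anti[OF ss(1)[OF j] j i] by (simp only: ss(2)[OF j])
    qed
    also have "\<dots> = - d i" using sums[of "\<lambda>j. T j i (s j)"] div[OF i] by (simp add: sum_negf)
    finally show ?thesis .
  qed
  define dT where "dT a b c i = app (anch C (e a)) (sprod C (D (e b) (e c)) (e i)) p" for a b c i
  have Tf: "sprod C (D (e b) (e c)) (e i) \<in> fns C" if "b < ?n" "c < ?n" "i < ?n" for b c i
    by (intro sprod_fns D_section es that)
  have d_eq: "app (anch C (e a)) (\<Sum>j<?n. sprod C (D (e (f j)) (e (g j))) (e (h j))) p = (\<Sum>j<?n. dT a (f j) (g j) (h j))"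
    "(\<Sum>j<?n. sprod C (D (e (f j)) (e (g j))) (e (h j))) \<in> fns C"
    if a: "a < ?n" and fgh: "\<And>j. j < ?n \<Longrightarrow> f j < ?n" "\<And>j. j < ?n \<Longrightarrow> g j < ?n" "\<And>j. j < ?n \<Longrightarrow> h j < ?n" for a f g h
  proof -
    have Tf': "sprod C (D (e (f j)) (e (g j))) (e (h j)) \<in> fns C" if "j \<in> {..<?n}" for j
      by (intro Tf fgh) (use that in simp_all)
    show "app (anch C (e a)) (\<Sum>j<?n. sprod C (D (e (f j)) (e (g j))) (e (h j))) p = (\<Sum>j<?n. dT a (f j) (g j) (h j))"
      unfolding app_def dT_def by (rule tangent_sum[OF manifold anch_tangent[OF es[OF a]] Tf'])
    show "(\<Sum>j<?n. sprod C (D (e (f j)) (e (g j))) (e (h j))) \<in> fns C"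
      by (rule Cinf_sum[OF manifold Tf'])
  qed
  \<comment> \<open>The divergence is differentiated at p, so its expression through the
    coefficients has to hold on a neighbourhood. The frame and its dual exchange roles in the trace
    to match the index pattern of \<open>dT\<close>.\<close>
  have near_div: "eventually (\<lambda>q. (\<Sum>j<?n. sprod C (D (e (s j)) (e i)) (e j)) q = div_of_conn C D (e i) q) (nhds p)"
    if i: "i < ?n" for i
    using ev
  proof eventually_elim
    case (elim q)
    show ?case
      unfolding div_of_conn_frame[OF dual_frames_swap[OF elim] es[OF i]] by (simp add: sum_fun_apply rk)
  qed
  have dT2: "(\<Sum>j<?n. dT a (s j) i j) = app (anch C (e a)) (div_of_conn C D (e i)) p" if a: "a < ?n" and i: "i < ?n" for a i
  proof -
    have "(\<Sum>j<?n. dT a (s j) i j) = app (anch C (e a)) (\<Sum>j<?n. sprod C (D (e (s j)) (e i)) (e j)) p"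
      by (rule d_eq(1)[symmetric]) (simp_all add: a i ss)
    also have "\<dots> = app (anch C (e a)) (div_of_conn C D (e i)) p"
      unfolding app_def
      by (rule tangent_local[OF manifold anch_tangent[OF es[OF a]] d_eq(2)[OF a] df[OF es[OF i]] near_div[OF i]])
        (simp_all add: i ss)
    finally show ?thesis .
  qed
  have dT1: "(\<Sum>j<?n. dT a (s j) j i) = - app (anch C (e a)) (div_of_conn C D (e i)) p" if a: "a < ?n" and i: "i < ?n" for a i
  proof -
    have "dT a (s j) j i = - dT a (s j) i j" if j: "j < ?n" for j
    proof -
      \<comment> \<open>Skewness of the coefficients, as an identity near p that may be
        differentiated.\<close>
      have "eventually (\<lambda>q. sprod C (D (e (s j)) (e j)) (e i) q = - 1 * sprod C (D (e (s j)) (e i)) (e j) q) (nhds p)"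
        using isotropic_frame_coefficients[OF I]
      proof eventually_elim
        case (elim q)
        show ?case using elim[rule_format, OF ss(1)[OF j] j i] by simp
      qed
      then have "anch C (e a) p (sprod C (D (e (s j)) (e j)) (e i)) =
          anch C (e a) p (\<lambda>q. - 1 * sprod C (D (e (s j)) (e i)) (e j) q)"
        using fns_mult[OF fns_const[of "- 1"] Tf[OF ss(1)[OF j] i j]]
        by (intro tangent_local[OF manifold anch_tangent[OF es[OF a]] Tf[OF ss(1)[OF j] j i]])
          (simp_all only: times_fun_def)
      also have "\<dots> = - 1 * anch C (e a) p (sprod C (D (e (s j)) (e i)) (e j))"
        by (rule tangent_scale[OF manifold anch_tangent[OF es[OF a]] Tf[OF ss(1)[OF j] i j]])
      finally show ?thesis by (simp add: dT_def app_def)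
    qed
    then have "(\<Sum>j<?n. dT a (s j) j i) = - (\<Sum>j<?n. dT a (s j) i j)" by (simp add: sum_negf)
    then show ?thesis using dT2[OF a i] by simp
  qed
  define S where "S i j = sprod C (curv (e (s i)) (e (s j)) (e j)) (e i) p" for i j
  have S: "S i j = dT (s i) (s j) j i - (\<Sum>k<?n. T (s j) j k * T (s i) i (s k)) - (\<Sum>k<?n. T (s i) (s j) k * T (s k) j i)
      - (dT (s j) (s i) j i - (\<Sum>k<?n. T (s i) j k * T (s j) i (s k)) - (\<Sum>k<?n. T (s j) (s i) k * T (s k) j i))"
    if ij: "i < ?n" "j < ?n" for i j
    unfolding S_def sprod_curv_frame[OF F es[OF ss(1)[OF ij(1)]] es[OF ss(1)[OF ij(2)]] es[OF ij(2)] es[OF ij(1)]] T_def dT_def rk ..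
  have sumS: "(\<Sum>i<?n. \<Sum>j<?n. S i j) = - 2 * (\<Sum>i<?n. l i) - (\<Sum>i<?n. d i * d (s i))
      - triple_sum ?n (\<lambda>i j k. T (s i) (s j) k * T (s k) j i)
      + triple_sum ?n (\<lambda>i j k. T (s i) j k * T (s j) i (s k))
      + triple_sum ?n (\<lambda>i j k. T (s j) (s i) k * T (s k) j i)"
  proof -
    have A: "(\<Sum>i<?n. \<Sum>j<?n. dT (s i) (s j) j i) = - (\<Sum>i<?n. l i)"
      unfolding sum_negf[symmetric] by (intro sum.cong refl) (simp add: dT1 ss l_def)
    have B: "(\<Sum>i<?n. \<Sum>j<?n. dT (s j) (s i) j i) = (\<Sum>i<?n. l i)"
      by (subst sum.swap) (intro sum.cong refl, simp add: dT2 ss l_def)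
    \<comment> \<open>The only quadratic term in which both factors contract to divergences; the two
      signs from skewness cancel.\<close>
    have E: "(\<Sum>i<?n. \<Sum>j<?n. \<Sum>k<?n. T (s j) j k * T (s i) i (s k)) = (\<Sum>k<?n. d k * d (s k))"
    proof -
      have "(\<Sum>i<?n. \<Sum>j<?n. \<Sum>k<?n. T (s j) j k * T (s i) i (s k)) =
          (\<Sum>k<?n. \<Sum>i<?n. \<Sum>j<?n. T (s j) j k * T (s i) i (s k))"
        by (rule triple_sum_rotate[of ?n "\<lambda>i j k. T (s j) j k * T (s i) i (s k)", unfolded triple_sum_def, symmetric])
      also have "\<dots> = (\<Sum>k<?n. (\<Sum>i<?n. T (s i) i (s k)) * (\<Sum>j<?n. T (s j) j k))"
        unfolding sum_product by (intro sum.cong refl mult.commute)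
      also have "\<dots> = (\<Sum>k<?n. d k * d (s k))"
      proof (intro sum.cong refl)
        fix k assume "k \<in> {..<?n}"
        then have k: "k < ?n" by simp
        show "(\<Sum>i<?n. T (s i) i (s k)) * (\<Sum>j<?n. T (s j) j k) = d k * d (s k)"
          unfolding div'[OF k] div'[OF ss(1)[OF k]] by simp
      qed
      finally show ?thesis .
    qed
    have "(\<Sum>i<?n. \<Sum>j<?n. S i j) = (\<Sum>i<?n. \<Sum>j<?n. dT (s i) (s j) j i - (\<Sum>k<?n. T (s j) j k * T (s i) i (s k))
      - (\<Sum>k<?n. T (s i) (s j) k * T (s k) j i) - (dT (s j) (s i) j i - (\<Sum>k<?n. T (s i) j k * T (s j) i (s k))
      - (\<Sum>k<?n. T (s j) (s i) k * T (s k) j i)))"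
      by (intro sum.cong refl S) simp_all
    then show ?thesis unfolding sum_subtractf A B E triple_sum_def by simp
  qed
  have "trE C (full_ricci C D) p = (\<Sum>j<?n. \<Sum>i<?n. gen_riemann C D (e i) (e j) (e (s i)) (e (s j)) p)"
    using trE_full_ricci_frame[OF F] by (simp only: rk)
  also have "\<dots> = (\<Sum>i<?n. \<Sum>j<?n. gen_riemann C D (e i) (e j) (e (s i)) (e (s j)) p)"
    by (rule sum.swap)
  also have "\<dots> = (\<Sum>i<?n. \<Sum>j<?n. 1 / 2 * (S i j + S (s j) (s i) - (\<Sum>k<?n. T k (s i) (s j) * T (s k) j i)))"
  proof (intro sum.cong refl)
    fix i j assume "i \<in> {..<?n}" "j \<in> {..<?n}"
    then have ij: "i < ?n" "j < ?n" by simp_all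
    show "gen_riemann C D (e i) (e j) (e (s i)) (e (s j)) p =
        1 / 2 * (S i j + S (s j) (s i) - (\<Sum>k<?n. T k (s i) (s j) * T (s k) j i))"
      unfolding gen_riemann_eq[OF F es[OF ij(1)] es[OF ij(2)] es[OF ss(1)[OF ij(1)]] es[OF ss(1)[OF ij(2)]]]
        S_def T_def ss(2)[OF ij(1)] ss(2)[OF ij(2)] rk ..
  qed
  also have "\<dots> = 1 / 2 * ((\<Sum>i<?n. \<Sum>j<?n. S i j) + (\<Sum>i<?n. \<Sum>j<?n. S (s j) (s i))
      - triple_sum ?n (\<lambda>i j k. T k (s i) (s j) * T (s k) j i))"
    by (simp only: sum_distrib_left[symmetric] sum.distrib sum_subtractf triple_sum_def)
  \<comment> \<open>Passing to dual indices and exchanging i and j permutes the summands.\<close>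
  also have "(\<Sum>i<?n. \<Sum>j<?n. S (s j) (s i)) = (\<Sum>i<?n. \<Sum>j<?n. S i j)"
    unfolding sums[of "\<lambda>j. S j (s _)"] sums[of "\<lambda>i. \<Sum>j<?n. S j i"] by (rule sum.swap)
  finally show ?thesis
    unfolding sumS using connection_coefficient_contractions[of r T, folded s_def, OF anti cyc]
    by (simp add: l_def d_def s_def)
qed

text \<open>Leibniz rule for x = \<Sum> \<langle>x, e' i\<rangle> e i. This expansion is only local
  while D acts on global sections, so the derivative is moved off x by metricity instead; skewness
  then turns the contracted coefficients into divergences.\<close>

lemma div_of_conn_isotropic_frame:
  assumes I: "isotropic_frame p r e" and x: "x \<in> sections C"
  shows "div_of_conn C D x p = (\<Sum>i<2 * r. app (anch C (e i)) (sprod C x (e (swap_half r i))) p)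
    + (\<Sum>i<2 * r. sprod C x (e (swap_half r i)) p * div_of_conn C D (e i) p)"
proof -
  let ?n = "2 * r" and ?s = "swap_half r"
  have rk: "rk C = ?n" using I by (simp add: isotropic_frame_def)
  have es: "e i \<in> sections C" if "i < ?n" for i using I that by (simp add: isotropic_frame_def)
  note ss = swap_half
  note F = eventually_nhds_x_imp_x[OF isotropic_frame_dual[OF I]]
  have "sprod C (D (e i) x) (e (?s i)) p = app (anch C (e i)) (sprod C x (e (?s i))) p
      - (\<Sum>k<?n. sprod C x (e (?s k)) p * sprod C (D (e i) (e (?s i))) (e k) p)" if i: "i < ?n" for i
  proof -
    note si = es[OF ss(1)[OF i]]
    have "app (anch C (e i)) (sprod C x (e (?s i))) p = sprod C (D (e i) x) (e (?s i)) p + sprod C x (D (e i) (e (?s i))) p"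
      using fun_cong[OF D_metric[OF es[OF i] x si], of p] by simp
    moreover have "sprod C x (D (e i) (e (?s i))) p = (\<Sum>k<?n. sprod C x (e (?s k)) p * sprod C (D (e i) (e (?s i))) (e k) p)"
      using sprod_dual_expand[OF dual_frames_swap[OF F] x D_section[OF es[OF i] si]] by (simp only: rk)
    ultimately show ?thesis by simp
  qed
  then have "div_of_conn C D x p = (\<Sum>i<?n. app (anch C (e i)) (sprod C x (e (?s i))) p
      - (\<Sum>k<?n. sprod C x (e (?s k)) p * sprod C (D (e i) (e (?s i))) (e k) p))"
    using div_of_conn_frame[OF F x] by (simp add: rk)
  also have "\<dots> = (\<Sum>i<?n. app (anch C (e i)) (sprod C x (e (?s i))) p)
      - (\<Sum>k<?n. sprod C x (e (?s k)) p * (\<Sum>i<?n. sprod C (D (e i) (e (?s i))) (e k) p))"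
    unfolding sum_subtractf sum_distrib_left by (subst sum.swap) (rule refl)
  also have "(\<Sum>k<?n. sprod C x (e (?s k)) p * (\<Sum>i<?n. sprod C (D (e i) (e (?s i))) (e k) p)) =
      (\<Sum>k<?n. - (sprod C x (e (?s k)) p * div_of_conn C D (e k) p))"
  proof (intro sum.cong refl)
    fix k assume "k \<in> {..<?n}"
    then have k: "k < ?n" by simp
    have "sprod C (D (e i) (e (?s i))) (e k) p = - sprod C (D (e i) (e k)) (e (?s i)) p" if "i < ?n" for i
      using eventually_nhds_x_imp_x[OF isotropic_frame_coefficients[OF I]] that k ss(1)[OF that] by blast
    then show "sprod C x (e (?s k)) p * (\<Sum>i<?n. sprod C (D (e i) (e (?s i))) (e k) p) =
        - (sprod C x (e (?s k)) p * div_of_conn C D (e k) p)"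
      unfolding div_of_conn_frame[OF F es[OF k]] rk by (simp add: sum_negf)
  qed
  finally show ?thesis by (simp add: sum_negf)
qed

text \<open>In each dual pair one member is a gradient, on which the anchor and \<open>d0\<close>
  vanish. This leaves the sum of \<pi>(e' i)\<langle>x, e i\<rangle> and that of \<langle>x, e'
  i\<rangle> d0(e i), each taken twice, and \<langle>x, x\<rangle>. By the Leibniz rule for the
  divergence the first two sums together are \<open>d0 x\<close>.\<close>

theorem trE_full_ricci:
  assumes df: "\<And>v. v \<in> sections C \<Longrightarrow> div_of_conn C D v \<in> fns C" and x: "x \<in> sections C"
    and d0: "\<And>v. v \<in> sections C \<Longrightarrow> div_of_conn C D v = d0 v - sprod C x v"
    and ker: "\<And>v. v \<in> sections C \<Longrightarrow> anch C v = 0 \<Longrightarrow> d0 v = 0"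
  shows "trE C (full_ricci C D) p = 2 * d0 x p - sprod C x x p"
proof -
  obtain r e where I: "isotropic_frame p r e" using isotropic_frame_exists by blast
  let ?n = "2 * r"
  define s where "s = swap_half r"
  have rk: "rk C = ?n" using I by (simp add: isotropic_frame_def)
  have es: "e i \<in> sections C" if "i < ?n" for i using I that by (simp add: isotropic_frame_def)
  have ea: "anch C (e i) = 0" if "i < r" for i
    using I that by (intro gradient_anch) (simp add: isotropic_frame_def)
  have ss: "s a < ?n" "s (s a) = a" "s a < r \<longleftrightarrow> \<not> a < r" if "a < ?n" for a
    using that by (simp_all add: s_def swap_half)
  have F: "dual_frames (sections C) (rk C) (scal C) p e (\<lambda>i. e (s i))"
    unfolding s_def by (rule eventually_nhds_x_imp_x[OF isotropic_frame_dual[OF I]])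
  have sums: "(\<Sum>i<?n. f (s i)) = (\<Sum>i<?n. f i)" for f :: "nat \<Rightarrow> real"
    unfolding s_def by (rule sum_swap_half)
  have d0e: "d0 (e i) p = 0" if "i < r" for i using ker[OF es ea, of i] that by simp
  define y where "y i = sprod C x (e i) p" for i
  define a where "a i = app (anch C (e (s i))) (sprod C x (e i)) p" for i
  have div: "div_of_conn C D (e i) p = d0 (e i) p - y i" if "i < ?n" for i
    using d0[OF es[OF that]] by (simp add: y_def)
  \<comment> \<open>For i < r the function \<open>d0 (e i)\<close> is identically 0, which allows
    its derivative to be dropped; otherwise the dual vector is a gradient and both sides vanish with
    its anchor.\<close>
  have l: "app (anch C (e (s i))) (div_of_conn C D (e i)) p = - a i" if i: "i < ?n" for i
  proof (cases "i < r")
    case True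
    then have "div_of_conn C D (e i) = (\<lambda>q. - 1 * sprod C x (e i) q)"
      using d0[OF es[OF i]] ker[OF es[OF i] ea[OF True]] by (simp add: fun_eq_iff)
    then show ?thesis
      using tangent_scale[OF manifold anch_tangent[OF es[OF ss(1)[OF i]]] sprod_fns[OF x es[OF i]], of p "- 1"]
      by (simp add: app_def a_def)
  next
    case False
    then have "anch C (e (s i)) = 0" using ea ss(3)[OF i] by simp
    then show ?thesis by (simp add: app_def a_def)
  qed
  have "trE C (full_ricci C D) p = - 2 * (\<Sum>i<?n. app (anch C (e (s i))) (div_of_conn C D (e i)) p)
    - (\<Sum>i<?n. div_of_conn C D (e i) p * div_of_conn C D (e (s i)) p)"
    unfolding s_def by (rule trE_full_ricci_isotropic_frame[OF I df])
  also have "(\<Sum>i<?n. app (anch C (e (s i))) (div_of_conn C D (e i)) p) = - (\<Sum>i<?n. a i)"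
    unfolding sum_negf[symmetric] by (intro sum.cong refl l) simp
  also have "(\<Sum>i<?n. div_of_conn C D (e i) p * div_of_conn C D (e (s i)) p) =
      (\<Sum>i<?n. y i * y (s i) - (d0 (e i) p * y (s i) + y i * d0 (e (s i)) p))"
  proof (intro sum.cong refl)
    fix i assume "i \<in> {..<?n}"
    then have i: "i < ?n" by simp
    \<comment> \<open>This removes the product of the two \<open>d0\<close> values and keeps the
      mixed terms.\<close>
    have "d0 (e i) p = 0 \<or> d0 (e (s i)) p = 0" using d0e ss(3)[OF i] by (cases "i < r") simp_all
    then show "div_of_conn C D (e i) p * div_of_conn C D (e (s i)) p =
        y i * y (s i) - (d0 (e i) p * y (s i) + y i * d0 (e (s i)) p)"
      unfolding div[OF i] div[OF ss(1)[OF i]] by (elim disjE) (simp_all add: algebra_simps)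
  qed
  also have "\<dots> = (\<Sum>i<?n. y i * y (s i)) - 2 * (\<Sum>i<?n. y (s i) * d0 (e i) p)"
  proof -
    have "(\<Sum>i<?n. y i * d0 (e (s i)) p) = (\<Sum>i<?n. y (s (s i)) * d0 (e (s i)) p)"
      by (intro sum.cong refl) (simp add: ss)
    also have "\<dots> = (\<Sum>i<?n. y (s i) * d0 (e i) p)" by (rule sums)
    finally show ?thesis by (simp add: sum_subtractf sum.distrib mult.commute)
  qed
  finally have tr: "trE C (full_ricci C D) p = 2 * (\<Sum>i<?n. a i) + 2 * (\<Sum>i<?n. y (s i) * d0 (e i) p) - (\<Sum>i<?n. y i * y (s i))"
    by simp
  have xx: "sprod C x x p = (\<Sum>i<?n. y i * y (s i))"
    using sprod_dual_expand[OF F x x] by (simp add: rk y_def)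
  have "d0 x p = div_of_conn C D x p + sprod C x x p" using d0[OF x] by simp
  also have "div_of_conn C D x p = (\<Sum>i<?n. app (anch C (e i)) (sprod C x (e (s i))) p)
      + (\<Sum>i<?n. y (s i) * div_of_conn C D (e i) p)"
    using div_of_conn_isotropic_frame[OF I x] by (simp add: s_def y_def)
  also have "(\<Sum>i<?n. app (anch C (e i)) (sprod C x (e (s i))) p) = (\<Sum>i<?n. a (s i))"
    by (intro sum.cong refl) (simp add: a_def ss)
  also have "\<dots> = (\<Sum>i<?n. a i)" by (rule sums)
  also have "(\<Sum>i<?n. y (s i) * div_of_conn C D (e i) p) = (\<Sum>i<?n. y (s i) * d0 (e i) p) - (\<Sum>i<?n. y i * y (s i))"
    unfolding sum_subtractf[symmetric] by (intro sum.cong refl) (simp add: div algebra_simps)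
  finally show ?thesis unfolding tr by (simp add: xx)
qed

end

section \<open>The generalised metric and the components of a section in the eigenbundles\<close>

context exact_courant_bundle
begin

lemma dual_frames_exist: "\<exists>e e'. dual_frames (sections C) (rk C) (scal C) p e e'"
proof -
  obtain r e where "isotropic_frame p r e" using isotropic_frame_exists by blast
  then have "dual_frames (sections C) (rk C) (scal C) p e (\<lambda>i. e (swap_half r i))"
    by (rule eventually_nhds_x_imp_x[OF isotropic_frame_dual])
  then show ?thesis by blast
qed

text \<open>The definite description in \<open>Gend\<close> is justified: \<Sum> G(x, e i) e' i
  represents G(x, .) for dual frames e, e', and nondegeneracy makes the representative
  unique.\<close>

lemma Gend_characterization:
  assumes G: "fibre_metric C G" and x: "x \<in> fibre C p"
  shows "Gend C G p x \<in> fibre C p \<and> (\<forall>v\<in>fibre C p. scal C p (Gend C G p x) v = G p x v)"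
  unfolding Gend_def
proof (rule theI')
  obtain e e' where F: "dual_frames (sections C) (rk C) (scal C) p e e'" using dual_frames_exist by blast
  have e: "e i p \<in> fibre C p" "e' i p \<in> fibre C p" if "i < rk C" for i
    using F that by (simp_all add: dual_frames_def section_fibre)
  have lin: "linear_on (fibre C p) (G p x)"
    using G x by (simp add: fibre_metric_def bilinear_on_def)
  have Gsum: "G p x (\<Sum>i\<in>I. c i *\<^sub>R z i) = (\<Sum>i\<in>I. c i * G p x (z i))"
    if "\<And>i. i \<in> I \<Longrightarrow> z i \<in> fibre C p" for I :: "nat set" and c z
    using that
  proof (induction I rule: infinite_finite_induct)
    case (insert i I)
    then have "c i *\<^sub>R z i \<in> fibre C p" "(\<Sum>i\<in>I. c i *\<^sub>R z i) \<in> fibre C p"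
      by (auto intro!: fibre_intros)
    then show ?case using lin insert by (simp add: linear_on_def)
  qed (use lin fibre_intros(5) in \<open>force simp: linear_on_def\<close>)+
  define y where "y = (\<Sum>i<rk C. G p x (e i p) *\<^sub>R e' i p)"
  have y: "y \<in> fibre C p" unfolding y_def by (intro fibre_intros e) simp
  have yv: "scal C p y v = G p x v" if v: "v \<in> fibre C p" for v
  proof -
    have "scal C p y v = (\<Sum>i<rk C. G p x (e i p) * scal C p (e' i p) v)"
      unfolding y_def by (rule scal_sum_left) (simp_all add: e v)
    also have "\<dots> = (\<Sum>i<rk C. scal C p (e' i p) v * G p x (e i p))" by (simp add: mult.commute)
    also have "\<dots> = G p x (\<Sum>i<rk C. scal C p (e' i p) v *\<^sub>R e i p)"
      by (rule Gsum[symmetric]) (simp add: e)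
    also have "\<dots> = G p x v" using dual_frames_expand[OF F v] by simp
    finally show ?thesis .
  qed
  show "\<exists>!w. w \<in> fibre C p \<and> (\<forall>v\<in>fibre C p. scal C p w v = G p x v)"
  proof (rule ex1I[of _ y])
    show "y \<in> fibre C p \<and> (\<forall>v\<in>fibre C p. scal C p y v = G p x v)" using y yv by blast
    fix w assume w: "w \<in> fibre C p \<and> (\<forall>v\<in>fibre C p. scal C p w v = G p x v)"
    have "w - y = 0"
    proof (rule scal_nondegenerate)
      show "w - y \<in> fibre C p" using w y by (intro fibre_intros) simp_all
      show "scal C p (w - y) v = 0" if "v \<in> fibre C p" for v
        using w y yv that by (simp add: scal_diff_left)
    qed
    then show "w = y" by simp
  qed
qed

text \<open>With g the image of x under the involution, polarisation reduces the difference for (x +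
  g) / 2 and (x - g) / 2 to G(x, g). The vector representing G(g, .) is the image of g, which is x
  again, so G(g, x) = \<langle>x, x\<rangle>.\<close>

lemma generalised_metric_projections:
  assumes G: "generalised_metric C G" and u: "u \<in> sections C"
  shows "G p (proj C G 1 u p) (proj C G 1 u p) - G p (proj C G (- 1) u p) (proj C G (- 1) u p) = sprod C u u p"
proof -
  let ?V = "fibre C p"
  define x where "x = u p"
  define g where "g = Gend C G p x"
  have fm: "fibre_metric C G" and inv: "Gend C G p (Gend C G p v) = v" if "v \<in> ?V" for v
    using G that by (simp_all add: generalised_metric_def)
  have x: "x \<in> ?V" unfolding x_def by (rule section_fibre[OF u])
  note fm = fm[OF x]
  have g: "g \<in> ?V" using Gend_characterization[OF fm x] by (simp add: g_def)
  have bl: "bilinear_on ?V (G p)" and sym: "sym_on ?V (G p)"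
    using fm by (simp_all add: fibre_metric_def)
  have "scal C p (Gend C G p g) x = G p g x"
    using Gend_characterization[OF fm g] x by blast
  then have Ggx: "G p g x = scal C p x x" using inv[OF x] by (simp add: g_def)
  have Gxg: "G p x g = scal C p x x" using Ggx sym x g by (simp add: sym_on_def)
  have half: "G p ((1 / 2) *\<^sub>R a) ((1 / 2) *\<^sub>R a) = 1 / 4 * G p a a" if "a \<in> ?V" for a
    using bl that fibre_intros(3)[OF that, of "1 / 2"] by (simp add: bilinear_on_def linear_on_def)
  have quad: "G p (x + s *\<^sub>R g) (x + s *\<^sub>R g) = G p x x + s * (G p x g + G p g x) + s * s * G p g g" for s
    using bl x g fibre_intros(3)[OF g, of s] fibre_intros(1)[OF x fibre_intros(3)[OF g, of s]]
    by (simp add: bilinear_on_def linear_on_def algebra_simps)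
  have "x + s *\<^sub>R g \<in> ?V" for s by (intro fibre_intros x g)
  from half[OF this] have q: "G p (proj C G s u p) (proj C G s u p) =
      1 / 4 * (G p x x + s * (G p x g + G p g x) + s * s * G p g g)" for s
    unfolding proj_def using quad by (simp add: x_def g_def)
  show ?thesis unfolding q[of 1] q[of "- 1"] by (simp add: Ggx Gxg sprod_def field_simps flip: x_def)
qed

end

theorem corollary4p5:
  fixes C :: "('m::{t2_space, second_countable_topology}, 'n::euclidean_space, 'v::real_vector) courant"
    and G :: "('m, 'v) form"
    and nabla :: "'m vfield \<Rightarrow> 'm vfield \<Rightarrow> 'm vfield"
    and e :: "'m \<Rightarrow> 'v"
    and dv :: "('m \<Rightarrow> 'v) \<Rightarrow> 'm \<Rightarrow> real"
    and D :: "('m, 'v) gconn"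
    and p :: 'm
  assumes "exact_courant_algebroid C"
    and "DIM('n) \<ge> 2"
    and "generalised_metric C G"
    and "levi_civita (atlas C) (base_metric C G) nabla"
    and "e \<in> sections C"
    and "divergence_operator C dv"
    and "\<forall>v\<in>sections C. dv v = metric_div C G nabla v - sprod C e v"
    and "canonical_glc C G nabla dv D"
  shows "trE C (full_ricci C D) p =
    2 * metric_div C G nabla e p
      - (G p (proj C G 1 e p) (proj C G 1 e p) - G p (proj C G (-1) e p) (proj C G (-1) e p))"
proof -
  note ex = assms(1) and G = assms(3) and e = assms(5) and dv = assms(7)
  have glc: "gen_levi_civita C G D" and dD: "\<And>v. v \<in> sections C \<Longrightarrow> div_of_conn C D v = dv v"
    using assms(8) by (simp_all add: canonical_glc_def)
  interpret torsion_free_connection C D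
  proof
    show "courant_algebroid C" using ex by (simp add: exact_courant_algebroid_def)
    show "exact_courant_algebroid C" by (rule ex)
    show "generalised_connection C D" using glc by (simp add: gen_levi_civita_def)
    show "torsion C D u v w = 0" if "u \<in> sections C" "v \<in> sections C" "w \<in> sections C" for u v w
      using glc that by (simp add: gen_levi_civita_def)
  qed
  let ?d = "metric_div C G nabla"
  have dv_fns: "dv v \<in> fns C" if "v \<in> sections C" for v
    using assms(6) that unfolding divergence_operator_def by blast
  \<comment> \<open>\<open>metric_div\<close> depends on a section only through its anchor, so it
    vanishes on the kernel of the anchor once it does at 0. Its value at 0 is read off from the
    additivity of \<open>dv\<close>.\<close>
  have "dv (0 + 0) = dv 0 + dv 0"
    using assms(6) section_zero unfolding divergence_operator_def by blast
  then have "dv 0 = 0" by simp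
  moreover have "sprod C e 0 = 0"
    using sprod_smul_right[OF e section_zero, of "\<lambda>_. 0"] by (simp add: smul_def zero_fun_def times_fun_def)
  ultimately have d0: "?d 0 = 0"
    using dv section_zero by (simp add: eq_diff_eq)
  have "trE C (full_ricci C D) p = 2 * ?d e p - sprod C e e p"
  proof (rule trE_full_ricci)
    show "div_of_conn C D v \<in> fns C" if "v \<in> sections C" for v
      unfolding dD[OF that] by (rule dv_fns[OF that])
    show "div_of_conn C D v = ?d v - sprod C e v" if "v \<in> sections C" for v
      unfolding dD[OF that] by (rule bspec[OF dv that])
    show "?d v = 0" if "v \<in> sections C" "anch C v = 0" for v
    proof -
      have "anch C v = anch C 0" using that(2) by (auto simp: fun_eq_iff anch_eq anchor_zero)
      then show ?thesis using d0 by (simp only: metric_div_def)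
    qed
  qed (rule e)
  then show ?thesis unfolding generalised_metric_projections[OF G e] .
qed

end
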